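(* Let $G$ be any two-step nilpotent group with rank-one commutator. Then $\mathcal{EP}_1$ is decidable in $G$; that is, there is an algorithm which, given any single equation $w=1$ in $G$, decides whether the equation has a solution in $G$. In particular, $\mathcal{EP}_1$ is decidable in the Heisenberg group $H(\mathbb{Z})=N(2,2)$.
   Context: Commutators: $[a,b]$ is the usual commutator, and nested commutators are left-normed: $[a,b,c]=[[a,b],c]$, and so on. A finitely generated group is called $k$-step nilpotent if all nested commutators with $k+1$ arguments are trivial, but not all those with $k$ arguments; in particular nilpotent groups here are finitely generated. A two-step nilpotent group $G$ has rank-one commutator if the (finitely generated abelian) commutator subgroup $[G,G]$ has rank one, i.e. $[G,G]\cong \mathbb{Z}\oplus T$ with $T$ a finite abelian group. (Torsion is allowed both in $[G,G]$ and in $G/[G,G]$.) An equation in a group $G$ is an expression $w=1$, where $w$ is a word written as a product of constants (fixed elements of $G$, given as words in a fixed finite generating set) and variables and their inverses. A solution is an assignment of elements of $G$ to the variables making $w$ equal to the identity. $\mathcal{EP}_1$ in $G$ is the decision problem of determining, for a given single equation in any finite number of variables, whether it has a solution in $G$. The group $G$ is fixed and the equation is the input. $H(\mathbb{Z})=\langle a,b : [a,b,a],[a,b,b]\rangle$ is the discrete Heisenberg group. $N(p,q)=F_q/H_{p+1}$ is the free nilpotent group of step $p$ and rank $q$, where $F_q$ is the free group on $q$ generators and $H_{i}$ is its lower central series, $H_1=F_q$, $H_{i+1}=[H_i,F_q]$. *)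

theory Defs
  imports
    "HOL-Algebra.Generated_Groups"
    "HOL-Algebra.Elementary_Groups"
    "HOL-Library.Nat_Bijection"
begin

section \<open>Recursive functions and decidable sets\<close>

text \<open>
  Codes of Kleene's partial recursive functions, with a big-step semantics:
  \<open>rec_eval f xs y\<close> means that the function with code \<open>f\<close> is defined at \<open>xs\<close>, with value \<open>y\<close>.
  Codes carry no arities; a code applied to too few arguments is simply undefined there.
\<close>

datatype recf =
    Zero
  | Succ
  | Proj nat
  | Comp recf "recf list"
  | PrimRec recf recf
  | Mu recf

inductive rec_eval :: "recf \<Rightarrow> nat list \<Rightarrow> nat \<Rightarrow> bool" where
  zero: "rec_eval Zero xs 0"
| succ: "rec_eval Succ [x] (Suc x)"
| proj: "i < length xs \<Longrightarrow> rec_eval (Proj i) xs (xs ! i)"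
| comp: "list_all2 (\<lambda>g y. rec_eval g xs y) gs ys \<Longrightarrow> rec_eval f ys z \<Longrightarrow> rec_eval (Comp f gs) xs z"
| primrec_0: "rec_eval f xs y \<Longrightarrow> rec_eval (PrimRec f g) (0 # xs) y"
| primrec_Suc:
    "rec_eval (PrimRec f g) (n # xs) r \<Longrightarrow> rec_eval g (n # r # xs) y \<Longrightarrow>
     rec_eval (PrimRec f g) (Suc n # xs) y"
| mu: "rec_eval f (n # xs) 0 \<Longrightarrow> (\<forall>m<n. \<exists>y. rec_eval f (m # xs) (Suc y)) \<Longrightarrow> rec_eval (Mu f) xs n"

definition decidable_set :: "nat set \<Rightarrow> bool" where
  "decidable_set A \<longleftrightarrow> (\<exists>f. \<forall>n. rec_eval f [n] (if n \<in> A then 1 else 0))"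


section \<open>Nilpotent groups with rank-one commutator\<close>

definition finitely_generated :: "('a, 'b) monoid_scheme \<Rightarrow> bool" where
  "finitely_generated G \<longleftrightarrow>
     (\<exists>S. finite S \<and> S \<subseteq> carrier G \<and> generate G S = carrier G)"

text \<open>The convention for \<open>[x, y]\<close> is the one of the library's \<^const>\<open>derived\<close> subgroup.\<close>

definition commutator :: "('a, 'b) monoid_scheme \<Rightarrow> 'a \<Rightarrow> 'a \<Rightarrow> 'a" where
  "commutator G x y = x \<otimes>\<^bsub>G\<^esub> y \<otimes>\<^bsub>G\<^esub> inv\<^bsub>G\<^esub> x \<otimes>\<^bsub>G\<^esub> inv\<^bsub>G\<^esub> y"

text \<open>
  \<open>nested_commutator G [x\<^sub>1, \<dots>, x\<^sub>k] = [\<dots>[[x\<^sub>1, x\<^sub>2], x\<^sub>3], \<dots>, x\<^sub>k]\<close>;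
  it is only meant for nonempty lists.
\<close>

definition nested_commutator :: "('a, 'b) monoid_scheme \<Rightarrow> 'a list \<Rightarrow> 'a" where
  "nested_commutator G xs = foldl (commutator G) (hd xs) (tl xs)"

definition step_nilpotent :: "('a, 'b) monoid_scheme \<Rightarrow> nat \<Rightarrow> bool" where
  "step_nilpotent G k \<longleftrightarrow>
     group G \<and> finitely_generated G \<and> 1 \<le> k \<and>
     (\<forall>xs. set xs \<subseteq> carrier G \<and> length xs = k + 1 \<longrightarrow> nested_commutator G xs = \<one>\<^bsub>G\<^esub>) \<and>
     \<not> (\<forall>xs. set xs \<subseteq> carrier G \<and> length xs = k \<longrightarrow> nested_commutator G xs = \<one>\<^bsub>G\<^esub>)"

text \<open>
  Taking \<open>T\<close> over the element type of \<open>G\<close> loses nothing, since such a \<open>T\<close> embeds in \<open>G\<close>.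
\<close>

definition rank_one_commutator :: "('a, 'b) monoid_scheme \<Rightarrow> bool" where
  "rank_one_commutator G \<longleftrightarrow>
     (\<exists>T :: 'a monoid. comm_group T \<and> finite (carrier T) \<and>
        G\<lparr>carrier := derived G (carrier G)\<rparr> \<cong> integer_group \<times>\<times> T)"


section \<open>Equations in a group\<close>

text \<open>
  Constants are words in a generating tuple \<open>gs\<close>: \<open>Gen i\<close> denotes \<open>gs ! i\<close>.
  A letter is paired with \<open>True\<close> when it occurs inverted.
  The word \<open>w\<close> stands for the equation \<open>w = 1\<close>.
\<close>

datatype symbol = Gen nat | Var nat

type_synonym equation = "(symbol \<times> bool) list"

definition is_equation :: "'a list \<Rightarrow> equation \<Rightarrow> bool" where
  "is_equation gs w \<longleftrightarrow> (\<forall>i e. (Gen i, e) \<in> set w \<longrightarrow> i < length gs)"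

primrec symbol_value :: "'a list \<Rightarrow> (nat \<Rightarrow> 'a) \<Rightarrow> symbol \<Rightarrow> 'a" where
  "symbol_value gs \<sigma> (Gen i) = gs ! i"
| "symbol_value gs \<sigma> (Var j) = \<sigma> j"

primrec word_value ::
  "('a, 'b) monoid_scheme \<Rightarrow> 'a list \<Rightarrow> (nat \<Rightarrow> 'a) \<Rightarrow> equation \<Rightarrow> 'a" where
  "word_value G gs \<sigma> [] = \<one>\<^bsub>G\<^esub>"
| "word_value G gs \<sigma> (l # w) =
     (let x = symbol_value gs \<sigma> (fst l) in if snd l then inv\<^bsub>G\<^esub> x else x) \<otimes>\<^bsub>G\<^esub> word_value G gs \<sigma> w"

definition has_solution :: "('a, 'b) monoid_scheme \<Rightarrow> 'a list \<Rightarrow> equation \<Rightarrow> bool" where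
  "has_solution G gs w \<longleftrightarrow>
     (\<exists>\<sigma>. (\<forall>j. \<sigma> j \<in> carrier G) \<and> word_value G gs \<sigma> w = \<one>\<^bsub>G\<^esub>)"

primrec symbol_encode :: "symbol \<Rightarrow> nat" where
  "symbol_encode (Gen i) = 2 * i"
| "symbol_encode (Var j) = 2 * j + 1"

definition equation_encode :: "equation \<Rightarrow> nat" where
  "equation_encode w = list_encode (map (\<lambda>(s, e). 2 * symbol_encode s + of_bool e) w)"

text \<open>
  The algorithm may depend on \<open>G\<close> and on the generating tuple, but not on the equation.
  Finite generation is part of the definition so that it is not vacuous
  for groups without a finite generating tuple.
\<close>

definition EP1_decidable :: "('a, 'b) monoid_scheme \<Rightarrow> bool" where
  "EP1_decidable G \<longleftrightarrow>
     finitely_generated G \<and>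
     (\<forall>gs. set gs \<subseteq> carrier G \<and> generate G (set gs) = carrier G \<longrightarrow>
        decidable_set (equation_encode ` {w. is_equation gs w \<and> has_solution G gs w}))"


section \<open>Free groups, free nilpotent groups and the Heisenberg group\<close>

text \<open>
  The free group on \<open>{..<q}\<close> consists of the freely reduced words;
  the product concatenates and reduces.
  As above, \<open>True\<close> marks an inverted letter.
\<close>

type_synonym fword = "(nat \<times> bool) list"

definition cancels :: "nat \<times> bool \<Rightarrow> nat \<times> bool \<Rightarrow> bool" where
  "cancels x y \<longleftrightarrow> fst x = fst y \<and> snd x \<noteq> snd y"

fun reduced_Cons :: "nat \<times> bool \<Rightarrow> fword \<Rightarrow> fword" where
  "reduced_Cons x [] = [x]"
| "reduced_Cons x (y # ys) = (if cancels x y then ys else x # y # ys)"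

definition free_group :: "nat \<Rightarrow> fword monoid" where
  "free_group q =
     \<lparr>carrier = {w. fst ` set w \<subseteq> {..<q} \<and> successively (\<lambda>x y. \<not> cancels x y) w},
      monoid.mult = (\<lambda>v w. foldr reduced_Cons v w),
      one = []\<rparr>"

abbreviation free_gen :: "nat \<Rightarrow> fword" where
  "free_gen i \<equiv> [(i, False)]"

text \<open>The indices start at 0: \<open>lower_central_series G i\<close> is the term usually called \<open>H\<^sub>i\<^sub>+\<^sub>1\<close>.\<close>

primrec lower_central_series :: "('a, 'b) monoid_scheme \<Rightarrow> nat \<Rightarrow> 'a set" where
  "lower_central_series G 0 = carrier G"
| "lower_central_series G (Suc i) =
     generate G {commutator G h g | h g. h \<in> lower_central_series G i \<and> g \<in> carrier G}"

definition free_nilpotent_group :: "nat \<Rightarrow> nat \<Rightarrow> fword set monoid" where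
  "free_nilpotent_group p q = free_group q Mod lower_central_series (free_group q) p"

definition normal_closure :: "('a, 'b) monoid_scheme \<Rightarrow> 'a set \<Rightarrow> 'a set" where
  "normal_closure G S = \<Inter>{N. N \<lhd> G \<and> S \<subseteq> N}"

definition presented_group :: "nat \<Rightarrow> fword set \<Rightarrow> fword set monoid" where
  "presented_group q R = free_group q Mod normal_closure (free_group q) R"

definition heisenberg_group :: "fword set monoid" where
  "heisenberg_group =
     (let F = free_group 2; a = free_gen 0; b = free_gen 1
      in presented_group 2 {nested_commutator F [a, b, a], nested_commutator F [a, b, b]})"

end

theory Submission
  imports Defs "HOL-Algebra.Multiplicative_Group"
begin

text \<open>
  Let \<open>C = [G, G]\<close>, let \<open>\<tau> : C \<rightarrow> \<int>\<close> be the projection with finite kernel, and let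
  \<open>P(M)\<close> be the set of products \<open>h\<^sup>2\<^sup>M c\<^sup>M\<close> with \<open>h \<in> G\<close>, \<open>c \<in> C\<close>. The heart of the matter is a
  local-global principle: \<open>w = 1\<close> is solvable as soon as, for every \<open>M\<close>, some assignment takes
  \<open>w\<close> into \<open>P(M)\<close>. If a variable has exponent sum \<open>e \<noteq> 0\<close>, then \<open>M = e\<^sup>2\<close> suffices, because an
  error in \<open>P(e\<^sup>2)\<close> can be absorbed into that variable. If all exponent sums vanish, the value of
  \<open>w\<close> lies in \<open>C\<close>, up to central factors it depends on two variables \<open>x, y\<close> as
  \<open>[x, y]\<^sup>a [x, H] [y, K]\<close>, and if \<open>a \<noteq> 0\<close> the error is corrected by multiplying \<open>x\<close> and \<open>y\<close> by
  words in two elements \<open>e, f\<close> with \<open>\<tau>[e, f] \<noteq> 0\<close>: the integer equation that arises asks for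
  \<open>u \<cdot> y + v \<cdot> x = 0\<close>, \<open>x \<cdot> y = k\<close> with \<open>x, y \<in> \<int>\<^sup>2\<close>, which is always solvable by a Euclidean descent.
  No general theorem on quadratic Diophantine equations is needed. If all \<open>a\<close> vanish, \<open>w\<close> is
  affine in the variables.

  Hence one may search simultaneously for an exact solution and for a modulus without
  approximate solutions. Both are recursive conditions on integer coordinates for the free
  two-step nilpotent group, of which \<open>G\<close> is the quotient by a finitely generated subgroup.
\<close>

section \<open>Closure properties of recursive functions\<close>

text \<open>When all exponent sums vanish, rank one is what reduces the correction of an error to
  one integer equation: \<open>\<tau>\<close> determines an element of \<open>C\<close> up to a
  finite group killed by \<open>N\<close>, so corrections are made by \<open>N\<close>-th powers and
  errors are required to be divisible by extra factors \<open>N\<close>. In higher rank the same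
  corrections would have to solve several quadratic equations at once. The quotient
  \<open>G/C\<close> then enters in two ways: only the trivial element is an \<open>M\<close>-th
  power for every \<open>M\<close>, which puts the values of \<open>w\<close> into \<open>C\<close>;
  and its torsion has bounded exponent \<open>R\<close>, so that the factor \<open>h^(2M)\<close> of
  an error in \<open>C\<close> can be rewritten as a power of an element of \<open>C\<close>. The
  shape of \<open>P(M)\<close> comes from collection: elements whose coordinates are all divisible
  by \<open>2M\<close> have this form. Finally, a congruence between coordinates involves only
  finitely many residues of the unknowns, so a modulus without approximate solutions is recognised
  by a finite search.\<close>

definition rec_fn :: "nat \<Rightarrow> (nat list \<Rightarrow> nat) \<Rightarrow> bool" where
  "rec_fn n F \<longleftrightarrow> (\<exists>r. \<forall>xs. length xs = n \<longrightarrow> rec_eval r xs (F xs))"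

lemma rec_fn_cong:
  assumes "rec_fn n F" and "\<And>xs. length xs = n \<Longrightarrow> F xs = G xs"
  shows "rec_fn n G"
  using assms unfolding rec_fn_def by metis

lemma rec_fn_nth: "i < n \<Longrightarrow> rec_fn n (\<lambda>xs. xs ! i)"
  unfolding rec_fn_def using rec_eval.proj by blast

lemma rec_fn_Suc:
  assumes "rec_fn n F" shows "rec_fn n (\<lambda>xs. Suc (F xs))"
proof -
  obtain r where r: "\<And>xs. length xs = n \<Longrightarrow> rec_eval r xs (F xs)"
    using assms unfolding rec_fn_def by blast
  have "rec_eval (Comp Succ [r]) xs (Suc (F xs))" if "length xs = n" for xs
    by (rule rec_eval.comp[where ys = "[F xs]"]) (use r that in \<open>auto intro: rec_eval.succ\<close>)
  then show ?thesis unfolding rec_fn_def by blast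
qed

lemma rec_fn_const: "rec_fn n (\<lambda>_. c)"
proof (induction c)
  case 0 show ?case unfolding rec_fn_def using rec_eval.zero by blast
next
  case (Suc c) then show ?case by (rule rec_fn_Suc)
qed

lemma rec_fn_list:
  assumes "\<And>F. F \<in> set Fs \<Longrightarrow> rec_fn n F"
  shows "\<exists>rs. \<forall>xs. length xs = n \<longrightarrow> list_all2 (\<lambda>r y. rec_eval r xs y) rs (map (\<lambda>F. F xs) Fs)"
  using assms
proof (induction Fs)
  case Nil then show ?case by auto
next
  case (Cons F Fs)
  obtain r where r: "\<And>xs. length xs = n \<Longrightarrow> rec_eval r xs (F xs)"
    using Cons.prems[of F] unfolding rec_fn_def by auto
  obtain rs where "\<forall>xs. length xs = n \<longrightarrow> list_all2 (\<lambda>r y. rec_eval r xs y) rs (map (\<lambda>F. F xs) Fs)"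
    using Cons.IH Cons.prems by auto
  with r have "\<forall>xs. length xs = n \<longrightarrow>
      list_all2 (\<lambda>r y. rec_eval r xs y) (r # rs) (map (\<lambda>F. F xs) (F # Fs))"
    by simp
  then show ?case by blast
qed

lemma rec_fn_comp:
  assumes "rec_fn m H" and "\<And>F. F \<in> set Fs \<Longrightarrow> rec_fn n F" and "length Fs = m"
  shows "rec_fn n (\<lambda>xs. H (map (\<lambda>F. F xs) Fs))"
proof -
  obtain r where r: "\<And>xs. length xs = m \<Longrightarrow> rec_eval r xs (H xs)"
    using assms(1) unfolding rec_fn_def by blast
  obtain rs where rs: "\<forall>xs. length xs = n \<longrightarrow>
      list_all2 (\<lambda>r y. rec_eval r xs y) rs (map (\<lambda>F. F xs) Fs)"
    using rec_fn_list[OF assms(2)] by blast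
  have "rec_eval (Comp r rs) xs (H (map (\<lambda>F. F xs) Fs))" if "length xs = n" for xs
    using rs that r[of "map (\<lambda>F. F xs) Fs"] assms(3) by (auto intro: rec_eval.comp)
  then show ?thesis unfolding rec_fn_def by blast
qed

lemma rec_fn_comp1:
  assumes "rec_fn 1 (\<lambda>xs. h (xs ! 0))" "rec_fn n F" shows "rec_fn n (\<lambda>xs. h (F xs))"
  using rec_fn_comp[OF assms(1), of "[F]" n] assms(2) by simp

text \<open>Substitution for the head argument, with the tail passed on unchanged: bodies with one
  extra bound variable are given by \<open>hd\<close> and \<open>tl\<close> of an extended argument
  list.\<close>

lemma rec_fn_Cons:
  assumes "rec_fn (Suc n) (\<lambda>ys. G (hd ys) (tl ys))" "rec_fn n K"
  shows "rec_fn n (\<lambda>xs. G (K xs) xs)"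
proof -
  have "rec_fn n (\<lambda>xs. G (hd (map (\<lambda>F. F xs) (K # map (\<lambda>i xs. xs ! i) [0..<n])))
      (tl (map (\<lambda>F. F xs) (K # map (\<lambda>i xs. xs ! i) [0..<n]))))"
    by (rule rec_fn_comp[OF assms(1)]) (use assms(2) rec_fn_nth in auto)
  then show ?thesis
    by (rule rec_fn_cong) (auto simp: o_def map_nth)
qed

lemma rec_fn_rec_nat:
  assumes "rec_fn n F0" "rec_fn (Suc (Suc n)) (\<lambda>ys. G (hd ys) (hd (tl ys)) (tl (tl ys)))" "rec_fn n K"
  shows "rec_fn n (\<lambda>xs. rec_nat (F0 xs) (\<lambda>i r. G i r xs) (K xs))"
proof -
  obtain f where f: "\<And>xs. length xs = n \<Longrightarrow> rec_eval f xs (F0 xs)"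
    using assms(1) unfolding rec_fn_def by blast
  obtain g where g: "\<And>ys. length ys = Suc (Suc n) \<Longrightarrow>
      rec_eval g ys (G (hd ys) (hd (tl ys)) (tl (tl ys)))"
    using assms(2) unfolding rec_fn_def by blast
  have *: "rec_eval (PrimRec f g) (k # xs) (rec_nat (F0 xs) (\<lambda>i r. G i r xs) k)"
    if "length xs = n" for k xs
  proof (induction k)
    case 0 then show ?case using f[OF that] by (auto intro: rec_eval.primrec_0)
  next
    case (Suc k)
    show ?case
      using rec_eval.primrec_Suc[OF Suc.IH] g[of "k # _ # xs"] that by auto
  qed
  have "rec_fn (Suc n) (\<lambda>ys. rec_nat (F0 (tl ys)) (\<lambda>i r. G i r (tl ys)) (hd ys))"
    unfolding rec_fn_def
  proof (intro exI allI impI)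
    fix ys :: "nat list" assume "length ys = Suc n"
    then show "rec_eval (PrimRec f g) ys (rec_nat (F0 (tl ys)) (\<lambda>i r. G i r (tl ys)) (hd ys))"
      using * by (cases ys) auto
  qed
  from rec_fn_Cons[OF this assms(3)] show ?thesis .
qed

text \<open>\<open>PrimRec\<close> hands both the counter and the previous value to its step
  function, whereas the body of a sum expects the counter alone; this bridges the two argument
  lists.\<close>

lemma rec_fn_Cons_nth:
  assumes "rec_fn (Suc n) (\<lambda>ys. G (hd ys) (tl ys))" "i < Suc (Suc n)"
  shows "rec_fn (Suc (Suc n)) (\<lambda>ys. G (ys ! i) (tl (tl ys)))"
proof -
  have "rec_fn (Suc (Suc n)) (\<lambda>ys. (\<lambda>zs. G (hd zs) (tl zs))
      (map (\<lambda>F. F ys) ((\<lambda>ys. ys ! i) # map (\<lambda>i ys. ys ! Suc (Suc i)) [0..<n])))"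
    by (rule rec_fn_comp[OF assms(1)]) (use assms(2) in \<open>auto intro: rec_fn_nth\<close>)
  then show ?thesis
    by (rule rec_fn_cong)
       (auto simp: o_def nth_tl intro!: arg_cong[of _ _ "G _"] nth_equalityI)
qed

lemma rec_fn_tl:
  assumes "rec_fn n F" shows "rec_fn (Suc n) (\<lambda>ys. F (tl ys))"
proof -
  have "rec_fn (Suc n) (\<lambda>ys. F (map (\<lambda>F. F ys) (map (\<lambda>i ys. ys ! Suc i) [0..<n])))"
    by (rule rec_fn_comp[OF assms(1)]) (auto intro: rec_fn_nth)
  then show ?thesis
    by (rule rec_fn_cong) (auto simp: o_def nth_tl intro!: arg_cong[of _ _ F] nth_equalityI)
qed

text \<open>
  Variables bound by sums and quantifiers are pushed onto the argument list, so an
  outer argument shows up as \<open>hd\<close> of an iterated tail; these rules recognise such terms.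
\<close>

definition suffix_of_args :: "nat \<Rightarrow> nat \<Rightarrow> (nat list \<Rightarrow> nat list) \<Rightarrow> bool" where
  "suffix_of_args n k E \<longleftrightarrow> (\<forall>xs. length xs = n \<longrightarrow> E xs = drop k xs)"

lemma suffix_of_args_id: "suffix_of_args n 0 (\<lambda>xs. xs)"
  by (simp add: suffix_of_args_def)

lemma suffix_of_args_tl: "suffix_of_args n k E \<Longrightarrow> suffix_of_args n (Suc k) (\<lambda>xs. tl (E xs))"
  by (simp add: suffix_of_args_def drop_Suc tl_drop)

lemma rec_fn_hd: "suffix_of_args n k E \<Longrightarrow> k < n \<Longrightarrow> rec_fn n (\<lambda>xs. hd (E xs))"
  by (rule rec_fn_cong[OF rec_fn_nth[of k n]]) (auto simp: suffix_of_args_def hd_drop_conv_nth)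

lemma rec_fn_nth': "suffix_of_args n k E \<Longrightarrow> k + i < n \<Longrightarrow> rec_fn n (\<lambda>xs. E xs ! i)"
  by (rule rec_fn_cong[OF rec_fn_nth[of "k + i" n]]) (auto simp: suffix_of_args_def)

named_theorems rec_fn_intros

lemmas [rec_fn_intros] = suffix_of_args_id suffix_of_args_tl rec_fn_hd rec_fn_nth' rec_fn_const rec_fn_Suc

lemma rec_fn_add [rec_fn_intros]:
  assumes "rec_fn n F" "rec_fn n G" shows "rec_fn n (\<lambda>xs. F xs + G xs)"
proof -
  have "rec_fn n (\<lambda>xs. rec_nat (F xs) (\<lambda>i r. Suc r) (G xs))"
    by (rule rec_fn_rec_nat) (rule assms rec_fn_intros | simp)+
  moreover have "rec_nat x (\<lambda>i. Suc) y = x + y" for x y :: nat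
    by (induction y) auto
  ultimately show ?thesis by simp
qed

lemma rec_fn_mult [rec_fn_intros]:
  assumes "rec_fn n F" "rec_fn n G" shows "rec_fn n (\<lambda>xs. F xs * G xs)"
proof -
  have "rec_fn n (\<lambda>xs. rec_nat 0 (\<lambda>i r. r + F xs) (G xs))"
  proof (rule rec_fn_rec_nat)
    show "rec_fn (Suc (Suc n)) (\<lambda>ys. hd (tl ys) + F (tl (tl ys)))"
    proof (rule rec_fn_add)
      show "rec_fn (Suc (Suc n)) (\<lambda>ys. hd (tl ys))" by (rule rec_fn_intros | simp)+
      show "rec_fn (Suc (Suc n)) (\<lambda>ys. F (tl (tl ys)))" by (rule rec_fn_tl[OF rec_fn_tl[OF assms(1)]])
    qed
  qed (rule assms rec_fn_intros)+
  moreover have "rec_nat 0 (\<lambda>i r. r + x) y = x * y" for x y :: nat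
    by (induction y) auto
  ultimately show ?thesis by simp
qed

lemma rec_fn_pred [rec_fn_intros]:
  assumes "rec_fn n F" shows "rec_fn n (\<lambda>xs. F xs - 1)"
proof -
  have "rec_fn n (\<lambda>xs. rec_nat 0 (\<lambda>i r. i) (F xs))"
    by (rule rec_fn_rec_nat) (rule assms rec_fn_intros | simp)+
  moreover have "rec_nat 0 (\<lambda>i r. i) y = y - 1" for y :: nat
    by (cases y) auto
  ultimately show ?thesis by simp
qed

lemma rec_fn_diff [rec_fn_intros]:
  assumes "rec_fn n F" "rec_fn n G" shows "rec_fn n (\<lambda>xs. F xs - G xs)"
proof -
  have "rec_fn n (\<lambda>xs. rec_nat (F xs) (\<lambda>i r. r - 1) (G xs))"
    by (rule rec_fn_rec_nat) (rule assms rec_fn_intros | simp)+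
  moreover have "rec_nat x (\<lambda>i r. r - 1) y = x - y" for x y :: nat
    by (induction y) auto
  ultimately show ?thesis by simp
qed

lemma rec_fn_sum:
  assumes "rec_fn (Suc n) (\<lambda>ys. F (hd ys) (tl ys))" "rec_fn n K"
  shows "rec_fn n (\<lambda>xs. \<Sum>i<K xs. F i xs)"
proof -
  have "rec_fn n (\<lambda>xs. rec_nat 0 (\<lambda>i r. r + F i xs) (K xs))"
  proof (rule rec_fn_rec_nat)
    have "rec_fn (Suc (Suc n)) (\<lambda>ys. F (ys ! 0) (tl (tl ys)))"
      by (rule rec_fn_Cons_nth[OF assms(1)]) simp
    then have "rec_fn (Suc (Suc n)) (\<lambda>ys. F (hd ys) (tl (tl ys)))"
      by (rule rec_fn_cong) (auto simp: length_Suc_conv)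
    moreover have "rec_fn (Suc (Suc n)) (\<lambda>ys. hd (tl ys))" by (rule rec_fn_intros | simp)+
    ultimately show "rec_fn (Suc (Suc n)) (\<lambda>ys. hd (tl ys) + F (hd ys) (tl (tl ys)))"
      by (rule rec_fn_add[rotated])
  qed (rule assms rec_fn_intros)+
  moreover have "rec_nat 0 (\<lambda>i r. r + F i xs) k = (\<Sum>i<k. F i xs)" for k xs
    by (induction k) auto
  ultimately show ?thesis by simp
qed

lemma rec_fn_funpow:
  assumes "rec_fn 1 (\<lambda>xs. h (xs ! 0))" "rec_fn n F" "rec_fn n G"
  shows "rec_fn n (\<lambda>xs. (h ^^ F xs) (G xs))"
proof -
  have "rec_fn (Suc (Suc n)) (\<lambda>ys. h (hd (tl ys)))"
    by (rule rec_fn_comp1[OF assms(1)]) (rule rec_fn_intros | simp)+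
  then have "rec_fn n (\<lambda>xs. rec_nat (G xs) (\<lambda>i r. h r) (F xs))"
    by (rule rec_fn_rec_nat[OF assms(3) _ assms(2)])
  moreover have "rec_nat x (\<lambda>i r. h r) k = (h ^^ k) x" for k x
    by (induction k) auto
  ultimately show ?thesis by simp
qed

section \<open>Recursive predicates, bounded quantifiers and minimisation\<close>

definition rec_pred :: "nat \<Rightarrow> (nat list \<Rightarrow> bool) \<Rightarrow> bool" where
  "rec_pred n P \<longleftrightarrow> rec_fn n (\<lambda>xs. of_bool (P xs))"

lemma rec_pred_cong:
  assumes "rec_pred n P" and "\<And>xs. length xs = n \<Longrightarrow> P xs = Q xs"
  shows "rec_pred n Q"
  using assms unfolding rec_pred_def by (elim rec_fn_cong) simp

lemma rec_fn_of_bool [rec_fn_intros]: "rec_pred n P \<Longrightarrow> rec_fn n (\<lambda>xs. of_bool (P xs))"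
  by (simp add: rec_pred_def)

lemma rec_pred_le [rec_fn_intros]:
  assumes "rec_fn n F" "rec_fn n G" shows "rec_pred n (\<lambda>xs. F xs \<le> G xs)"
  unfolding rec_pred_def
  by (rule rec_fn_cong[of n "\<lambda>xs. 1 - (F xs - G xs)"]) (rule assms rec_fn_intros | simp)+

lemma rec_pred_not [rec_fn_intros]:
  assumes "rec_pred n P" shows "rec_pred n (\<lambda>xs. \<not> P xs)"
  unfolding rec_pred_def
  by (rule rec_fn_cong[of n "\<lambda>xs. 1 - of_bool (P xs)"]) (rule assms rec_fn_intros | simp)+

lemma rec_pred_conj [rec_fn_intros]:
  assumes "rec_pred n P" "rec_pred n Q" shows "rec_pred n (\<lambda>xs. P xs \<and> Q xs)"
  unfolding rec_pred_def
  by (rule rec_fn_cong[of n "\<lambda>xs. of_bool (P xs) * of_bool (Q xs)"]) (rule assms rec_fn_intros | simp)+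

lemma rec_pred_disj [rec_fn_intros]:
  assumes "rec_pred n P" "rec_pred n Q" shows "rec_pred n (\<lambda>xs. P xs \<or> Q xs)"
  by (rule rec_pred_cong[of n "\<lambda>xs. \<not> (\<not> P xs \<and> \<not> Q xs)"]) (rule assms rec_fn_intros | simp)+

lemma rec_pred_imp [rec_fn_intros]:
  assumes "rec_pred n P" "rec_pred n Q" shows "rec_pred n (\<lambda>xs. P xs \<longrightarrow> Q xs)"
  by (rule rec_pred_cong[of n "\<lambda>xs. \<not> P xs \<or> Q xs"]) (rule assms rec_fn_intros | simp)+

lemma rec_pred_less [rec_fn_intros]:
  assumes "rec_fn n F" "rec_fn n G" shows "rec_pred n (\<lambda>xs. F xs < G xs)"
  by (rule rec_pred_cong[of n "\<lambda>xs. \<not> G xs \<le> F xs"]) (rule assms rec_fn_intros | simp add: not_le)+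

lemma rec_pred_eq [rec_fn_intros]:
  assumes "rec_fn n F" "rec_fn n G" shows "rec_pred n (\<lambda>xs. F xs = G xs)"
  by (rule rec_pred_cong[of n "\<lambda>xs. F xs \<le> G xs \<and> G xs \<le> F xs"]) (rule assms rec_fn_intros | auto)+

lemma rec_pred_ex:
  assumes "rec_pred (Suc n) (\<lambda>ys. P (hd ys) (tl ys))" "rec_fn n K"
  shows "rec_pred n (\<lambda>xs. \<exists>i<K xs. P i xs)"
proof (rule rec_pred_cong)
  show "rec_pred n (\<lambda>xs. \<not> (\<Sum>i<K xs. of_bool (P i xs)) \<le> (0::nat))"
    by (intro rec_pred_not rec_pred_le rec_fn_sum rec_fn_const assms rec_fn_of_bool)
qed auto

lemma rec_pred_all:
  assumes "rec_pred (Suc n) (\<lambda>ys. P (hd ys) (tl ys))" "rec_fn n K"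
  shows "rec_pred n (\<lambda>xs. \<forall>i<K xs. P i xs)"
  by (rule rec_pred_cong[OF rec_pred_not[OF rec_pred_ex[OF rec_pred_not[OF assms(1)] assms(2)]]]) auto

lemma rec_pred_finite_all:
  assumes "finite I" "\<And>i. i \<in> I \<Longrightarrow> rec_pred n (P i)"
  shows "rec_pred n (\<lambda>xs. \<forall>i\<in>I. P i xs)"
  using assms
proof (induction I)
  case empty
  then show ?case by (simp add: rec_pred_def rec_fn_const)
next
  case (insert i I)
  then have "rec_pred n (\<lambda>xs. P i xs \<and> (\<forall>i\<in>I. P i xs))" by (intro rec_pred_conj) auto
  then show ?case by simp
qed

lemma rec_fn_Least:
  assumes "rec_pred (Suc n) (\<lambda>ys. P (hd ys) (tl ys))" and ex: "\<And>xs. length xs = n \<Longrightarrow> \<exists>i. P i xs"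
  shows "rec_fn n (\<lambda>xs. LEAST i. P i xs)"
proof -
  \<comment> \<open>\<open>Mu\<close> searches for a zero, hence the indicator of the
    negation.\<close>
  obtain r where r: "\<And>ys. length ys = Suc n \<Longrightarrow> rec_eval r ys (of_bool (\<not> P (hd ys) (tl ys)))"
    using rec_pred_not[OF assms(1)] unfolding rec_pred_def rec_fn_def by blast
  have "rec_eval (Mu r) xs (LEAST i. P i xs)" if "length xs = n" for xs
  proof (rule rec_eval.mu)
    show "rec_eval r ((LEAST i. P i xs) # xs) 0"
      using r[of "(LEAST i. P i xs) # xs"] that LeastI_ex[OF ex[OF that]] by simp
    show "\<forall>m<LEAST i. P i xs. \<exists>y. rec_eval r (m # xs) (Suc y)"
    proof (intro allI impI)
      fix m assume "m < (LEAST i. P i xs)"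
      then have "\<not> P m xs" by (rule not_less_Least)
      then show "\<exists>y. rec_eval r (m # xs) (Suc y)" using r[of "m # xs"] that by auto
    qed
  qed
  then show ?thesis unfolding rec_fn_def by blast
qed

text \<open>The quotient counts the positive multiples of the divisor that do not exceed the
  dividend; the guard gives the value 0 for division by zero.\<close>

lemma rec_fn_div [rec_fn_intros]:
  assumes "rec_fn n F" "rec_fn n G" shows "rec_fn n (\<lambda>xs. F xs div G xs)"
proof (rule rec_fn_cong)
  show "rec_fn n (\<lambda>xs. \<Sum>q<F xs. of_bool (G xs \<noteq> 0 \<and> Suc q * G xs \<le> F xs))"
    by (rule rec_fn_sum) (rule assms assms[THEN rec_fn_tl] rec_fn_intros zero_less_Suc)+
  fix xs
  have "(\<Sum>q<x. of_bool (y \<noteq> 0 \<and> Suc q * y \<le> x)) = x div y" for x y :: nat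
  proof (cases "y = 0")
    case False
    have *: "Suc q * y \<le> x \<longleftrightarrow> q < x div y" for q
      using False by (simp add: less_eq_div_iff_mult_less_eq Suc_le_eq[symmetric] del: mult_Suc)
    have "{..<x} \<inter> {q. q < x div y} = {..<x div y}"
      using div_le_dividend[of x y] by (auto intro: less_le_trans)
    then show ?thesis using False by (simp add: * sum.If_cases of_bool_def del: mult_Suc)
  qed simp
  then show "(\<Sum>q<F xs. of_bool (G xs \<noteq> 0 \<and> Suc q * G xs \<le> F xs)) = F xs div G xs" by simp
qed

lemma rec_fn_mod [rec_fn_intros]:
  assumes "rec_fn n F" "rec_fn n G" shows "rec_fn n (\<lambda>xs. F xs mod G xs)"
  by (rule rec_fn_cong[of n "\<lambda>xs. F xs - F xs div G xs * G xs"])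
    (rule assms rec_fn_intros | simp add: minus_div_mult_eq_mod)+

lemma rec_fn_prod_encode [rec_fn_intros]:
  assumes "rec_fn n F" "rec_fn n G" shows "rec_fn n (\<lambda>xs. prod_encode (F xs, G xs))"
  unfolding prod_encode_def triangle_def by simp (rule assms rec_fn_intros)+

text \<open>Each component is found by minimisation, the other one by a bounded quantifier; a pair
  code bounds both of its components.\<close>

lemma rec_fn_prod_decode [rec_fn_intros]:
  assumes "rec_fn n F"
  shows "rec_fn n (\<lambda>xs. fst (prod_decode (F xs)))" "rec_fn n (\<lambda>xs. snd (prod_decode (F xs)))"
proof -
  have tt: "rec_fn (Suc (Suc n)) (\<lambda>ys. F (tl (tl ys)))"
    by (rule rec_fn_tl[OF rec_fn_tl[OF assms]])
  have D: "rec_pred (Suc n) (\<lambda>ys. \<exists>y<Suc (F (tl ys)). prod_encode (hd ys, y) = F (tl ys))"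
    "rec_pred (Suc n) (\<lambda>ys. \<exists>x<Suc (F (tl ys)). prod_encode (x, hd ys) = F (tl ys))"
    by (rule rec_pred_ex, (rule tt assms assms[THEN rec_fn_tl] rec_fn_intros zero_less_Suc lessI Suc_less_eq[THEN iffD2])+)+
  have ex: "\<exists>x y. y < Suc z \<and> x < Suc z \<and> prod_encode (x, y) = z" for z
    by (metis le_imp_less_Suc le_prod_encode_1 le_prod_encode_2 prod.collapse prod_decode_inverse)
  have "(LEAST x. \<exists>y<Suc z. prod_encode (x, y) = z) = fst (prod_decode z)"
    "(LEAST y. \<exists>x<Suc z. prod_encode (x, y) = z) = snd (prod_decode z)" for z
    using ex[of z] by (auto intro!: Least_equality)
  with rec_fn_Least[OF D(1)] rec_fn_Least[OF D(2)] ex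
  show "rec_fn n (\<lambda>xs. fst (prod_decode (F xs)))" "rec_fn n (\<lambda>xs. snd (prod_decode (F xs)))"
    by (simp_all) blast+
qed

section \<open>Access to coded lists\<close>

definition code_tl :: "nat \<Rightarrow> nat" where "code_tl c = snd (prod_decode (c - 1))"

definition code_nth :: "nat \<Rightarrow> nat \<Rightarrow> nat" where
  "code_nth c k = fst (prod_decode ((code_tl ^^ k) c - 1))"

text \<open>Iterated tails reach 0, the code of the empty list, after as many steps as the list is
  long, and stay there. The code itself is a large enough range since it bounds the length.\<close>

definition code_length :: "nat \<Rightarrow> nat" where
  "code_length c = (\<Sum>k<c. of_bool ((code_tl ^^ k) c \<noteq> 0))"

lemma code_tl_0 [simp]: "code_tl 0 = 0"
  by (metis code_tl_def diff_0_eq_0 le_0_eq le_prod_encode_2 prod.collapse prod_decode_inverse)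

lemma code_tl_list_encode: "code_tl (list_encode xs) = list_encode (tl xs)"
  by (cases xs) (simp, simp add: code_tl_def)

lemma funpow_code_tl: "(code_tl ^^ k) (list_encode xs) = list_encode (drop k xs)"
  by (induction k arbitrary: xs) (simp_all add: code_tl_list_encode drop_Suc tl_drop)

lemma list_encode_eq_0 [simp]: "list_encode xs = 0 \<longleftrightarrow> xs = []"
  by (cases xs) auto

lemma code_nth_list_encode:
  "code_nth (list_encode xs) k = (if k < length xs then xs ! k else 0)"
proof (cases "drop k xs")
  case Nil
  have "fst (prod_decode 0) = 0"
    by (metis le_0_eq le_prod_encode_1 prod.collapse prod_decode_inverse)
  with Nil show ?thesis by (simp add: code_nth_def funpow_code_tl)
next
  case (Cons y ys)
  then have "k < length xs" by (metis drop_eq_Nil linorder_not_le list.distinct(1))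
  with Cons have "xs ! k = y" by (metis Cons_nth_drop_Suc list.inject)
  with Cons \<open>k < length xs\<close> show ?thesis by (simp add: code_nth_def funpow_code_tl)
qed

lemma length_le_list_encode: "length xs \<le> list_encode xs"
proof (induction xs)
  case (Cons x xs)
  then show ?case using le_prod_encode_2[of "list_encode xs" x] by simp
qed simp

lemma mem_less_list_encode: "x \<in> set xs \<Longrightarrow> x < list_encode xs"
proof (induction xs)
  case (Cons y xs)
  then show ?case
    using le_prod_encode_1[of y "list_encode xs"] le_prod_encode_2[of "list_encode xs" y]
    by (auto intro: le_imp_less_Suc dest!: Cons.IH)
qed simp

lemma code_length_list_encode: "code_length (list_encode xs) = length xs"
proof -
  have "{..<list_encode xs} \<inter> {k. k < length xs} = {..<length xs}"
    using length_le_list_encode[of xs] by auto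
  then show ?thesis
    by (simp add: code_length_def funpow_code_tl sum.If_cases of_bool_def not_le[symmetric])
qed

lemma rec_fn_funpow_code_tl:
  assumes "rec_fn n F" "rec_fn n G" shows "rec_fn n (\<lambda>xs. (code_tl ^^ F xs) (G xs))"
proof (rule rec_fn_funpow[OF _ assms])
  show "rec_fn 1 (\<lambda>xs. code_tl (xs ! 0))"
    unfolding code_tl_def by (rule rec_fn_intros rec_fn_nth | simp only: less_one)+
qed

lemma rec_fn_code_nth [rec_fn_intros]:
  assumes "rec_fn n F" "rec_fn n G" shows "rec_fn n (\<lambda>xs. code_nth (F xs) (G xs))"
  unfolding code_nth_def by (rule rec_fn_prod_decode rec_fn_pred rec_fn_funpow_code_tl assms)+

lemma rec_fn_code_length [rec_fn_intros]:
  assumes "rec_fn n F" shows "rec_fn n (\<lambda>xs. code_length (F xs))"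
  unfolding code_length_def
  by (rule rec_fn_sum)
    (rule assms assms[THEN rec_fn_tl] rec_fn_funpow_code_tl rec_fn_intros zero_less_Suc)+

text \<open>The code of the constant list \<open>b, ..., b\<close>. As pairing is monotone, it is
  the largest code of a list of this length with entries at most \<open>b\<close>, and turns a
  search over tuples into a bounded quantifier.\<close>

primrec list_encode_bound :: "nat \<Rightarrow> nat \<Rightarrow> nat" where
  "list_encode_bound b 0 = 0"
| "list_encode_bound b (Suc k) = Suc (prod_encode (b, list_encode_bound b k))"

lemma prod_encode_mono: "a \<le> a' \<Longrightarrow> b \<le> b' \<Longrightarrow> prod_encode (a, b) \<le> prod_encode (a', b')"
  by (auto simp: prod_encode_def triangle_def intro!: add_mono div_le_mono mult_le_mono)

lemma list_encode_le_bound: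
  "(\<And>x. x \<in> set xs \<Longrightarrow> x \<le> b) \<Longrightarrow> list_encode xs \<le> list_encode_bound b (length xs)"
  by (induction xs) (auto intro: prod_encode_mono)

lemma rec_fn_list_encode_bound [rec_fn_intros]:
  assumes "rec_fn n F" "rec_fn n G" shows "rec_fn n (\<lambda>xs. list_encode_bound (F xs) (G xs))"
proof -
  have "rec_fn n (\<lambda>xs. rec_nat 0 (\<lambda>i r. Suc (prod_encode (F xs, r))) (G xs))"
    by (rule rec_fn_rec_nat)
      (rule assms rec_fn_tl[OF rec_fn_tl[OF assms(1)]] rec_fn_intros zero_less_Suc lessI Suc_less_eq[THEN iffD2])+
  moreover have "rec_nat 0 (\<lambda>i r. Suc (prod_encode (x, r))) y = list_encode_bound x y" for x y
    by (induction y) auto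
  ultimately show ?thesis by simp
qed

section \<open>Integer-valued recursive functions\<close>

definition rec_int :: "nat \<Rightarrow> (nat list \<Rightarrow> int) \<Rightarrow> bool" where
  "rec_int n F \<longleftrightarrow>
     (\<exists>f g. rec_fn n f \<and> rec_fn n g \<and> (\<forall>xs. length xs = n \<longrightarrow> F xs = int (f xs) - int (g xs)))"

lemma rec_intI:
  assumes "rec_fn n f" "rec_fn n g" "\<And>xs. length xs = n \<Longrightarrow> F xs = int (f xs) - int (g xs)"
  shows "rec_int n F"
  using assms unfolding rec_int_def by blast

lemma rec_intE:
  assumes "rec_int n F"
  obtains f g where "rec_fn n f" "rec_fn n g" "\<And>xs. length xs = n \<Longrightarrow> F xs = int (f xs) - int (g xs)"
  using assms unfolding rec_int_def by blast

named_theorems rec_int_intros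

lemma rec_int_cong:
  assumes "rec_int n F" and "\<And>xs. length xs = n \<Longrightarrow> F xs = G xs"
  shows "rec_int n G"
  using assms unfolding rec_int_def by auto

lemma rec_int_const [rec_int_intros]: "rec_int n (\<lambda>_. c)"
  by (rule rec_intI[of n "\<lambda>_. nat c" "\<lambda>_. nat (- c)"]) (auto intro: rec_fn_const)

lemma rec_int_of_nat [rec_int_intros]: "rec_fn n F \<Longrightarrow> rec_int n (\<lambda>xs. int (F xs))"
  by (rule rec_intI[of n F "\<lambda>_. 0"]) (auto intro: rec_fn_const)

lemma rec_int_add [rec_int_intros]:
  assumes "rec_int n F" "rec_int n G" shows "rec_int n (\<lambda>xs. F xs + G xs)"
proof -
  obtain f g where 1: "rec_fn n f" "rec_fn n g" "\<And>xs. length xs = n \<Longrightarrow> F xs = int (f xs) - int (g xs)"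
    using assms(1) by (rule rec_intE) blast
  obtain f' g' where 2: "rec_fn n f'" "rec_fn n g'" "\<And>xs. length xs = n \<Longrightarrow> G xs = int (f' xs) - int (g' xs)"
    using assms(2) by (rule rec_intE) blast
  show ?thesis
    by (rule rec_intI[OF rec_fn_add[OF 1(1) 2(1)] rec_fn_add[OF 1(2) 2(2)]]) (simp add: 1(3) 2(3))
qed

lemma rec_int_uminus [rec_int_intros]:
  assumes "rec_int n F" shows "rec_int n (\<lambda>xs. - F xs)"
  using assms by (rule rec_intE) (auto intro: rec_intI)

lemma rec_int_diff [rec_int_intros]:
  assumes "rec_int n F" "rec_int n G" shows "rec_int n (\<lambda>xs. F xs - G xs)"
  using rec_int_add[OF assms(1) rec_int_uminus[OF assms(2)]] by simp

lemma rec_int_mult [rec_int_intros]: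
  assumes "rec_int n F" "rec_int n G" shows "rec_int n (\<lambda>xs. F xs * G xs)"
proof -
  obtain f g where 1: "rec_fn n f" "rec_fn n g" "\<And>xs. length xs = n \<Longrightarrow> F xs = int (f xs) - int (g xs)"
    using assms(1) by (rule rec_intE) blast
  obtain f' g' where 2: "rec_fn n f'" "rec_fn n g'" "\<And>xs. length xs = n \<Longrightarrow> G xs = int (f' xs) - int (g' xs)"
    using assms(2) by (rule rec_intE) blast
  show ?thesis
    by (rule rec_intI[of n "\<lambda>xs. f xs * f' xs + g xs * g' xs" "\<lambda>xs. f xs * g' xs + g xs * f' xs"])
      (rule 1 2 rec_fn_intros | simp add: 1(3) 2(3) algebra_simps)+
qed

lemma rec_int_sum:
  assumes "rec_int (Suc n) (\<lambda>ys. F (hd ys) (tl ys))" "rec_fn n K"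
  shows "rec_int n (\<lambda>xs. \<Sum>i<K xs. F i xs)"
proof -
  obtain f g where 1: "rec_fn (Suc n) f" "rec_fn (Suc n) g"
    "\<And>ys. length ys = Suc n \<Longrightarrow> F (hd ys) (tl ys) = int (f ys) - int (g ys)"
    using assms(1) by (rule rec_intE) blast
  have E: "f ys = f (hd ys # tl ys)" "g ys = g (hd ys # tl ys)" if "length ys = Suc n" for ys
    using that by (cases ys; simp)+
  show ?thesis
  proof (rule rec_intI)
    show "rec_fn n (\<lambda>xs. \<Sum>i<K xs. f (i # xs))" "rec_fn n (\<lambda>xs. \<Sum>i<K xs. g (i # xs))"
      by (rule rec_fn_sum[OF _ assms(2)], rule rec_fn_cong[OF 1(1)], rule E, assumption)
        (rule rec_fn_sum[OF _ assms(2)], rule rec_fn_cong[OF 1(2)], rule E, assumption)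
    fix xs :: "nat list" assume "length xs = n"
    then have "F i xs = int (f (i # xs)) - int (g (i # xs))" for i
      using 1(3)[of "i # xs"] by simp
    then show "(\<Sum>i<K xs. F i xs) = int (\<Sum>i<K xs. f (i # xs)) - int (\<Sum>i<K xs. g (i # xs))"
      by (simp add: sum_subtractf)
  qed
qed

lemma rec_int_if [rec_int_intros]:
  assumes "rec_pred n P" "rec_int n F" "rec_int n G" shows "rec_int n (\<lambda>xs. if P xs then F xs else G xs)"
  by (rule rec_int_cong[of n "\<lambda>xs. int (of_bool (P xs)) * F xs + int (of_bool (\<not> P xs)) * G xs"])
    (rule assms rec_int_intros rec_fn_intros | simp)+

lemma rec_int_int_decode [rec_int_intros]:
  assumes "rec_fn n F" shows "rec_int n (\<lambda>xs. int_decode (F xs))"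
  by (rule rec_int_cong[of n "\<lambda>xs. if F xs mod 2 = 0 then int (F xs div 2) else - int (F xs div 2) - 1"])
    (rule assms rec_int_intros rec_fn_intros
      | simp add: int_decode_def sum_decode_def even_iff_mod_2_eq_zero)+

text \<open>Expresses the binomial coefficient of a difference again as a difference of nonnegative
  terms when \<open>a\<close> and \<open>b\<close> are natural numbers; all three halves are
  exact.\<close>

lemma choose_two_diff:
  "(a - b) * (a - b - 1) div 2 = a * (a - 1) div 2 + b * (b + 1) div 2 - a * (b :: int)"
proof -
  have "even (a * (a - 1))" "even (b * (b + 1))" by auto
  then obtain p q where pq: "a * (a - 1) = 2 * p" "b * (b + 1) = 2 * q" by (meson evenE)
  then have "(a - b) * (a - b - 1) = 2 * (p + q - a * b)" by (simp add: algebra_simps)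
  with pq show ?thesis by simp
qed

lemma rec_int_choose_two [rec_int_intros]:
  assumes "rec_int n F" shows "rec_int n (\<lambda>xs. F xs * (F xs - 1) div 2)"
proof -
  obtain f g where 1: "rec_fn n f" "rec_fn n g" "\<And>xs. length xs = n \<Longrightarrow> F xs = int (f xs) - int (g xs)"
    using assms by (rule rec_intE) blast
  show ?thesis
  proof (rule rec_intI[of n "\<lambda>xs. f xs * (f xs - 1) div 2 + g xs * (g xs + 1) div 2" "\<lambda>xs. f xs * g xs"])
    fix xs :: "nat list" assume "length xs = n"
    have "int (x * (x - 1) div 2) = int x * (int x - 1) div 2" for x
      by (cases x) (auto simp: zdiv_int algebra_simps)
    moreover have "int (x * (x + 1) div 2) = int x * (int x + 1) div 2" for x
      by (simp add: zdiv_int algebra_simps)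
    ultimately show "F xs * (F xs - 1) div 2 =
        int (f xs * (f xs - 1) div 2 + g xs * (g xs + 1) div 2) - int (f xs * g xs)"
      by (simp only: 1(3)[OF \<open>length xs = n\<close>] choose_two_diff of_nat_add of_nat_mult)
  qed (rule 1 rec_fn_intros)+
qed

text \<open>Divisibility of a difference is equality of residues. The case \<open>K xs = 0\<close>
  is included, where both sides express equality, so the same predicate tests exact and modular
  congruences.\<close>

lemma rec_pred_int_dvd:
  assumes "rec_int n F" "rec_fn n K" shows "rec_pred n (\<lambda>xs. int (K xs) dvd F xs)"
proof -
  obtain f g where 1: "rec_fn n f" "rec_fn n g" "\<And>xs. length xs = n \<Longrightarrow> F xs = int (f xs) - int (g xs)"
    using assms(1) by (rule rec_intE) blast
  show ?thesis
  proof (rule rec_pred_cong)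
    show "rec_pred n (\<lambda>xs. f xs mod K xs = g xs mod K xs)" by (rule 1 assms rec_fn_intros)+
    fix xs :: "nat list" assume "length xs = n"
    then show "(f xs mod K xs = g xs mod K xs) = (int (K xs) dvd F xs)"
      by (simp add: 1(3) mod_eq_dvd_iff[symmetric] zmod_int[symmetric] del: of_nat_mod)
  qed
qed

section \<open>Subgroups of the integer sequences, seen in their first \<open>k\<close>
  coordinates\<close>

definition lattice_like :: "(nat \<Rightarrow> int) set \<Rightarrow> bool" where
  "lattice_like L \<longleftrightarrow> (\<forall>x\<in>L. \<forall>y\<in>L. (\<lambda>i. x i - y i) \<in> L) \<and> L \<noteq> {}"

lemma lattice_like_combination:
  assumes "lattice_like L" "x \<in> L" "y \<in> L"
  shows "(\<lambda>i. a * x i + b * y i) \<in> L"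
proof -
  have diff: "(\<lambda>i. u i - v i) \<in> L" if "u \<in> L" "v \<in> L" for u v
    using assms(1) that unfolding lattice_like_def by blast
  have zero: "(\<lambda>i. 0) \<in> L" using diff[OF assms(2) assms(2)] by simp
  have add: "(\<lambda>i. u i + v i) \<in> L" if "u \<in> L" "v \<in> L" for u v
    using diff[OF that(1) diff[OF zero that(2)]] by simp
  have mult: "(\<lambda>i. c * u i) \<in> L" if "u \<in> L" for u c
  proof (induction c rule: int_induct[where k = 0])
    case base show ?case using zero by simp
  next
    case (step1 i) then show ?case using add[OF step1(2) that] by (simp add: algebra_simps)
  next
    case (step2 i) then show ?case using diff[OF step2(2) that] by (simp add: algebra_simps)
  qed
  show ?thesis by (rule add[OF mult[OF assms(2)] mult[OF assms(3)]])
qed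

lemma lattice_like_slice:
  assumes "lattice_like L" shows "lattice_like {x \<in> L. x k = 0}"
proof -
  obtain x where "x \<in> L" using assms unfolding lattice_like_def by blast
  then have "(\<lambda>i. 0 * x i + 0 * x i) \<in> L" by (intro lattice_like_combination assms)
  then show ?thesis using assms unfolding lattice_like_def by fastforce
qed

text \<open>Echelon form: a least positive value of coordinate \<open>k\<close> divides all others,
  and subtracting a multiple of the member attaining it leads into the slice covered by the
  induction hypothesis.\<close>

lemma lattice_like_finitely_generated:
  assumes "lattice_like L"
  shows "\<exists>gs. set gs \<subseteq> L \<and>
    (\<forall>x\<in>L. \<exists>c::nat \<Rightarrow> int. \<forall>i<k. x i = (\<Sum>l<length gs. c l * (gs ! l) i))"
  using assms
proof (induction k arbitrary: L)
  case 0 then show ?case by (intro exI[of _ "[]"]) auto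
next
  case (Suc k)
  let ?L' = "{x \<in> L. x k = 0}"
  obtain gs where gs: "set gs \<subseteq> ?L'"
    and c: "\<And>x. x \<in> ?L' \<Longrightarrow> \<exists>c::nat \<Rightarrow> int. \<forall>i<k. x i = (\<Sum>l<length gs. c l * (gs ! l) i)"
    using Suc.IH[OF lattice_like_slice[OF Suc.prems]] by blast
  have gsk: "(gs ! l) k = 0" if "l < length gs" for l using gs that nth_mem by blast
  have c': "\<exists>c::nat \<Rightarrow> int. \<forall>i<Suc k. x i = (\<Sum>l<length gs. c l * (gs ! l) i)" if "x \<in> ?L'" for x
    using c[OF that] that gsk by (auto simp: less_Suc_eq)
  show ?case
  proof (cases "\<exists>x\<in>L. x k \<noteq> 0")
    case False
    then show ?thesis using gs c' by blast
  next
    case True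
    let ?P = "\<lambda>d. d > 0 \<and> (\<exists>x\<in>L. x k = int d)"
    have "\<exists>d. ?P d"
    proof -
      obtain x where x: "x \<in> L" "x k \<noteq> 0" using True by blast
      define y where "y = (\<lambda>i. sgn (x k) * x i + 0 * x i)"
      have "y \<in> L" unfolding y_def by (intro lattice_like_combination Suc.prems x)
      moreover have "y k = int (nat \<bar>x k\<bar>)" by (simp add: y_def sgn_if)
      moreover have "nat \<bar>x k\<bar> > 0" using x by simp
      ultimately have "?P (nat \<bar>x k\<bar>)" by blast
      then show ?thesis by blast
    qed
    define d where "d = (LEAST d. ?P d)"
    have d: "?P d" unfolding d_def using \<open>\<exists>d. ?P d\<close> by (rule LeastI_ex)
    then obtain g where g: "g \<in> L" "g k = int d" and "d > 0" by blast
    have "\<exists>c::nat \<Rightarrow> int. \<forall>i<Suc k. x i = (\<Sum>l<length (g # gs). c l * ((g # gs) ! l) i)"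
      if "x \<in> L" for x
    proof -
      define q where "q = x k div int d"
      define y where "y = (\<lambda>i. 1 * x i + (- q) * g i)"
      have "y \<in> L" unfolding y_def by (intro lattice_like_combination Suc.prems that g)
      have yk: "y k = x k mod int d" using minus_div_mult_eq_mod[of "x k" "int d"] by (simp add: y_def q_def g)
      have "y k = 0"
      proof (rule ccontr)
        assume "y k \<noteq> 0"
        moreover have "y k \<ge> 0" "y k < int d" unfolding yk using \<open>d > 0\<close> by auto
        ultimately have "y k > 0" "y k < int d" by linarith+
        then have "?P (nat (y k))" using \<open>y \<in> L\<close> by auto
        then have "d \<le> nat (y k)" unfolding d_def by (rule Least_le)
        then show False using \<open>y k < int d\<close> \<open>y k > 0\<close> by linarith
      qed
      then obtain c where c: "\<And>i. i < Suc k \<Longrightarrow> y i = (\<Sum>l<length gs. c l * (gs ! l) i)"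
        using c'[of y] \<open>y \<in> L\<close> by auto
      have "x i = (\<Sum>l<length (g # gs). (case l of 0 \<Rightarrow> q | Suc l \<Rightarrow> c l) * ((g # gs) ! l) i)"
        if "i < Suc k" for i
        using c[OF that] by (simp add: sum.lessThan_Suc_shift y_def del: sum.lessThan_Suc)
      then show ?thesis by (intro exI[of _ "\<lambda>l. case l of 0 \<Rightarrow> q | Suc l \<Rightarrow> c l"]) blast
    qed
    then show ?thesis using gs g by (intro exI[of _ "g # gs"]) auto
  qed
qed

text \<open>\<open>\<Lambda>\<close> cuts out the rational span of \<open>L\<close> in the first
  \<open>k\<close> coordinates, and \<open>R\<close> multiplies every integer point of that span
  into \<open>L\<close>. For the quotient by \<open>L\<close> this encodes both a torsion bound and
  the separation of elements by linear forms.\<close>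

definition annihilators :: "nat \<Rightarrow> (nat \<Rightarrow> int) set \<Rightarrow> (nat \<Rightarrow> int) set \<Rightarrow> nat \<Rightarrow> bool" where
  "annihilators k L \<Lambda> R \<longleftrightarrow> finite \<Lambda> \<and> R > 0 \<and>
    (\<forall>\<phi>\<in>\<Lambda>. \<forall>x\<in>L. (\<Sum>i<k. \<phi> i * x i) = 0) \<and>
    (\<forall>x. (\<forall>\<phi>\<in>\<Lambda>. (\<Sum>i<k. \<phi> i * x i) = 0) \<longrightarrow> (\<exists>y\<in>L. \<forall>i<k. y i = int R * x i))"

lemma lattice_like_annihilators:
  assumes "lattice_like L"
  shows "\<exists>\<Lambda> R. annihilators k L \<Lambda> R"
  using assms
proof (induction k arbitrary: L)
  case 0
  then have "annihilators 0 L {} 1" by (auto simp: annihilators_def lattice_like_def)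
  then show ?case by blast
next
  case (Suc k)
  let ?L' = "{x \<in> L. x k = 0}"
  obtain \<Lambda> and R :: nat where ann: "annihilators k ?L' \<Lambda> R"
    using Suc.IH[OF lattice_like_slice[OF Suc.prems]] by blast
  then have fin: "finite \<Lambda>" and R: "R > 0" unfolding annihilators_def by blast+
  have van: "(\<Sum>i<k. \<phi> i * x i) = 0" if "\<phi> \<in> \<Lambda>" "x \<in> L" "x k = 0" for \<phi> x
    using ann that unfolding annihilators_def by blast
  have sep: "\<exists>y\<in>L. y k = 0 \<and> (\<forall>i<k. y i = int R * x i)"
    if "\<forall>\<phi>\<in>\<Lambda>. (\<Sum>i<k. \<phi> i * x i) = 0" for x
    using ann that unfolding annihilators_def by blast
  show ?case
  proof (cases "\<exists>x\<in>L. x k \<noteq> 0")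
    case False
    let ?ext = "\<lambda>\<phi>::nat \<Rightarrow> int. \<phi>(k := 0)"
    let ?last = "\<lambda>i. if i = k then 1 else (0::int)"
    have ext: "(\<Sum>i<Suc k. ?ext \<phi> i * x i) = (\<Sum>i<k. \<phi> i * x i)" for \<phi> x by simp
    have last: "(\<Sum>i<Suc k. ?last i * x i) = x k" for x by simp
    have "\<exists>y\<in>L. \<forall>i<Suc k. y i = int R * x i"
      if "\<forall>\<phi>\<in>insert ?last (?ext ` \<Lambda>). (\<Sum>i<Suc k. \<phi> i * x i) = 0" for x
    proof -
      have "x k = 0" "\<forall>\<phi>\<in>\<Lambda>. (\<Sum>i<k. \<phi> i * x i) = 0"
        using that ext[of _ x] last[of x] by (auto simp del: sum.lessThan_Suc fun_upd_apply)
      then obtain y where "y \<in> L" "y k = 0" "\<And>i. i < k \<Longrightarrow> y i = int R * x i"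
        using sep[of x] by blast
      with \<open>x k = 0\<close> show ?thesis by (intro bexI[of _ y]) (auto simp: less_Suc_eq)
    qed
    moreover have "(\<Sum>i<Suc k. \<phi> i * x i) = 0" if "\<phi> \<in> insert ?last (?ext ` \<Lambda>)" "x \<in> L" for \<phi> x
      using that van[of _ x] False ext[of _ x] last[of x] by (auto simp del: sum.lessThan_Suc fun_upd_apply)
    ultimately have "annihilators (Suc k) L (insert ?last (?ext ` \<Lambda>)) R"
      unfolding annihilators_def using fin R by (intro conjI ballI allI impI) auto
    then show ?thesis by blast
  next
    case True
    then obtain g where g: "g \<in> L" "g k \<noteq> 0" by blast
    \<comment> \<open>Elimination of coordinate \<open>k\<close>: \<open>?ext \<phi>\<close>
      evaluates \<open>\<phi>\<close> at \<open>g k * x - x k * g\<close>, whose coordinate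
      \<open>k\<close> is zero.\<close>
    let ?ext = "\<lambda>\<phi> i. if i < k then g k * \<phi> i else - (\<Sum>i<k. \<phi> i * g i)"
    have ext: "(\<Sum>i<Suc k. ?ext \<phi> i * x i) = (\<Sum>i<k. \<phi> i * (g k * x i - x k * g i))" for \<phi> x
      by (simp add: sum_subtractf sum_distrib_left sum_distrib_right algebra_simps)
    have ann1: "(\<Sum>i<Suc k. \<phi> i * x i) = 0" if "\<phi> \<in> ?ext ` \<Lambda>" "x \<in> L" for \<phi> x
    proof -
      have "(\<lambda>i. g k * x i + - x k * g i) \<in> L"
        by (intro lattice_like_combination Suc.prems that g)
      then show ?thesis using that van[of _ "\<lambda>i. g k * x i - x k * g i"] ext by auto
    qed
    have ann2: "\<exists>y\<in>L. \<forall>i<Suc k. y i = int (R * nat \<bar>g k\<bar>) * x i"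
      if x: "\<forall>\<phi>\<in>?ext ` \<Lambda>. (\<Sum>i<Suc k. \<phi> i * x i) = 0" for x
    proof -
      have "\<forall>\<phi>\<in>\<Lambda>. (\<Sum>i<k. \<phi> i * (g k * x i - x k * g i)) = 0"
        by (intro ballI, subst ext[symmetric], rule bspec[OF x], rule imageI)
      then obtain y where y: "y \<in> L" "y k = 0" "\<And>i. i < k \<Longrightarrow> y i = int R * (g k * x i - x k * g i)"
        using sep[of "\<lambda>i. g k * x i - x k * g i"] by blast
      \<comment> \<open>\<open>g k * x\<close> is the eliminated vector plus \<open>x k * g\<close>.
        Multiplied by \<open>R\<close>, both are available from \<open>L\<close>, and the sign turns
        \<open>g k\<close> into its absolute value.\<close>
      define z where "z = (\<lambda>i. sgn (g k) * y i + (sgn (g k) * int R * x k) * g i)"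
      have "z \<in> L" unfolding z_def by (intro lattice_like_combination Suc.prems y g)
      moreover have "z i = int (R * nat \<bar>g k\<bar>) * x i" if "i < Suc k" for i
      proof -
        have "z i = sgn (g k) * g k * int R * x i"
        proof (cases "i = k")
          case True then show ?thesis using y(2) by (simp add: z_def algebra_simps)
        next
          case False
          then have "i < k" using that by simp
          show ?thesis unfolding z_def y(3)[OF \<open>i < k\<close>] by (simp add: algebra_simps)
        qed
        also have "sgn (g k) * g k = \<bar>g k\<bar>" by (simp add: abs_sgn mult.commute)
        finally show ?thesis by simp
      qed
      ultimately show ?thesis by blast
    qed
    have "annihilators (Suc k) L (?ext ` \<Lambda>) (R * nat \<bar>g k\<bar>)"
      unfolding annihilators_def
    proof (intro conjI ballI allI impI)
      show "R * nat \<bar>g k\<bar> > 0" using R g by simp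
    qed (rule finite_imageI[OF fin] | erule (1) ann1 | erule ann2)+
    then show ?thesis by blast
  qed
qed

section \<open>A quadratic equation with a linear constraint\<close>

text \<open>Descent by isometries of the form \<open>x1 * y1 + x2 * y2\<close>: exchanging the two
  indices, exchanging \<open>x2\<close> with \<open>y2\<close>, and adding \<open>q * x1\<close> to
  \<open>x2\<close> while subtracting \<open>q * y2\<close> from \<open>y1\<close>. They act on the
  coefficients by Euclidean steps, until \<open>u1\<close> divides \<open>u2\<close> and
  \<open>v2\<close>.\<close>

lemma hyperbolic_pair_aux:
  fixes u1 u2 v1 v2 k :: int
  assumes "u1 \<noteq> 0"
  shows "\<exists>x1 x2 y1 y2. u1 * y1 + u2 * y2 + v1 * x1 + v2 * x2 = 0 \<and> x1 * y1 + x2 * y2 = k"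
  using assms
proof (induction "nat \<bar>u1\<bar>" arbitrary: u1 u2 v1 v2 rule: less_induct)
  case less
  have mod_less: "nat \<bar>a mod u1\<bar> < nat \<bar>u1\<bar>" for a
    using less.prems abs_mod_less[of u1 a] by linarith
  consider "u1 dvd u2" "u1 dvd v2" | "u2 mod u1 \<noteq> 0" | "v2 mod u1 \<noteq> 0"
    by (auto simp: mod_eq_0_iff_dvd)
  then show ?case
  proof cases
    case 1
    then obtain a b where "u2 = u1 * a" "v2 = u1 * b" by (auto elim!: dvdE)
    \<comment> \<open>With \<open>x = (0, 1)\<close> the coefficient \<open>v1\<close> disappears
      and \<open>y2 = k\<close> is forced; what remains is divisible by \<open>u1\<close> and
      determines \<open>y1\<close>.\<close>
    then show ?thesis
      by (intro exI[of _ 0] exI[of _ 1] exI[of _ "- k * a - b"] exI[of _ k]) (simp add: algebra_simps)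
  next
    case 2
    define q where "q = u2 div u1"
    have r: "u2 mod u1 = u2 - q * u1" by (simp add: q_def minus_div_mult_eq_mod)
    obtain x1 x2 y1 y2 where
      "(u2 mod u1) * y1 + u1 * y2 + v2 * x1 + (v1 + q * v2) * x2 = 0" "x1 * y1 + x2 * y2 = k"
      using less.hyps[OF mod_less 2, of u1 v2 "v1 + q * v2"] by blast
    then show ?thesis unfolding r
      by (intro exI[of _ x2] exI[of _ "x1 + q * x2"] exI[of _ "y2 - q * y1"] exI[of _ y1])
        (simp add: algebra_simps)
  next
    case 3
    define q where "q = v2 div u1"
    have r: "v2 mod u1 = v2 - q * u1" by (simp add: q_def minus_div_mult_eq_mod)
    obtain x1 x2 y1 y2 where
      "(v2 mod u1) * y1 + u1 * y2 + u2 * x1 + (v1 + q * u2) * x2 = 0" "x1 * y1 + x2 * y2 = k"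
      using less.hyps[OF mod_less 3, of u1 u2 "v1 + q * u2"] by blast
    then show ?thesis unfolding r
      by (intro exI[of _ x2] exI[of _ y1] exI[of _ "y2 - q * y1"] exI[of _ "x1 + q * x2"])
        (simp add: algebra_simps)
  qed
qed

text \<open>The symmetries of the form move a nonzero \<open>u2\<close> or \<open>v2\<close> into
  the place of \<open>u1\<close>; if \<open>u1\<close>, \<open>u2\<close>, \<open>v2\<close> all
  vanish, \<open>x1 = 0\<close> satisfies the linear equation.\<close>

lemma hyperbolic_pair:
  fixes u1 u2 v1 v2 k :: int
  shows "\<exists>x1 x2 y1 y2. u1 * y1 + u2 * y2 + v1 * x1 + v2 * x2 = 0 \<and> x1 * y1 + x2 * y2 = k"
proof -
  consider "u1 \<noteq> 0" | "u2 \<noteq> 0" | "v2 \<noteq> 0" | "u1 = 0" "u2 = 0" "v2 = 0" by blast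
  then show ?thesis
  proof cases
    case 1 then show ?thesis by (rule hyperbolic_pair_aux)
  next
    case 2
    obtain x1 x2 y1 y2 where "u2 * y1 + u1 * y2 + v2 * x1 + v1 * x2 = 0" "x1 * y1 + x2 * y2 = k"
      using hyperbolic_pair_aux[OF 2] by blast
    then show ?thesis
      by (intro exI[of _ x2] exI[of _ x1] exI[of _ y2] exI[of _ y1]) (simp add: algebra_simps)
  next
    case 3
    obtain x1 x2 y1 y2 where "v2 * y1 + u1 * y2 + u2 * x1 + v1 * x2 = 0" "x1 * y1 + x2 * y2 = k"
      using hyperbolic_pair_aux[OF 3] by blast
    then show ?thesis
      by (intro exI[of _ x2] exI[of _ y1] exI[of _ y2] exI[of _ x1]) (simp add: algebra_simps)
  next
    case 4
    then show ?thesis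
      by (intro exI[of _ 0] exI[of _ 1] exI[of _ 0] exI[of _ k]) simp
  qed
qed

section \<open>Groups with central commutators\<close>

text \<open>The step from \<open>k\<close> to \<open>k + 1\<close> determines all powers, also the
  negative ones. Later power formulas are proved by this lemma without separate downward
  inductions.\<close>

lemma (in group) int_pow_unique:
  fixes f :: "int \<Rightarrow> 'a"
  assumes "g \<in> carrier G" "f 0 = \<one>" "\<And>k. f k \<in> carrier G" "\<And>k. f (k + 1) = f k \<otimes> g"
  shows "f k = g [^] k"
proof (induction k rule: int_induct[where k = 0])
  case base show ?case using assms(2) by simp
next
  case (step1 i) then show ?case using assms by (simp add: int_pow_mult)
next
  case (step2 i)
  have "f (i - 1) \<otimes> g = g [^] (i - 1) \<otimes> g"
    using assms(4)[of "i - 1"] step2 int_pow_mult[OF assms(1), of "i - 1" 1] assms(1) by simp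
  then show ?case using assms by simp
qed

context group
begin

definition "Z = {z \<in> carrier G. \<forall>g\<in>carrier G. g \<otimes> z = z \<otimes> g}"

lemma Z_carrier: "z \<in> Z \<Longrightarrow> z \<in> carrier G" by (simp add: Z_def)

lemma Z_comm: "z \<in> Z \<Longrightarrow> g \<in> carrier G \<Longrightarrow> g \<otimes> z = z \<otimes> g" by (simp add: Z_def)

lemma Z_lcomm: "z \<in> Z \<Longrightarrow> g \<in> carrier G \<Longrightarrow> h \<in> carrier G \<Longrightarrow> g \<otimes> (z \<otimes> h) = z \<otimes> (g \<otimes> h)"
  by (metis Z_comm Z_carrier m_assoc)

lemma commute_inv:
  assumes "x \<in> carrier G" "y \<in> carrier G" "x \<otimes> y = y \<otimes> x"
  shows "x \<otimes> inv y = inv y \<otimes> x"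
proof -
  have "x \<otimes> inv y = inv y \<otimes> (y \<otimes> x) \<otimes> inv y" using assms(1,2) by (simp add: m_assoc[symmetric])
  also have "\<dots> = inv y \<otimes> x" unfolding assms(3)[symmetric] using assms(1,2) by (simp add: m_assoc)
  finally show ?thesis .
qed

lemma subgroup_Z: "subgroup Z G"
proof
  show "Z \<subseteq> carrier G" by (auto simp: Z_def)
  fix x assume x: "x \<in> Z"
  have "g \<otimes> inv x = inv x \<otimes> g" if "g \<in> carrier G" for g
    by (rule commute_inv[OF that Z_carrier[OF x] Z_comm[OF x that]])
  moreover have "inv x \<in> carrier G" using x Z_carrier by blast
  ultimately show "inv x \<in> Z" unfolding Z_def by blast
  fix y assume y: "y \<in> Z"
  have "g \<otimes> (x \<otimes> y) = x \<otimes> y \<otimes> g" if "g \<in> carrier G" for g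
    using that x y Z_lcomm[of x g y] Z_comm[of y g] by (simp add: Z_carrier m_assoc)
  moreover have "x \<otimes> y \<in> carrier G" using x y Z_carrier by blast
  ultimately show "x \<otimes> y \<in> Z" unfolding Z_def by blast
qed (simp add: Z_def)

lemma commutator_closed [simp]:
  "x \<in> carrier G \<Longrightarrow> y \<in> carrier G \<Longrightarrow> commutator G x y \<in> carrier G"
  by (simp add: commutator_def)

lemma commutator_in_derived [simp]:
  "x \<in> carrier G \<Longrightarrow> y \<in> carrier G \<Longrightarrow> commutator G x y \<in> derived G (carrier G)"
  unfolding derived_def commutator_def by (intro generate.incl) blast

lemma derived_subset:
  assumes "subgroup H G" "\<And>x y. x \<in> carrier G \<Longrightarrow> y \<in> carrier G \<Longrightarrow> commutator G x y \<in> H"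
  shows "derived G (carrier G) \<subseteq> H"
  unfolding derived_def
  by (rule generate_subgroup_incl[OF _ assms(1)]) (use assms(2) in \<open>auto simp: commutator_def\<close>)

end

lemma choose_two_Suc: "(k + 1) * k div 2 = k * (k - 1) div 2 + (k::int)"
proof -
  have "(k + 1) * k = k * (k - 1) + k * 2" by (simp add: algebra_simps)
  then show ?thesis by simp
qed

locale two_step_group = group G for G (structure) +
  assumes commutator_central:
    "\<lbrakk>x \<in> carrier G; y \<in> carrier G; z \<in> carrier G\<rbrakk> \<Longrightarrow> z \<otimes> commutator G x y = commutator G x y \<otimes> z"
begin

abbreviation "C \<equiv> derived G (carrier G)"

lemma commutator_Z [simp]: "x \<in> carrier G \<Longrightarrow> y \<in> carrier G \<Longrightarrow> commutator G x y \<in> Z"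
  unfolding Z_def using commutator_central commutator_closed by blast

lemma subgroup_C: "subgroup C G"
  unfolding derived_def by (rule generate_is_subgroup) auto

lemma C_subset_Z: "C \<subseteq> Z"
  by (rule derived_subset[OF subgroup_Z commutator_Z])

lemma C_Z: "c \<in> C \<Longrightarrow> c \<in> Z" using C_subset_Z by blast
lemma C_carrier: "c \<in> C \<Longrightarrow> c \<in> carrier G" using C_Z Z_carrier by blast

lemma C_closed [simp]:
  "\<one> \<in> C" "c \<in> C \<Longrightarrow> d \<in> C \<Longrightarrow> c \<otimes> d \<in> C" "c \<in> C \<Longrightarrow> inv c \<in> C" "c \<in> C \<Longrightarrow> c [^] (k::int) \<in> C"
  using subgroup_C by (auto simp: subgroup.one_closed subgroup.m_closed subgroup.m_inv_closed
      subgroup_int_pow_closed)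

lemma Z_closed [simp]:
  "\<one> \<in> Z" "c \<in> Z \<Longrightarrow> d \<in> Z \<Longrightarrow> c \<otimes> d \<in> Z" "c \<in> Z \<Longrightarrow> inv c \<in> Z" "c \<in> Z \<Longrightarrow> c [^] (k::int) \<in> Z"
  using subgroup_Z by (auto simp: subgroup.one_closed subgroup.m_closed subgroup.m_inv_closed
      subgroup_int_pow_closed)

lemma mult_swap:
  "x \<in> carrier G \<Longrightarrow> y \<in> carrier G \<Longrightarrow> x \<otimes> y = commutator G x y \<otimes> (y \<otimes> x)"
  by (simp add: commutator_def m_assoc inv_solve_right) (simp add: m_assoc[symmetric])

lemma commutator_eqI:
  assumes "x \<in> carrier G" "y \<in> carrier G" "c \<in> carrier G" "x \<otimes> y = c \<otimes> (y \<otimes> x)"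
  shows "commutator G x y = c"
  using mult_swap[OF assms(1,2)] assms by simp

lemma commutator_mult_left:
  assumes "x \<in> carrier G" "y \<in> carrier G" "z \<in> carrier G"
  shows "commutator G (x \<otimes> y) z = commutator G x z \<otimes> commutator G y z"
proof (rule commutator_eqI)
  have "x \<otimes> y \<otimes> z = x \<otimes> (commutator G y z \<otimes> (z \<otimes> y))"
    using mult_swap[of y z] assms by (simp add: m_assoc)
  also have "\<dots> = commutator G y z \<otimes> ((x \<otimes> z) \<otimes> y)"
    using assms by (simp add: Z_lcomm[of "commutator G y z" x] m_assoc)
  also have "\<dots> = commutator G y z \<otimes> (commutator G x z \<otimes> (z \<otimes> x) \<otimes> y)"
    using mult_swap[of x z] assms by simp
  also have "\<dots> = commutator G x z \<otimes> commutator G y z \<otimes> (z \<otimes> (x \<otimes> y))"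
    using assms by (simp add: m_assoc Z_lcomm[of "commutator G y z" "commutator G x z"])
  finally show "x \<otimes> y \<otimes> z = commutator G x z \<otimes> commutator G y z \<otimes> (z \<otimes> (x \<otimes> y))" .
qed (use assms in auto)

lemma commutator_swap:
  assumes "x \<in> carrier G" "y \<in> carrier G"
  shows "commutator G y x = inv (commutator G x y)"
  using assms by (simp add: commutator_def inv_mult_group m_assoc)

lemma commutator_mult_right:
  assumes "x \<in> carrier G" "y \<in> carrier G" "z \<in> carrier G"
  shows "commutator G x (y \<otimes> z) = commutator G x y \<otimes> commutator G x z"
proof -
  have "commutator G x (y \<otimes> z) = inv (commutator G y x \<otimes> commutator G z x)"
    using assms by (subst commutator_swap) (simp_all add: commutator_mult_left)
  also have "\<dots> = inv (commutator G z x) \<otimes> inv (commutator G y x)"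
    using assms by (simp add: inv_mult_group)
  also have "\<dots> = commutator G x z \<otimes> commutator G x y"
    using assms by (simp add: commutator_swap[symmetric])
  also have "\<dots> = commutator G x y \<otimes> commutator G x z"
    using assms by (intro Z_comm) auto
  finally show ?thesis .
qed

lemma commutator_one [simp]:
  "x \<in> carrier G \<Longrightarrow> commutator G x \<one> = \<one>" "x \<in> carrier G \<Longrightarrow> commutator G \<one> x = \<one>"
  by (simp_all add: commutator_def)

lemma commutator_Z_one [simp]:
  "x \<in> carrier G \<Longrightarrow> z \<in> Z \<Longrightarrow> commutator G x z = \<one>" "x \<in> carrier G \<Longrightarrow> z \<in> Z \<Longrightarrow> commutator G z x = \<one>"
  by (rule commutator_eqI; simp add: Z_carrier Z_comm[of z x])+

lemma commutator_self [simp]: "x \<in> carrier G \<Longrightarrow> commutator G x x = \<one>"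
  by (rule commutator_eqI) auto

lemma commutator_pow_left:
  assumes "x \<in> carrier G" "y \<in> carrier G"
  shows "commutator G (x [^] (k::int)) y = commutator G x y [^] k"
  by (rule int_pow_unique[of _ "\<lambda>k. commutator G (x [^] k) y"])
    (use assms in \<open>auto simp: int_pow_mult commutator_mult_left\<close>)

lemma commutator_pow_right:
  assumes "x \<in> carrier G" "y \<in> carrier G"
  shows "commutator G x (y [^] (k::int)) = commutator G x y [^] k"
  by (rule int_pow_unique[of _ "\<lambda>k. commutator G x (y [^] k)"])
    (use assms in \<open>auto simp: int_pow_mult commutator_mult_right\<close>)

lemma Z_mult_pow:
  assumes "x \<in> Z" "y \<in> carrier G"
  shows "(x \<otimes> y) [^] (k::int) = x [^] k \<otimes> y [^] k"
  by (rule int_pow_mult_distrib) (use assms in \<open>auto simp: Z_carrier Z_comm[of x y]\<close>)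

text \<open>The Hall-Petresco formula in class two: each exchange of a \<open>y\<close> with a later
  \<open>x\<close> costs one central \<open>[y, x]\<close>, and there are \<open>k choose 2\<close>
  of them; the same polynomial serves negative \<open>k\<close>.\<close>

lemma mult_pow:
  assumes "x \<in> carrier G" "y \<in> carrier G"
  shows "(x \<otimes> y) [^] (k::int) = x [^] k \<otimes> (y [^] k \<otimes> commutator G y x [^] (k * (k - 1) div 2))"
proof -
  let ?f = "\<lambda>k::int. x [^] k \<otimes> (y [^] k \<otimes> commutator G y x [^] (k * (k - 1) div 2))"
  let ?b = "\<lambda>k::int. commutator G y x [^] k"
  have "?f (k + 1) = ?f k \<otimes> (x \<otimes> y)" for k
  proof -
    define B where "B = ?b (k * (k - 1) div 2)"
    define b where "b = ?b k"
    have B: "B \<in> Z" "B \<in> carrier G" and b: "b \<in> Z" "b \<in> carrier G"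
      using assms by (auto simp: B_def b_def)
    have "?f k \<otimes> (x \<otimes> y) = B \<otimes> (x [^] k \<otimes> ((y [^] k \<otimes> x) \<otimes> y))"
      unfolding B_def[symmetric] using assms B
      by (simp add: m_assoc Z_lcomm[of B "x [^] k"] Z_lcomm[of B "y [^] k"])
    also have "y [^] k \<otimes> x = b \<otimes> (x \<otimes> y [^] k)"
      using assms mult_swap[of "y [^] k" x] by (simp add: commutator_pow_left b_def)
    also have "B \<otimes> (x [^] k \<otimes> (b \<otimes> (x \<otimes> y [^] k) \<otimes> y)) =
       (B \<otimes> b) \<otimes> ((x [^] k \<otimes> x) \<otimes> (y [^] k \<otimes> y))"
      using assms b B by (simp add: m_assoc Z_lcomm[of b "x [^] k"])
    also have "\<dots> = ?b ((k + 1) * k div 2) \<otimes> (x [^] (k + 1) \<otimes> y [^] (k + 1))"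
      using assms unfolding B_def b_def choose_two_Suc by (simp add: int_pow_mult)
    also have "\<dots> = ?f (k + 1)"
      using assms Z_comm[of "?b ((k + 1) * k div 2)" "x [^] (k + 1) \<otimes> y [^] (k + 1)"]
      by (simp add: m_assoc)
    finally show ?thesis by simp
  qed
  then show ?thesis
    by (intro int_pow_unique[of _ ?f, symmetric]) (use assms in auto)
qed

end

section \<open>Equations over a group with central commutators\<close>

definition letter_sign :: "symbol \<times> bool \<Rightarrow> int" where
  "letter_sign l = (if snd l then - 1 else 1)"

primrec exponent_sum :: "nat \<Rightarrow> equation \<Rightarrow> int" where
  "exponent_sum j [] = 0"
| "exponent_sum j (l # w) = (if fst l = Var j then letter_sign l else 0) + exponent_sum j w"

text \<open>The cost of collecting \<open>x_j\<close> to the left of \<open>x_k\<close>: a letter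
  \<open>x_k^s\<close> has to pass the power \<open>x_j^e\<close> of the remaining word, and
  \<open>[x_k^s, x_j^e] = [x_j, x_k]^(- s e)\<close>.\<close>

primrec commutator_exponent :: "nat \<Rightarrow> nat \<Rightarrow> equation \<Rightarrow> int" where
  "commutator_exponent j k [] = 0"
| "commutator_exponent j k (l # w) =
     commutator_exponent j k w - (if fst l = Var k then letter_sign l * exponent_sum j w else 0)"

lemma (in group) word_value_Cons:
  assumes "symbol_value gs \<sigma> (fst l) \<in> carrier G"
  shows "word_value G gs \<sigma> (l # w) =
    symbol_value gs \<sigma> (fst l) [^] letter_sign l \<otimes> word_value G gs \<sigma> w"
  using assms int_pow_neg_int[OF assms, of 1] by (simp add: letter_sign_def Let_def)

lemma word_value_cong:
  assumes "\<And>j e. (Var j, e) \<in> set w \<Longrightarrow> \<sigma> j = \<sigma>' j"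
  shows "word_value G gs \<sigma> w = word_value G gs \<sigma>' w"
  using assms
proof (induction w)
  case (Cons l w)
  have "symbol_value gs \<sigma> (fst l) = symbol_value gs \<sigma>' (fst l)"
    using Cons.prems[of _ "snd l"] by (cases l; cases "fst l") auto
  moreover have "word_value G gs \<sigma> w = word_value G gs \<sigma>' w"
    by (rule Cons.IH) (use Cons.prems in auto)
  ultimately show ?case by simp
qed simp

lemma finite_variables: "finite {j. \<exists>e. (Var j, e) \<in> set w}"
proof (rule finite_subset)
  show "{j. \<exists>e. (Var j, e) \<in> set w} \<subseteq> (\<lambda>l. case fst l of Var j \<Rightarrow> j | Gen i \<Rightarrow> i) ` set w" by force
qed simp

lemma is_equation_Cons [simp]:
  "is_equation gs (l # w) \<longleftrightarrow> (\<forall>i. fst l = Gen i \<longrightarrow> i < length gs) \<and> is_equation gs w"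
  by (cases l) (auto simp: is_equation_def)

context two_step_group
begin

lemma Z_ac:
  "a \<in> Z \<Longrightarrow> b \<in> Z \<Longrightarrow> a \<otimes> b = b \<otimes> a"
  "a \<in> Z \<Longrightarrow> b \<in> Z \<Longrightarrow> c \<in> carrier G \<Longrightarrow> a \<otimes> (b \<otimes> c) = b \<otimes> (a \<otimes> c)"
  by (auto intro: Z_comm Z_lcomm simp: Z_carrier)

lemma mult_swap_left:
  "x \<in> carrier G \<Longrightarrow> y \<in> carrier G \<Longrightarrow> z \<in> carrier G \<Longrightarrow>
    x \<otimes> (y \<otimes> z) = commutator G x y \<otimes> (y \<otimes> (x \<otimes> z))"
  using mult_swap[of x y] by (metis commutator_closed m_assoc m_closed)

lemma commutator_pow_flip:
  assumes "x \<in> carrier G" "g \<in> carrier G"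
  shows "commutator G g (x [^] (e::int)) = commutator G x (g [^] (- e))"
proof -
  have "commutator G g (x [^] e) = inv (commutator G x g) [^] e"
    using assms by (simp only: commutator_pow_right commutator_swap[of x g])
  also have "\<dots> = commutator G x g [^] (- e)"
    using assms by (simp add: int_pow_inv int_pow_neg)
  finally show ?thesis using assms by (simp only: commutator_pow_right)
qed

lemma commutator_pow_pow_flip:
  assumes "x \<in> carrier G" "y \<in> carrier G"
  shows "commutator G (y [^] (s::int)) (x [^] (e::int)) = commutator G x y [^] (- (s * e))"
proof -
  have "commutator G (y [^] s) (x [^] e) = commutator G x (y [^] (s * - e))"
    using assms commutator_pow_flip[of x "y [^] s" e] by (simp add: int_pow_pow)
  then show ?thesis using assms by (simp add: commutator_pow_right)
qed

context
  fixes gs :: "'a list"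
  assumes gs: "set gs \<subseteq> carrier G"
begin

lemma symbol_value_closed:
  assumes "is_equation gs (l # w)" "\<And>j. \<sigma> j \<in> carrier G"
  shows "symbol_value gs \<sigma> (fst l) \<in> carrier G"
  using assms gs nth_mem by (cases "fst l") fastforce+

lemma word_value_closed:
  assumes "is_equation gs w" "\<And>j. \<sigma> j \<in> carrier G"
  shows "word_value G gs \<sigma> w \<in> carrier G"
  using assms
proof (induction w)
  case (Cons l w)
  have "symbol_value gs \<sigma> (fst l) \<in> carrier G" using symbol_value_closed Cons.prems by blast
  with Cons show ?case by (simp add: word_value_Cons del: word_value.simps(2))
qed simp

text \<open>Collection, letter by letter from the right. \<open>H\<close> and \<open>K\<close>
  gather the exchanges with constants and other variables; they are chosen before \<open>x\<close>
  and \<open>y\<close>, so the formula describes the value as a function of both.\<close>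

lemma word_value_two_vars:
  assumes "is_equation gs w" and \<sigma>: "\<And>j. \<sigma> j \<in> carrier G" and "j \<noteq> k"
  shows "\<exists>H\<in>carrier G. \<exists>K\<in>carrier G. \<forall>x\<in>carrier G. \<forall>y\<in>carrier G.
    word_value G gs (\<sigma>(j := x, k := y)) w =
    (commutator G x y [^] commutator_exponent j k w \<otimes> (commutator G x H \<otimes> commutator G y K)) \<otimes>
    (x [^] exponent_sum j w \<otimes> (y [^] exponent_sum k w \<otimes> word_value G gs (\<sigma>(j := \<one>, k := \<one>)) w))"
  using assms(1)
proof (induction w)
  case Nil
  show ?case by (intro bexI[of _ \<one>]) auto
next
  case (Cons l w)
  define s where "s = letter_sign l"
  define e where "e = exponent_sum j w"
  define f where "f = exponent_sum k w"
  define a where "a = commutator_exponent j k w"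
  define W where "W = word_value G gs (\<sigma>(j := \<one>, k := \<one>)) w"
  have eq: "is_equation gs w" using Cons.prems by simp
  have W: "W \<in> carrier G" unfolding W_def by (rule word_value_closed[OF eq]) (use \<sigma> in auto)
  have upd: "(\<sigma>(j := x, k := y)) i \<in> carrier G" if "x \<in> carrier G" "y \<in> carrier G" for x y i
    using that \<sigma> by auto
  obtain H K where H: "H \<in> carrier G" and K: "K \<in> carrier G"
    and IH: "\<And>x y. x \<in> carrier G \<Longrightarrow> y \<in> carrier G \<Longrightarrow>
      word_value G gs (\<sigma>(j := x, k := y)) w =
      (commutator G x y [^] a \<otimes> (commutator G x H \<otimes> commutator G y K)) \<otimes> (x [^] e \<otimes> (y [^] f \<otimes> W))"
    using Cons.IH[OF eq] unfolding e_def f_def a_def W_def by blast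
  have val: "word_value G gs (\<sigma>(j := x, k := y)) (l # w) =
      symbol_value gs (\<sigma>(j := x, k := y)) (fst l) [^] s \<otimes>
      ((commutator G x y [^] a \<otimes> (commutator G x H \<otimes> commutator G y K)) \<otimes> (x [^] e \<otimes> (y [^] f \<otimes> W)))"
    if "x \<in> carrier G" "y \<in> carrier G" for x y
    unfolding s_def IH[OF that, symmetric]
    by (rule word_value_Cons) (rule symbol_value_closed[OF Cons.prems upd[OF that]])
  consider "fst l = Var j" | "fst l = Var k" | "fst l \<noteq> Var j" "fst l \<noteq> Var k" by blast
  then show ?case
  proof cases
    case 1
    have main: "word_value G gs (\<sigma>(j := x, k := y)) (l # w) =
        (commutator G x y [^] a \<otimes> (commutator G x H \<otimes> commutator G y K)) \<otimes>
        (x [^] (s + e) \<otimes> (y [^] f \<otimes> W))" if "x \<in> carrier G" "y \<in> carrier G" for x y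
    proof -
      define D where "D = commutator G x y [^] a \<otimes> (commutator G x H \<otimes> commutator G y K)"
      have D: "D \<in> Z" "D \<in> carrier G" unfolding D_def using that H K by (auto simp: Z_carrier)
      have "symbol_value gs (\<sigma>(j := x, k := y)) (fst l) = x" using 1 \<open>j \<noteq> k\<close> by simp
      then show ?thesis
        using that D W unfolding val[OF that] D_def[symmetric]
        by (simp add: Z_lcomm[of D] int_pow_mult m_assoc)
    qed
    \<comment> \<open>The last factor of the collected form is identified by setting
      \<open>x = y = \<one>\<close>.\<close>
    have base: "word_value G gs (\<sigma>(j := \<one>, k := \<one>)) (l # w) = W"
      using main[OF one_closed one_closed] H K W by simp
    show ?thesis
      by (rule bexI[of _ "H"], rule bexI[of _ "K"])
        (use H K 1 \<open>j \<noteq> k\<close> in \<open>simp_all add: main base s_def e_def f_def a_def del: word_value.simps(2) fun_upd_apply\<close>)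
  next
    case 2
    have main: "word_value G gs (\<sigma>(j := x, k := y)) (l # w) =
        (commutator G x y [^] (a - s * e) \<otimes> (commutator G x H \<otimes> commutator G y K)) \<otimes>
        (x [^] e \<otimes> (y [^] (s + f) \<otimes> W))" if "x \<in> carrier G" "y \<in> carrier G" for x y
    proof -
      define D where "D = commutator G x H \<otimes> commutator G y K"
      have D: "D \<in> Z" "D \<in> carrier G" unfolding D_def using that H K by (auto simp: Z_carrier)
      define B where "B = commutator G x y [^] a"
      have B: "B \<in> Z" "B \<in> carrier G" unfolding B_def using that by auto
      have "symbol_value gs (\<sigma>(j := x, k := y)) (fst l) = y" using 2 by simp
      then have "word_value G gs (\<sigma>(j := x, k := y)) (l # w) =
          y [^] s \<otimes> (B \<otimes> (D \<otimes> (x [^] e \<otimes> (y [^] f \<otimes> W))))"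
        using that D B W unfolding val[OF that] D_def[symmetric] B_def[symmetric] by (simp add: m_assoc)
      also have "\<dots> = B \<otimes> (D \<otimes> (y [^] s \<otimes> (x [^] e \<otimes> (y [^] f \<otimes> W))))"
        using that D B W by (simp add: Z_lcomm[of B "y [^] s"] Z_lcomm[of D "y [^] s"])
      also have "y [^] s \<otimes> (x [^] e \<otimes> (y [^] f \<otimes> W)) =
          commutator G x y [^] (- (s * e)) \<otimes> (x [^] e \<otimes> (y [^] (s + f) \<otimes> W))"
        using that W
        by (simp add: mult_swap_left[of "y [^] s" "x [^] e"] commutator_pow_pow_flip int_pow_mult m_assoc)
      also have "B \<otimes> (D \<otimes> \<dots>) =
          ((B \<otimes> commutator G x y [^] (- (s * e))) \<otimes> D) \<otimes> (x [^] e \<otimes> (y [^] (s + f) \<otimes> W))"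
        using that D B W
        by (simp add: Z_lcomm[of "commutator G x y [^] (- (s * e))" D] m_assoc)
      also have "B \<otimes> commutator G x y [^] (- (s * e)) = commutator G x y [^] (a - s * e)"
        using that by (simp add: B_def int_pow_mult[symmetric])
      finally show ?thesis unfolding D_def .
    qed
    have base: "word_value G gs (\<sigma>(j := \<one>, k := \<one>)) (l # w) = W"
      using main[OF one_closed one_closed] H K W by simp
    show ?thesis
      by (rule bexI[of _ "H"], rule bexI[of _ "K"])
        (use H K 2 \<open>j \<noteq> k\<close> in \<open>simp_all add: main base s_def e_def f_def a_def del: word_value.simps(2) fun_upd_apply\<close>)
  next
    case 3
    define g where "g = symbol_value gs \<sigma> (fst l) [^] s"
    have sv: "symbol_value gs (\<sigma>(j := x, k := y)) (fst l) [^] s = g" for x y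
      using 3 unfolding g_def by (cases "fst l") auto
    have g: "g \<in> carrier G"
      unfolding g_def by (rule int_pow_closed, rule symbol_value_closed[OF Cons.prems \<sigma>])
    \<comment> \<open>The fixed value \<open>g\<close> has to pass \<open>x^e\<close> and
      \<open>y^f\<close>. By bilinearity the commutators \<open>[g, x^e]\<close> and
      \<open>[g, y^f]\<close> equal \<open>[x, g^(-e)]\<close> and \<open>[y, g^(-f)]\<close>, which
      are absorbed into \<open>H\<close> and \<open>K\<close>.\<close>
    have main: "word_value G gs (\<sigma>(j := x, k := y)) (l # w) =
        (commutator G x y [^] a \<otimes>
          (commutator G x (H \<otimes> g [^] (- e)) \<otimes> commutator G y (K \<otimes> g [^] (- f)))) \<otimes>
        (x [^] e \<otimes> (y [^] f \<otimes> (g \<otimes> W)))" if "x \<in> carrier G" "y \<in> carrier G" for x y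
    proof -
      define D where "D = commutator G x y [^] a \<otimes> (commutator G x H \<otimes> commutator G y K)"
      define p where "p = commutator G x (g [^] (- e))"
      define q where "q = commutator G y (g [^] (- f))"
      have D: "D \<in> Z" "D \<in> carrier G" unfolding D_def using that H K by (auto simp: Z_carrier)
      have pq: "p \<in> Z" "p \<in> carrier G" "q \<in> Z" "q \<in> carrier G"
        unfolding p_def q_def using that g by auto
      have pq': "commutator G g (x [^] e) = p" "commutator G g (y [^] f) = q"
        unfolding p_def q_def using that g by (auto intro: commutator_pow_flip)
      have "word_value G gs (\<sigma>(j := x, k := y)) (l # w) = D \<otimes> (g \<otimes> (x [^] e \<otimes> (y [^] f \<otimes> W)))"
        using that D W g unfolding val[OF that] sv D_def[symmetric] by (simp add: Z_lcomm[of D])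
      also have "g \<otimes> (x [^] e \<otimes> (y [^] f \<otimes> W)) = p \<otimes> (q \<otimes> (x [^] e \<otimes> (y [^] f \<otimes> (g \<otimes> W))))"
        using that W g pq
        by (simp add: mult_swap_left[of g "x [^] e"] mult_swap_left[of g "y [^] f"] pq'
            Z_lcomm[of q "x [^] e"])
      also have "D \<otimes> \<dots> = (D \<otimes> (p \<otimes> q)) \<otimes> (x [^] e \<otimes> (y [^] f \<otimes> (g \<otimes> W)))"
        using that D W g pq by (simp add: m_assoc)
      also have "D \<otimes> (p \<otimes> q) = commutator G x y [^] a \<otimes>
          (commutator G x (H \<otimes> g [^] (- e)) \<otimes> commutator G y (K \<otimes> g [^] (- f)))"
        using that H K g pq unfolding D_def
        by (simp add: commutator_mult_right p_def[symmetric] q_def[symmetric] m_assoc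
            Z_lcomm[of p "commutator G y K"])
      finally show ?thesis .
    qed
    have base: "word_value G gs (\<sigma>(j := \<one>, k := \<one>)) (l # w) = g \<otimes> W"
      using main[OF one_closed one_closed] H K W g by simp
    show ?thesis
      by (rule bexI[of _ "H \<otimes> g [^] (- e)"], rule bexI[of _ "K \<otimes> g [^] (- f)"])
        (use H K g 3 in \<open>simp_all add: main base e_def f_def a_def del: word_value.simps(2) fun_upd_apply\<close>)
  qed
qed

lemma word_value_one_var:
  assumes w: "is_equation gs w" and \<sigma>: "\<And>j. \<sigma> j \<in> carrier G"
  shows "\<exists>H\<in>carrier G. \<forall>x\<in>carrier G. word_value G gs (\<sigma>(j := x)) w =
    commutator G x H \<otimes> (x [^] exponent_sum j w \<otimes> word_value G gs (\<sigma>(j := \<one>)) w)"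
proof -
  \<comment> \<open>A variable that does not occur in \<open>w\<close> plays the part of
    \<open>y\<close> and is set to \<open>\<one>\<close>.\<close>
  have "finite (insert j {k. \<exists>e. (Var k, e) \<in> set w})" by (simp add: finite_variables)
  then obtain k where k: "k \<notin> insert j {k. \<exists>e. (Var k, e) \<in> set w}"
    using ex_new_if_finite infinite_UNIV_nat by blast
  then have "j \<noteq> k" by blast
  have fresh: "word_value G gs (\<sigma>(j := x)) w = word_value G gs (\<sigma>(j := x, k := \<one>)) w" for x
    by (rule word_value_cong) (use k in auto)
  have closed: "word_value G gs (\<sigma>(j := \<one>, k := \<one>)) w \<in> carrier G"
    by (rule word_value_closed[OF w]) (use \<sigma> in auto)
  from word_value_two_vars[OF w, of \<sigma> j k, OF \<sigma> \<open>j \<noteq> k\<close>]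
  obtain H K where H: "H \<in> carrier G" and K: "K \<in> carrier G" and
    upd: "\<forall>x\<in>carrier G. \<forall>y\<in>carrier G. word_value G gs (\<sigma>(j := x, k := y)) w =
    (commutator G x y [^] commutator_exponent j k w \<otimes> (commutator G x H \<otimes> commutator G y K)) \<otimes>
    (x [^] exponent_sum j w \<otimes> (y [^] exponent_sum k w \<otimes> word_value G gs (\<sigma>(j := \<one>, k := \<one>)) w))"
    by (elim bexE) (rule that)
  show ?thesis
  proof (rule bexI[OF _ H], rule ballI)
    fix x assume "x \<in> carrier G"
    with H K closed bspec[OF bspec[OF upd this] one_closed]
    show "word_value G gs (\<sigma>(j := x)) w =
        commutator G x H \<otimes> (x [^] exponent_sum j w \<otimes> word_value G gs (\<sigma>(j := \<one>)) w)"
      unfolding fresh by (simp del: fun_upd_apply)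
  qed
qed

end

end

section \<open>The local-global principle\<close>

text \<open>\<open>N\<close> kills the kernel of \<open>\<tau>\<close>. The last two assumptions
  speak about the abelian group \<open>G/C\<close>: elements of finite order have order dividing
  \<open>R\<close>, and only the trivial element is an \<open>M\<close>-th power for every
  \<open>M > 0\<close>.\<close>

locale rank_one_group = two_step_group +
  fixes \<tau> :: "'a \<Rightarrow> int" and N R :: int
  assumes N_pos: "N > 0" and R_pos: "R > 0"
    and \<tau>_mult: "\<lbrakk>c \<in> C; d \<in> C\<rbrakk> \<Longrightarrow> \<tau> (c \<otimes> d) = \<tau> c + \<tau> d"
    and \<tau>_ker: "\<lbrakk>c \<in> C; \<tau> c = 0\<rbrakk> \<Longrightarrow> c [^] N = \<one>"
    and \<tau>_nontrivial: "\<exists>x\<in>carrier G. \<exists>y\<in>carrier G. \<tau> (commutator G x y) \<noteq> 0"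
    and torsion_exponent: "\<lbrakk>h \<in> carrier G; (k::int) > 0; h [^] k \<in> C\<rbrakk> \<Longrightarrow> h [^] R \<in> C"
    and residually_in_C:
      "\<lbrakk>g \<in> carrier G; \<And>M::int. M > 0 \<Longrightarrow> \<exists>h\<in>carrier G. \<exists>c\<in>C. g = h [^] M \<otimes> c\<rbrakk> \<Longrightarrow> g \<in> C"
begin

lemma \<tau>_one [simp]: "\<tau> \<one> = 0"
  using \<tau>_mult[of \<one> \<one>] by simp

lemma \<tau>_pow: "c \<in> C \<Longrightarrow> \<tau> (c [^] (k::int)) = k * \<tau> c"
proof (induction k rule: int_induct[where k = 0])
  case (step1 i)
  then have "\<tau> (c [^] (i + 1)) = \<tau> (c [^] i \<otimes> c)" by (simp add: int_pow_mult C_carrier)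
  then show ?case using step1 by (simp add: \<tau>_mult algebra_simps)
next
  case (step2 i)
  then have "\<tau> (c [^] (i - 1) \<otimes> c) = \<tau> (c [^] i)"
    using int_pow_mult[of c "i - 1" 1] by (simp add: C_carrier)
  then show ?case using step2 by (simp add: \<tau>_mult algebra_simps)
qed simp

lemma \<tau>_inv: "c \<in> C \<Longrightarrow> \<tau> (inv c) = - \<tau> c"
  using \<tau>_pow[of c "- 1"] int_pow_neg_int[of c 1] by (simp add: C_carrier)

text \<open>Equality under \<open>\<tau>\<close> leaves a torsion factor undetermined; taking
  \<open>N\<close>-th powers removes it. Hence errors and corrections in \<open>C\<close> are always
  compared as \<open>N\<close>-th powers.\<close>

lemma \<tau>_eq_pow:
  assumes "c \<in> C" "d \<in> C" "\<tau> c = \<tau> d"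
  shows "c [^] N = d [^] N"
proof -
  have "(c \<otimes> inv d) [^] N = \<one>" using assms by (intro \<tau>_ker) (auto simp: \<tau>_mult \<tau>_inv)
  then have "c [^] N \<otimes> inv (d [^] N) = \<one>"
    using assms by (simp add: Z_mult_pow C_Z C_carrier int_pow_inv)
  then show ?thesis using assms by (simp add: C_carrier inv_solve_right')
qed

text \<open>
  The exponent of \<open>h\<close> is doubled because \<open>M\<close> divides \<open>2M choose 2\<close>, which is the exponent of the
  commutators in the \<open>2M\<close>-th power of a product.
\<close>

definition power_coset :: "int \<Rightarrow> 'a set" where
  "power_coset M = {h [^] (2 * M) \<otimes> c [^] M | h c. h \<in> carrier G \<and> c \<in> C}"

context
  fixes gs :: "'a list" and w :: equation
  assumes gs: "set gs \<subseteq> carrier G" and eq: "is_equation gs w"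
begin

abbreviation "val \<sigma> \<equiv> word_value G gs \<sigma> w"

lemma val_closed: "(\<And>j. \<sigma> j \<in> carrier G) \<Longrightarrow> val \<sigma> \<in> carrier G"
  by (rule word_value_closed[OF gs eq])

lemma has_solutionI: "(\<And>i. \<sigma> i \<in> carrier G) \<Longrightarrow> val \<sigma> = \<one> \<Longrightarrow> has_solution G gs w"
  unfolding has_solution_def by blast

text \<open>Finitely many resets lead from any assignment to one that agrees with the constant
  \<open>\<one>\<close> on all relevant variables. So whatever survives a single reset is
  constant.\<close>

lemma reset_variables:
  assumes "\<And>\<sigma> j. (\<And>i. \<sigma> i \<in> carrier G) \<Longrightarrow> Q \<sigma> = Q (\<sigma>(j := \<one>))"
    and "\<And>\<sigma> \<sigma>'. (\<And>j. j < (n::nat) \<Longrightarrow> \<sigma> j = \<sigma>' j) \<Longrightarrow> Q \<sigma> = Q \<sigma>'"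
    and "\<And>i. \<sigma> i \<in> carrier G"
  shows "Q \<sigma> = Q (\<lambda>_. \<one>)"
proof -
  have "Q \<sigma> = Q (\<lambda>j. if j < m then \<one> else \<sigma> j)" for m
  proof (induction m)
    case (Suc m)
    have "(\<lambda>j. if j < m then \<one> else \<sigma> j)(m := \<one>) = (\<lambda>j. if j < Suc m then \<one> else \<sigma> j)"
      by (auto simp: less_Suc_eq)
    then show ?case using assms(1)[of "\<lambda>j. if j < m then \<one> else \<sigma> j" m] assms(3) Suc by simp
  qed simp
  also have "Q (\<lambda>j. if j < n then \<one> else \<sigma> j) = Q (\<lambda>_. \<one>)"
    by (rule assms(2)) simp
  finally show ?thesis .
qed

lemma variables_bounded: "\<exists>n. \<forall>\<sigma> \<sigma>'. (\<forall>j<n. \<sigma> j = \<sigma>' j) \<longrightarrow> val \<sigma> = val \<sigma>'"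
proof -
  obtain n where "\<forall>j\<in>{j. \<exists>e. (Var j, e) \<in> set w}. j < n"
    using finite_variables[of w] finite_nat_set_iff_bounded by blast
  then have "val \<sigma> = val \<sigma>'" if "\<forall>j<n. \<sigma> j = \<sigma>' j" for \<sigma> \<sigma>'
    using that by (intro word_value_cong) blast
  then show ?thesis by blast
qed

text \<open>A factor \<open>k\<close> of \<open>x_j\<close> cancels the power of \<open>h\<close> in
  the error. All commutators created on the way have exponents divisible by \<open>d\<close>, so the
  new error is a \<open>d\<close>-th power in \<open>C\<close>, and a second, central factor of
  \<open>x_j\<close> removes it.\<close>

lemma solvable_if_exponent_sum_nonzero:
  assumes e: "exponent_sum j w \<noteq> 0"
    and approx: "\<And>M. M > 0 \<Longrightarrow> \<exists>\<sigma>. (\<forall>i. \<sigma> i \<in> carrier G) \<and> val \<sigma> \<in> power_coset M"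
  shows "has_solution G gs w"
proof -
  define e where "e = exponent_sum j w"
  define d where "d = \<bar>e\<bar>"
  define s where "s = sgn e"
  have se: "s * e = d" "e = s * d" "d > 0" "s * s = 1"
    using e by (auto simp: d_def s_def e_def sgn_if)
  have "d * d > 0" using se by simp
  then obtain \<sigma> h c where \<sigma>: "\<And>i. \<sigma> i \<in> carrier G" and h: "h \<in> carrier G" and c: "c \<in> C"
    and v: "val \<sigma> = h [^] (2 * (d * d)) \<otimes> c [^] (d * d)"
    using approx[of "d * d"] unfolding power_coset_def by blast
  define u where "u = \<sigma> j"
  define W where "W = val (\<sigma>(j := \<one>))"
  have u: "u \<in> carrier G" unfolding u_def by (rule \<sigma>)
  have W: "W \<in> carrier G" unfolding W_def by (rule val_closed) (use \<sigma> in auto)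
  have "\<exists>H\<in>carrier G. \<forall>x\<in>carrier G. val (\<sigma>(j := x)) = commutator G x H \<otimes> (x [^] e \<otimes> W)"
    unfolding e_def W_def by (rule word_value_one_var[OF gs eq \<sigma>])
  then obtain H where H: "H \<in> carrier G"
    and val_upd: "\<And>x. x \<in> carrier G \<Longrightarrow> val (\<sigma>(j := x)) = commutator G x H \<otimes> (x [^] e \<otimes> W)"
    by blast
  \<comment> \<open>Since \<open>s * e = d\<close>, this exponent gives
    \<open>k^e = h^(- 2 d^2)\<close>, the inverse of the factor to be cancelled.\<close>
  define k where "k = h [^] (- 2 * d * s)"
  have k: "k \<in> carrier G" unfolding k_def using h by simp
  define b where "b = e * (e - 1) div 2"
  \<comment> \<open>A \<open>d\<close>-th root of the new error, factor by factor: from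
    \<open>[k, H]\<close>, from the expansion of \<open>(u k)^e\<close>, from moving
    \<open>k^e\<close> past \<open>W\<close>, and from \<open>c^(d^2)\<close>.\<close>
  define z where "z = (commutator G h H [^] (- 2 * s) \<otimes> commutator G h u [^] (- 2 * s * b)) \<otimes>
    (commutator G h W [^] (- 2 * d) \<otimes> c [^] d)"
  have z: "z \<in> C" unfolding z_def using h H u W c by simp
  have zd: "z [^] d = (commutator G k H \<otimes> commutator G k u [^] b) \<otimes>
      (commutator G (h [^] (- 2 * (d * d))) W \<otimes> c [^] (d * d))"
    unfolding z_def k_def using h H u W c
    by (simp add: Z_mult_pow C_Z C_carrier commutator_pow_left int_pow_pow algebra_simps)
  define h' where "h' = h [^] (- 2 * (d * d))"
  have h': "h' \<in> carrier G" unfolding h'_def using h by simp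
  have "(- 2 * d * s) * e = - 2 * (d * (s * e))" by (simp add: mult.assoc)
  also have "\<dots> = - 2 * (d * d)" by (simp only: se(1))
  finally have "h [^] ((- 2 * d * s) * e) = h'" unfolding h'_def by (rule arg_cong)
  then have ke: "k [^] e = h'" unfolding k_def using h by (simp only: int_pow_pow)
  have "val (\<sigma>(j := u \<otimes> k)) =
      (commutator G u H \<otimes> commutator G k H) \<otimes> (u [^] e \<otimes> (h' \<otimes> commutator G k u [^] b) \<otimes> W)"
    using u k H W by (simp only: val_upd m_closed commutator_mult_left mult_pow b_def ke)
  also have "\<dots> = (commutator G k H \<otimes> commutator G k u [^] b) \<otimes>
      (commutator G u H \<otimes> (u [^] e \<otimes> (h' \<otimes> W)))"
    using u k H W h'
    by (simp add: m_assoc Z_lcomm[of "commutator G k u [^] b" h']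
        Z_lcomm[of "commutator G k u [^] b" "u [^] e"]
        Z_lcomm[of "commutator G k u [^] b" "commutator G u H"]
        Z_lcomm[of "commutator G k H" "commutator G u H"])
  also have "h' \<otimes> W = commutator G h' W \<otimes> (W \<otimes> h')"
    using h' W by (rule mult_swap)
  also have "commutator G u H \<otimes> (u [^] e \<otimes> (commutator G h' W \<otimes> (W \<otimes> h'))) =
      commutator G h' W \<otimes> ((commutator G u H \<otimes> (u [^] e \<otimes> W)) \<otimes> h')"
    using u H W h'
    by (simp add: m_assoc Z_lcomm[of "commutator G h' W" "u [^] e"]
        Z_lcomm[of "commutator G h' W" "commutator G u H"])
  also have "commutator G u H \<otimes> (u [^] e \<otimes> W) = h [^] (2 * (d * d)) \<otimes> c [^] (d * d)"
    using val_upd[OF u] v by (simp add: u_def)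
  also have "\<dots> \<otimes> h' = c [^] (d * d)"
  proof -
    define p where "p = h [^] (2 * (d * d))"
    have p: "p \<in> carrier G" "h' = inv p" unfolding p_def h'_def using h by (simp_all add: int_pow_neg)
    have c2: "c [^] (d * d) \<in> Z" "c [^] (d * d) \<in> carrier G" using c by (simp_all add: C_Z C_carrier)
    have "p \<otimes> c [^] (d * d) \<otimes> h' = c [^] (d * d) \<otimes> p \<otimes> inv p"
      using p c2 Z_comm[of "c [^] (d * d)" p] by simp
    then show ?thesis using p c2 unfolding p_def[symmetric] by (simp add: m_assoc)
  qed
  also have "(commutator G k H \<otimes> commutator G k u [^] b) \<otimes> (commutator G h' W \<otimes> c [^] (d * d)) = z [^] d"
    unfolding zd h'_def ..
  finally have uk: "val (\<sigma>(j := u \<otimes> k)) = z [^] d" .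
  \<comment> \<open>\<open>y^e = z^(- s e) = z^(- d)\<close>, and a central \<open>y\<close> creates
    no commutators.\<close>
  define y where "y = z [^] (- s)"
  have y: "y \<in> Z" "y \<in> carrier G" unfolding y_def using z by (auto simp: C_Z C_carrier)
  have "val (\<sigma>(j := u \<otimes> k \<otimes> y)) = y [^] e \<otimes> val (\<sigma>(j := u \<otimes> k))"
  proof -
    have "val (\<sigma>(j := u \<otimes> k \<otimes> y)) = commutator G (u \<otimes> k) H \<otimes> ((y \<otimes> (u \<otimes> k)) [^] e \<otimes> W)"
      using u k H y W Z_comm[of y "u \<otimes> k"] by (simp add: val_upd commutator_mult_left)
    also have "\<dots> = y [^] e \<otimes> (commutator G (u \<otimes> k) H \<otimes> ((u \<otimes> k) [^] e \<otimes> W))"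
      using u k H y W by (simp add: Z_mult_pow m_assoc Z_lcomm[of "y [^] e" "commutator G (u \<otimes> k) H"])
    finally show ?thesis using u k by (simp add: val_upd)
  qed
  also have "y [^] e = z [^] (- d)"
    unfolding y_def using z by (simp add: int_pow_pow C_carrier se(1))
  also have "z [^] (- d) \<otimes> val (\<sigma>(j := u \<otimes> k)) = \<one>"
    using z unfolding uk by (simp add: C_carrier int_pow_mult[symmetric])
  finally show ?thesis by (rule has_solutionI[rotated]) (use \<sigma> u k y in auto)
qed

section \<open>Equations all of whose exponent sums vanish\<close>

context
  assumes exponents: "\<And>j. exponent_sum j w = 0"
    and approx: "\<And>M. M > 0 \<Longrightarrow> \<exists>\<sigma>. (\<forall>i. \<sigma> i \<in> carrier G) \<and> val \<sigma> \<in> power_coset M"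
begin

lemma val_upd_one:
  assumes \<sigma>: "\<And>i. \<sigma> i \<in> carrier G"
  shows "\<exists>H\<in>carrier G. \<forall>x\<in>carrier G. val (\<sigma>(j := x)) = commutator G x H \<otimes> val (\<sigma>(j := \<one>))"
proof -
  have "val (\<sigma>(j := \<one>)) \<in> carrier G" by (rule val_closed) (use \<sigma> in auto)
  then show ?thesis
    using word_value_one_var[OF gs eq, of \<sigma> j, OF \<sigma>] by (simp add: exponents)
qed

lemma val_upd_two:
  assumes \<sigma>: "\<And>i. \<sigma> i \<in> carrier G" and "j \<noteq> k"
  shows "\<exists>H\<in>carrier G. \<exists>K\<in>carrier G. \<forall>x\<in>carrier G. \<forall>y\<in>carrier G. val (\<sigma>(j := x, k := y)) =
    (commutator G x y [^] commutator_exponent j k w \<otimes> (commutator G x H \<otimes> commutator G y K)) \<otimes>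
    val (\<sigma>(j := \<one>, k := \<one>))"
proof -
  have "val (\<sigma>(j := \<one>, k := \<one>)) \<in> carrier G" by (rule val_closed) (use \<sigma> in auto)
  then show ?thesis
    using word_value_two_vars[OF gs eq, of \<sigma> j k, OF \<sigma> \<open>j \<noteq> k\<close>] by (simp add: exponents)
qed

text \<open>A variable with exponent sum zero contributes only commutators, so the class of the
  value modulo \<open>C\<close> does not depend on the assignment.\<close>

lemma val_in_coset:
  assumes "h \<in> carrier G" "\<And>i. \<sigma> i \<in> carrier G"
  shows "(\<exists>c\<in>C. val \<sigma> = h \<otimes> c) \<longleftrightarrow> (\<exists>c\<in>C. val (\<lambda>_. \<one>) = h \<otimes> c)"
proof -
  obtain n where n: "\<And>\<sigma> \<sigma>'. (\<forall>j<n. \<sigma> j = \<sigma>' j) \<Longrightarrow> val \<sigma> = val \<sigma>'"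
    using variables_bounded by blast
  show ?thesis
  proof (rule reset_variables[where n = n])
    fix \<sigma> :: "nat \<Rightarrow> 'a" and j assume \<sigma>: "\<And>i. \<sigma> i \<in> carrier G"
    define W where "W = val (\<sigma>(j := \<one>))"
    have "\<exists>H\<in>carrier G. \<forall>x\<in>carrier G. val (\<sigma>(j := x)) = commutator G x H \<otimes> W"
      unfolding W_def by (rule val_upd_one[OF \<sigma>])
    then obtain H where H: "H \<in> carrier G" and
      "\<forall>x\<in>carrier G. val (\<sigma>(j := x)) = commutator G x H \<otimes> W" by blast
    then have v: "val \<sigma> = commutator G (\<sigma> j) H \<otimes> W" using \<sigma>[of j] by (metis fun_upd_triv)
    define b where "b = commutator G (\<sigma> j) H"
    have b: "b \<in> C" unfolding b_def using \<sigma> H by simp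
    have W: "W \<in> carrier G" unfolding W_def by (rule val_closed) (use \<sigma> in auto)
    show "(\<exists>c\<in>C. val \<sigma> = h \<otimes> c) = (\<exists>c\<in>C. val (\<sigma>(j := \<one>)) = h \<otimes> c)"
      unfolding W_def[symmetric] v b_def[symmetric]
    proof
      assume "\<exists>c\<in>C. b \<otimes> W = h \<otimes> c"
      then obtain c where c: "c \<in> C" "b \<otimes> W = h \<otimes> c" by blast
      have "W = inv b \<otimes> (h \<otimes> c)" using c b W by (simp add: C_carrier c(2)[symmetric] m_assoc[symmetric])
      also have "\<dots> = h \<otimes> (inv b \<otimes> c)" using b c assms(1) by (simp add: Z_lcomm[of "inv b" h] C_Z C_carrier)
      finally show "\<exists>c\<in>C. W = h \<otimes> c" using b c by (intro bexI[of _ "inv b \<otimes> c"]) auto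
    next
      assume "\<exists>c\<in>C. W = h \<otimes> c"
      then obtain c where c: "c \<in> C" "W = h \<otimes> c" by blast
      then have "b \<otimes> W = h \<otimes> (b \<otimes> c)" using b assms(1) by (simp add: Z_lcomm[of b h] C_Z C_carrier)
      then show "\<exists>c\<in>C. b \<otimes> W = h \<otimes> c" using b c(1) by (intro bexI[of _ "b \<otimes> c"]) auto
    qed
  next
    fix \<sigma> \<sigma>' :: "nat \<Rightarrow> 'a" assume "\<And>j. j < n \<Longrightarrow> \<sigma> j = \<sigma>' j"
    then have "val \<sigma> = val \<sigma>'" by (intro n) blast
    then show "(\<exists>c\<in>C. val \<sigma> = h \<otimes> c) = (\<exists>c\<in>C. val \<sigma>' = h \<otimes> c)" by simp
  qed (rule assms(2))
qed

text \<open>By approximate solvability the constant class modulo \<open>C\<close> is an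
  \<open>M\<close>-th power for every \<open>M\<close>, hence trivial.\<close>

lemma val_one_in_C: "val (\<lambda>_. \<one>) \<in> C"
proof (rule residually_in_C)
  show "val (\<lambda>_. \<one>) \<in> carrier G" by (rule val_closed) simp
  fix M :: int assume "M > 0"
  then obtain \<sigma> h c where \<sigma>: "\<And>i. \<sigma> i \<in> carrier G" and h: "h \<in> carrier G" and c: "c \<in> C"
    and v: "val \<sigma> = h [^] (2 * M) \<otimes> c [^] M"
    using approx unfolding power_coset_def by blast
  then have "\<exists>d\<in>C. val (\<lambda>_. \<one>) = h [^] (2 * M) \<otimes> d"
    by (subst val_in_coset[OF _ \<sigma>, symmetric]) auto
  moreover have "h [^] (2 * M) = (h [^] (2::int)) [^] M" using h by (simp add: int_pow_pow)
  ultimately show "\<exists>h\<in>carrier G. \<exists>c\<in>C. val (\<lambda>_. \<one>) = h [^] M \<otimes> c"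
    using h by (metis int_pow_closed)
qed

lemma val_in_C: "(\<And>i. \<sigma> i \<in> carrier G) \<Longrightarrow> val \<sigma> \<in> C"
  using val_in_coset[of \<one> \<sigma>] val_one_in_C by (auto simp: C_carrier)

text \<open>Approximate with \<open>R * M\<close>. Since the value lies in \<open>C\<close>, so does
  \<open>h^(2 R M)\<close>, and by the torsion bound already \<open>h^R\<close>; thus
  \<open>h^(2 R M)\<close> is the \<open>M\<close>-th power of an element of
  \<open>C\<close>.\<close>

lemma approx_power:
  assumes "(M::int) > 0"
  shows "\<exists>\<sigma>. (\<forall>i. \<sigma> i \<in> carrier G) \<and> (\<exists>c\<in>C. val \<sigma> = c [^] M)"
proof -
  have "R * M > 0" using R_pos assms by simp
  then obtain \<sigma> h c where \<sigma>: "\<And>i. \<sigma> i \<in> carrier G" and h: "h \<in> carrier G" and c: "c \<in> C"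
    and v: "val \<sigma> = h [^] (2 * (R * M)) \<otimes> c [^] (R * M)"
    using approx[of "R * M"] unfolding power_coset_def by blast
  have "h [^] (2 * (R * M)) = val \<sigma> \<otimes> inv (c [^] (R * M))"
    using v h c by (simp add: C_carrier m_assoc)
  also have "\<dots> \<in> C" using val_in_C[OF \<sigma>] c by simp
  finally have "h [^] R \<in> C"
    using torsion_exponent[OF h, of "2 * (R * M)"] \<open>R * M > 0\<close> by simp
  define X where "X = (h [^] R) [^] (2::int)"
  have X: "X \<in> C" unfolding X_def using \<open>h [^] R \<in> C\<close> by simp
  have "X [^] M = h [^] (2 * (R * M))"
    unfolding X_def using h by (simp add: int_pow_pow ac_simps)
  then have "val \<sigma> = (X \<otimes> c [^] R) [^] M"
    using v c X by (simp add: Z_mult_pow C_Z C_carrier int_pow_pow)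
  moreover have "X \<otimes> c [^] R \<in> C" using X c by simp
  ultimately show ?thesis using \<sigma> by blast
qed

text \<open>Replacing \<open>u\<close>, \<open>v\<close> by \<open>u p\<close>, \<open>v q\<close>
  with words \<open>p\<close>, \<open>q\<close> in \<open>e\<close>, \<open>f\<close> changes the
  value by terms linear and quadratic in the exponents. \<open>hyperbolic_pair\<close> makes the
  linear part vanish under \<open>\<tau>\<close> while the quadratic part, a multiple of
  \<open>a * t\<close>, takes a prescribed value.\<close>

lemma solvable_if_commutator_exponent_nonzero:
  assumes "j \<noteq> k" and a: "commutator_exponent j k w \<noteq> 0"
  shows "has_solution G gs w"
proof -
  obtain e f where ef: "e \<in> carrier G" "f \<in> carrier G" and "\<tau> (commutator G e f) \<noteq> 0"
    using \<tau>_nontrivial by blast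
  define t where "t = \<tau> (commutator G e f)"
  define a where "a = commutator_exponent j k w"
  have at: "a * t \<noteq> 0" using a \<open>\<tau> (commutator G e f) \<noteq> 0\<close> by (simp add: a_def t_def)
  \<comment> \<open>The outer \<open>N\<close> is for \<open>\<tau>_eq_pow\<close>. The inner one
    arises since \<open>p\<close> and \<open>q\<close> have exponents divisible by \<open>N\<close>,
    so that \<open>[p, q]\<close> carries \<open>N^2\<close>.\<close>
  then have "N * (N * \<bar>a * t\<bar>) > 0" using N_pos by simp
  then obtain \<sigma> c where \<sigma>: "\<And>i. \<sigma> i \<in> carrier G" and c: "c \<in> C"
    and v: "val \<sigma> = c [^] (N * (N * \<bar>a * t\<bar>))"
    using approx_power by blast
  define c' where "c' = c [^] sgn (a * t)"
  have c': "c' \<in> C" unfolding c'_def using c by simp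
  have v': "val \<sigma> = (c' [^] (N * (a * t))) [^] N"
    unfolding v c'_def using c by (simp add: int_pow_pow C_carrier abs_sgn ac_simps)
  define u where "u = \<sigma> j"
  define v where "v = \<sigma> k"
  have uv: "u \<in> carrier G" "v \<in> carrier G" unfolding u_def v_def by (rule \<sigma>)+
  define W where "W = val (\<sigma>(j := \<one>, k := \<one>))"
  have W: "W \<in> carrier G" unfolding W_def by (rule val_closed) (use \<sigma> in auto)
  have "\<exists>H\<in>carrier G. \<exists>K\<in>carrier G. \<forall>x\<in>carrier G. \<forall>y\<in>carrier G. val (\<sigma>(j := x, k := y)) =
      (commutator G x y [^] a \<otimes> (commutator G x H \<otimes> commutator G y K)) \<otimes> W"
    unfolding a_def W_def by (rule val_upd_two[OF \<sigma> \<open>j \<noteq> k\<close>])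
  then obtain H K where H: "H \<in> carrier G" and K: "K \<in> carrier G"
    and upd: "\<And>x y. x \<in> carrier G \<Longrightarrow> y \<in> carrier G \<Longrightarrow> val (\<sigma>(j := x, k := y)) =
      (commutator G x y [^] a \<otimes> (commutator G x H \<otimes> commutator G y K)) \<otimes> W"
    by blast
  \<comment> \<open>The coefficients are the \<open>\<tau>\<close>-values of those terms of
    \<open>[u p, v q]^a [u p, H] [v q, K]\<close> that are linear in the exponents, with the common
    factor \<open>N\<close> removed.\<close>
  obtain x1 x2 y1 y2 where lin: "(a * \<tau> (commutator G u f) + \<tau> (commutator G f K)) * y1 +
      (a * \<tau> (commutator G f v) + \<tau> (commutator G f H)) * y2 +
      (a * \<tau> (commutator G e v) + \<tau> (commutator G e H)) * x1 +
      (- (a * \<tau> (commutator G u e) + \<tau> (commutator G e K))) * x2 = 0"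
    and quad: "x1 * y1 + x2 * y2 = - \<tau> c'"
    using hyperbolic_pair by blast
  \<comment> \<open>The exponents of \<open>p\<close> and \<open>q\<close> form a matrix of
    determinant \<open>N^2 (x1 y1 + x2 y2)\<close>, which is the exponent of \<open>[e, f]\<close>
    in \<open>[p, q]\<close>; hence the negative sign at \<open>x2\<close>.\<close>
  define p where "p = e [^] (N * x1) \<otimes> f [^] (N * y2)"
  define q where "q = e [^] (N * - x2) \<otimes> f [^] (N * y1)"
  have pq: "p \<in> carrier G" "q \<in> carrier G" unfolding p_def q_def using ef by auto
  define A where "A = commutator G u e [^] (- x2) \<otimes> commutator G u f [^] y1"
  define B where "B = commutator G e v [^] x1 \<otimes> commutator G f v [^] y2"
  define \<Gamma> where "\<Gamma> = commutator G e f [^] (N * (x1 * y1 + x2 * y2))"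
  define D where "D = commutator G e H [^] x1 \<otimes> commutator G f H [^] y2"
  define E where "E = commutator G e K [^] (- x2) \<otimes> commutator G f K [^] y1"
  have inC: "A \<in> C" "B \<in> C" "\<Gamma> \<in> C" "D \<in> C" "E \<in> C"
    unfolding A_def B_def \<Gamma>_def D_def E_def using ef uv H K by auto
  have pows: "commutator G u q = A [^] N" "commutator G p v = B [^] N"
    "commutator G p H = D [^] N" "commutator G q K = E [^] N"
    unfolding p_def q_def A_def B_def D_def E_def using ef uv H K
    by (simp_all add: commutator_mult_left commutator_mult_right commutator_pow_left
        commutator_pow_right Z_mult_pow int_pow_pow ac_simps)
  have \<Gamma>: "commutator G p q = \<Gamma> [^] N"
  proof -
    have "commutator G p q = commutator G e f [^] (N * x1 * (N * y1)) \<otimes> commutator G f e [^] (N * y2 * (N * - x2))"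
      unfolding p_def q_def using ef
      by (simp add: commutator_mult_left commutator_mult_right commutator_pow_left
          commutator_pow_right int_pow_pow ac_simps)
        (rule Z_ac(1); use ef in simp)
    also have "commutator G f e = commutator G e f [^] (- 1 :: int)"
      using ef commutator_swap[of e f] by (simp add: int_pow_neg)
    finally show ?thesis unfolding \<Gamma>_def using ef
      by (simp add: int_pow_pow int_pow_mult[symmetric] algebra_simps)
  qed
  define S where "S = (A \<otimes> (B \<otimes> \<Gamma>)) [^] a \<otimes> (D \<otimes> E)"
  have S: "S \<in> C" unfolding S_def using inC by simp
  define x where "x = u \<otimes> p"
  define y where "y = v \<otimes> q"
  have xy: "x \<in> carrier G" "y \<in> carrier G" unfolding x_def y_def using uv pq by auto
  have "val (\<sigma>(j := x, k := y)) = S [^] N \<otimes>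
      ((commutator G u v [^] a \<otimes> (commutator G u H \<otimes> commutator G v K)) \<otimes> W)"
  proof -
    have "commutator G x y = commutator G u v \<otimes> (A \<otimes> (B \<otimes> \<Gamma>)) [^] N"
    proof -
      have "commutator G x y = (commutator G u v \<otimes> A [^] N) \<otimes> (B [^] N \<otimes> \<Gamma> [^] N)"
        unfolding x_def y_def using uv pq
        by (simp add: commutator_mult_left commutator_mult_right pows \<Gamma>)
          (use inC in \<open>simp add: m_assoc C_carrier Z_ac C_Z\<close>)
      then show ?thesis using inC uv by (simp add: Z_mult_pow C_carrier C_Z m_assoc)
    qed
    moreover have "commutator G x H = commutator G u H \<otimes> D [^] N"
      "commutator G y K = commutator G v K \<otimes> E [^] N"
      unfolding x_def y_def using uv pq H K by (simp_all add: commutator_mult_left pows)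
    moreover have "S [^] N = ((A \<otimes> (B \<otimes> \<Gamma>)) [^] N) [^] a \<otimes> (D [^] N \<otimes> E [^] N)"
      unfolding S_def using inC
      by (simp add: Z_mult_pow C_Z C_carrier int_pow_pow mult.commute)
    ultimately show ?thesis
      using uv H K W inC
      by (simp add: upd[OF xy] Z_mult_pow Z_ac C_Z C_carrier m_assoc)
  qed
  also have "(commutator G u v [^] a \<otimes> (commutator G u H \<otimes> commutator G v K)) \<otimes> W = val \<sigma>"
    using upd[OF uv] by (simp add: u_def v_def)
  also have "\<tau> S = \<tau> (c' [^] (- (N * (a * t))))"
  proof -
    have "\<tau> S = a * (\<tau> A + (\<tau> B + \<tau> \<Gamma>)) + (\<tau> D + \<tau> E)"
      unfolding S_def using inC by (simp add: \<tau>_mult \<tau>_pow)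
    also have "\<tau> \<Gamma> = N * (- \<tau> c') * t"
      unfolding \<Gamma>_def quad t_def using ef by (simp add: \<tau>_pow)
    also have "\<tau> A = (- x2) * \<tau> (commutator G u e) + y1 * \<tau> (commutator G u f)"
      unfolding A_def using uv ef by (simp add: \<tau>_mult \<tau>_pow)
    also have "\<tau> B = x1 * \<tau> (commutator G e v) + y2 * \<tau> (commutator G f v)"
      unfolding B_def using uv ef by (simp add: \<tau>_mult \<tau>_pow)
    also have "\<tau> D = x1 * \<tau> (commutator G e H) + y2 * \<tau> (commutator G f H)"
      unfolding D_def using H ef by (simp add: \<tau>_mult \<tau>_pow)
    also have "\<tau> E = (- x2) * \<tau> (commutator G e K) + y1 * \<tau> (commutator G f K)"
      unfolding E_def using K ef by (simp add: \<tau>_mult \<tau>_pow)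
    finally show ?thesis using lin c' by (simp add: \<tau>_pow algebra_simps)
  qed
  then have "S [^] N = (c' [^] (- (N * (a * t)))) [^] N"
    using S c' by (intro \<tau>_eq_pow) auto
  also have "\<dots> \<otimes> val \<sigma> = \<one>"
    unfolding v' using c' by (simp add: int_pow_pow C_carrier int_pow_mult[symmetric])
  finally show ?thesis by (rule has_solutionI[rotated]) (use \<sigma> xy in auto)
qed

text \<open>Without mixed terms the effect of one variable is independent of the others. Either some
  effect has nonzero \<open>\<tau>\<close> and its powers remove the error, or \<open>\<tau>\<close>
  of the value is constant, and then the approximate solution for one large modulus is
  exact.\<close>

lemma solvable_if_commutator_exponents_zero:
  assumes a: "\<And>j k. j \<noteq> k \<Longrightarrow> commutator_exponent j k w = 0"
  shows "has_solution G gs w"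
proof -
  obtain n where n: "\<And>\<sigma> \<sigma>'. (\<forall>j<n. \<sigma> j = \<sigma>' j) \<Longrightarrow> val \<sigma> = val \<sigma>'"
    using variables_bounded by blast
  have step: "\<exists>H\<in>carrier G. \<forall>x\<in>carrier G. val (\<sigma>(j := x)) = commutator G x H \<otimes> val (\<sigma>(j := \<one>))"
    if "\<And>i. \<sigma> i \<in> carrier G" for \<sigma> j using that by (rule val_upd_one)
  show ?thesis
  proof (cases "\<exists>\<sigma> j x d. (\<forall>i. \<sigma> i \<in> carrier G) \<and> x \<in> carrier G \<and> d \<in> C \<and> \<tau> d \<noteq> 0 \<and>
      val (\<sigma>(j := x)) = d \<otimes> val (\<sigma>(j := \<one>))")
    case True
    then obtain \<sigma>0 j x d where \<sigma>0: "\<And>i. \<sigma>0 i \<in> carrier G" and x: "x \<in> carrier G" and d: "d \<in> C"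
      and \<tau>d: "\<tau> d \<noteq> 0" and v0: "val (\<sigma>0(j := x)) = d \<otimes> val (\<sigma>0(j := \<one>))" by blast
    \<comment> \<open>The effect \<open>d\<close> of changing \<open>x_j\<close> from
      \<open>\<one>\<close> to \<open>x\<close> is known at \<open>\<sigma>0\<close>, whereas the
      approximate solution is another assignment; invariance of \<open>Q\<close> carries the effect
      over.\<close>
    define Q where "Q \<sigma> \<longleftrightarrow> val (\<sigma>(j := x)) = d \<otimes> val (\<sigma>(j := \<one>))" for \<sigma>
    have Q: "Q \<sigma> = Q (\<lambda>_. \<one>)" if "\<And>i. \<sigma> i \<in> carrier G" for \<sigma>
    proof (rule reset_variables[where n = n])
      fix \<sigma> :: "nat \<Rightarrow> 'a" and k assume \<sigma>: "\<And>i. \<sigma> i \<in> carrier G"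
      show "Q \<sigma> = Q (\<sigma>(k := \<one>))"
      proof (cases "k = j")
        case True then show ?thesis by (simp add: Q_def)
      next
        case False
        define W where "W = val (\<sigma>(j := \<one>, k := \<one>))"
        have W: "W \<in> carrier G" unfolding W_def by (rule val_closed) (use \<sigma> in auto)
        have "\<exists>H\<in>carrier G. \<exists>K\<in>carrier G. \<forall>x\<in>carrier G. \<forall>y\<in>carrier G. val (\<sigma>(j := x, k := y)) =
          (commutator G x y [^] commutator_exponent j k w \<otimes> (commutator G x H \<otimes> commutator G y K)) \<otimes> W"
          unfolding W_def by (rule val_upd_two[OF \<sigma>]) (use False in simp)
        then obtain H K where H: "H \<in> carrier G" and K: "K \<in> carrier G"
          and upd: "\<And>x y. x \<in> carrier G \<Longrightarrow> y \<in> carrier G \<Longrightarrow> val (\<sigma>(j := x, k := y)) =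
          (commutator G x y [^] commutator_exponent j k w \<otimes> (commutator G x H \<otimes> commutator G y K)) \<otimes> W"
          by blast
        have iff: "val (\<sigma>(j := x, k := y)) = d \<otimes> val (\<sigma>(j := \<one>, k := y)) \<longleftrightarrow> commutator G x H = d"
          if y: "y \<in> carrier G" for y
        proof -
          define g where "g = commutator G y K \<otimes> W"
          have g: "g \<in> carrier G" unfolding g_def using y K W by simp
          have "val (\<sigma>(j := x, k := y)) = commutator G x H \<otimes> g" "val (\<sigma>(j := \<one>, k := y)) = g"
            unfolding g_def using x y H K W False by (simp_all add: upd a m_assoc)
          then show ?thesis using g x H d by (simp add: C_carrier)
        qed
        have "\<sigma>(j := z) = \<sigma>(j := z, k := \<sigma> k)" "(\<sigma>(k := \<one>))(j := z) = \<sigma>(j := z, k := \<one>)" for z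
          using False by auto
        then have "Q \<sigma> \<longleftrightarrow> val (\<sigma>(j := x, k := \<sigma> k)) = d \<otimes> val (\<sigma>(j := \<one>, k := \<sigma> k))"
          "Q (\<sigma>(k := \<one>)) \<longleftrightarrow> val (\<sigma>(j := x, k := \<one>)) = d \<otimes> val (\<sigma>(j := \<one>, k := \<one>))"
          unfolding Q_def by metis+
        with iff[OF \<sigma>] iff[OF one_closed] show ?thesis by simp
      qed
    next
      fix \<sigma> \<sigma>' :: "nat \<Rightarrow> 'a" assume *: "\<And>j. j < n \<Longrightarrow> \<sigma> j = \<sigma>' j"
      have "val (\<sigma>(j := z)) = val (\<sigma>'(j := z))" for z by (rule n) (use * in auto)
      then show "Q \<sigma> = Q \<sigma>'" by (simp add: Q_def)
    qed (rule that)
    have "N * \<bar>\<tau> d\<bar> > 0" using N_pos \<tau>d by simp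
    then obtain \<sigma> c where \<sigma>: "\<And>i. \<sigma> i \<in> carrier G" and c: "c \<in> C" and v: "val \<sigma> = c [^] (N * \<bar>\<tau> d\<bar>)"
      using approx_power by blast
    define c' where "c' = c [^] sgn (\<tau> d)"
    have c': "c' \<in> C" unfolding c'_def using c by simp
    have v': "val \<sigma> = (c' [^] \<tau> d) [^] N"
      unfolding v c'_def using c by (simp add: int_pow_pow C_carrier abs_sgn ac_simps)
    define u where "u = \<sigma> j"
    have u: "u \<in> carrier G" unfolding u_def by (rule \<sigma>)
    define W where "W = val (\<sigma>(j := \<one>))"
    have W: "W \<in> carrier G" unfolding W_def by (rule val_closed) (use \<sigma> in auto)
    obtain H where H: "H \<in> carrier G" and
      upd: "\<And>x. x \<in> carrier G \<Longrightarrow> val (\<sigma>(j := x)) = commutator G x H \<otimes> W"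
      using step[of \<sigma> j, OF \<sigma>] unfolding W_def by blast
    have "Q \<sigma>" using Q[OF \<sigma>] Q[OF \<sigma>0] v0 by (simp add: Q_def)
    then have dH: "commutator G x H = d"
      using x H W d upd[OF x] unfolding Q_def W_def[symmetric] by (simp add: C_carrier)
    \<comment> \<open>This multiplies the value by \<open>d^(- \<tau> c' * N)\<close>. As
      \<open>d^(\<tau> c')\<close> and \<open>c'^(\<tau> d)\<close> have the same
      \<open>\<tau>\<close>, their \<open>N\<close>-th powers agree, and the error cancels.\<close>
    define y where "y = x [^] (- (\<tau> c' * N)) \<otimes> u"
    have y: "y \<in> carrier G" unfolding y_def using x u by simp
    have "val (\<sigma>(j := y)) = (d [^] (- \<tau> c')) [^] N \<otimes> (commutator G u H \<otimes> W)"
      using x u H W d unfolding upd[OF y]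
      by (simp add: y_def commutator_mult_left commutator_pow_left dH int_pow_pow C_carrier m_assoc)
    also have "commutator G u H \<otimes> W = val \<sigma>" using upd[OF u] by (simp add: u_def)
    also have "(d [^] (- \<tau> c')) [^] N = (c' [^] (- \<tau> d)) [^] N"
      using d c' by (intro \<tau>_eq_pow) (auto simp: \<tau>_pow)
    also have "\<dots> \<otimes> val \<sigma> = \<one>"
      unfolding v' using c' by (simp add: int_pow_pow C_carrier int_pow_mult[symmetric])
    finally show ?thesis by (rule has_solutionI[rotated]) (use \<sigma> y in auto)
  next
    case False
    have const: "(\<tau> (val \<sigma>) = t) = (\<tau> (val (\<lambda>_. \<one>)) = t)" if "\<And>i. \<sigma> i \<in> carrier G" for \<sigma> t
    proof (rule reset_variables[where n = n])
      fix \<sigma> :: "nat \<Rightarrow> 'a" and j assume \<sigma>: "\<And>i. \<sigma> i \<in> carrier G"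
      obtain H where H: "H \<in> carrier G" and
        upd: "\<And>x. x \<in> carrier G \<Longrightarrow> val (\<sigma>(j := x)) = commutator G x H \<otimes> val (\<sigma>(j := \<one>))"
        using step[of \<sigma> j, OF \<sigma>] by blast
      have v: "val \<sigma> = commutator G (\<sigma> j) H \<otimes> val (\<sigma>(j := \<one>))"
        using upd[of "\<sigma> j"] \<sigma> by simp
      moreover have "\<tau> (commutator G (\<sigma> j) H) = 0"
      proof (rule ccontr)
        assume "\<tau> (commutator G (\<sigma> j) H) \<noteq> 0"
        then show False using False upd[of "\<sigma> j"] \<sigma> H commutator_in_derived by blast
      qed
      moreover have "val (\<sigma>(j := \<one>)) \<in> C" by (rule val_in_C) (use \<sigma> in auto)
      ultimately have "\<tau> (val \<sigma>) = \<tau> (val (\<sigma>(j := \<one>)))" using \<sigma> H by (simp add: \<tau>_mult)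
      then show "(\<tau> (val \<sigma>) = t) = (\<tau> (val (\<sigma>(j := \<one>))) = t)" by simp
    next
      fix \<sigma> \<sigma>' :: "nat \<Rightarrow> 'a" assume "\<And>j. j < n \<Longrightarrow> \<sigma> j = \<sigma>' j"
      then have "val \<sigma> = val \<sigma>'" by (intro n) blast
      then show "(\<tau> (val \<sigma>) = t) = (\<tau> (val \<sigma>') = t)" by simp
    qed (rule that)
    define t where "t = \<tau> (val (\<lambda>_. \<one>))"
    \<comment> \<open>\<open>M > \<bar>t\<bar>\<close>, so \<open>M * \<tau> c = t\<close> forces
      \<open>\<tau> c = 0\<close>; as a multiple of \<open>N\<close>, \<open>M\<close> then makes
      \<open>c^M\<close> trivial.\<close>
    define M where "M = N * (\<bar>t\<bar> + 1)"
    have "M > 0" unfolding M_def using N_pos by (intro mult_pos_pos) auto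
    then obtain \<sigma> c where \<sigma>: "\<And>i. \<sigma> i \<in> carrier G" and c: "c \<in> C" and v: "val \<sigma> = c [^] M"
      using approx_power by blast
    have "M * \<tau> c = t" using const[of \<sigma> t, OF \<sigma>] v c by (simp add: t_def \<tau>_pow)
    have "\<tau> c = 0"
    proof (rule ccontr)
      assume "\<tau> c \<noteq> 0"
      then have "M * 1 \<le> M * \<bar>\<tau> c\<bar>" using \<open>M > 0\<close> by (intro mult_left_mono) auto
      also have "\<dots> = \<bar>t\<bar>" using \<open>M * \<tau> c = t\<close> \<open>M > 0\<close> by (metis abs_mult abs_of_pos)
      also have "\<bar>t\<bar> < 1 * (\<bar>t\<bar> + 1)" by simp
      also have "\<dots> \<le> M" unfolding M_def using N_pos by (intro mult_right_mono) auto
      finally show False by simp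
    qed
    then have "c [^] N = \<one>" using c by (intro \<tau>_ker)
    then have "val \<sigma> = \<one>" unfolding v M_def using c by (simp add: int_pow_pow[symmetric] C_carrier)
    then show ?thesis unfolding has_solution_def using \<sigma> by blast
  qed
qed

end

theorem solvable_if_approximately_solvable:
  assumes "\<And>M. M > 0 \<Longrightarrow> \<exists>\<sigma>. (\<forall>i. \<sigma> i \<in> carrier G) \<and> val \<sigma> \<in> power_coset M"
  shows "has_solution G gs w"
proof (cases "\<exists>j. exponent_sum j w \<noteq> 0")
  case True
  then show ?thesis using solvable_if_exponent_sum_nonzero assms by blast
next
  case False
  then have e: "\<And>j. exponent_sum j w = 0" by blast
  show ?thesis
  proof (cases "\<exists>j k. j \<noteq> k \<and> commutator_exponent j k w \<noteq> 0")
    case True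
    then show ?thesis using solvable_if_commutator_exponent_nonzero[OF e assms] by blast
  next
    case False
    then show ?thesis by (intro solvable_if_commutator_exponents_zero[OF e assms]) auto
  qed
qed

end
end

section \<open>Coordinates\<close>

text \<open>
  \<open>(n, m)\<close> stands for \<open>\<Prod>\<^sub>i x\<^sub>i\<^bsup>n i\<^esup> \<cdot> \<Prod>\<^sub>j\<^sub><\<^sub>i [x\<^sub>i, x\<^sub>j]\<^bsup>m i j\<^esup>\<close> in the free two-step nilpotent group;
  the values of \<open>m\<close> outside \<open>j < i\<close> carry no meaning.
\<close>

type_synonym coords = "(nat \<Rightarrow> int) \<times> (nat \<Rightarrow> nat \<Rightarrow> int)"

definition coords_one :: coords where
  "coords_one = (\<lambda>_. 0, \<lambda>_ _. 0)"

text \<open>The bilinear term is the cost of collection: moving \<open>x_i^(n i)\<close> past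
  \<open>x_j^(n' j)\<close> for \<open>j < i\<close> creates
  \<open>[x_i, x_j]^(n i * n' j)\<close>.\<close>

definition coords_mult :: "coords \<Rightarrow> coords \<Rightarrow> coords" where
  "coords_mult x y =
     (\<lambda>i. fst x i + fst y i, \<lambda>i j. snd x i j + snd y i j + fst x i * fst y j)"

definition coords_inv :: "coords \<Rightarrow> coords" where
  "coords_inv x = (\<lambda>i. - fst x i, \<lambda>i j. fst x i * fst x j - snd x i j)"

definition coords_pow :: "coords \<Rightarrow> int \<Rightarrow> coords" where
  "coords_pow x k = (\<lambda>i. k * fst x i, \<lambda>i j. k * snd x i j + (k * (k - 1) div 2) * (fst x i * fst x j))"

definition gen_coords :: "nat \<Rightarrow> coords" where
  "gen_coords g = (\<lambda>i. if i = g then 1 else 0, \<lambda>_ _. 0)"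

text \<open>Exponents are indexed from the end of the list, so those of the tail do not shift when
  an element is put in front.\<close>

primrec coords_prod :: "coords list \<Rightarrow> (nat \<Rightarrow> int) \<Rightarrow> coords" where
  "coords_prod [] c = coords_one"
| "coords_prod (x # xs) c = coords_mult (coords_pow x (c (length xs))) (coords_prod xs c)"

text \<open>For \<open>M = 0\<close> this is equality of the meaningful coordinates.\<close>

definition coords_cong :: "nat \<Rightarrow> int \<Rightarrow> coords \<Rightarrow> coords \<Rightarrow> bool" where
  "coords_cong r M x y \<longleftrightarrow> (\<forall>i<r. M dvd fst x i - fst y i) \<and> (\<forall>i<r. \<forall>j<i. M dvd snd x i j - snd y i j)"

lemma coords_prod_append:
  "coords_prod (xs @ ys) c = coords_mult (coords_prod xs (\<lambda>l. c (l + length ys))) (coords_prod ys c)"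
  by (induction xs) (auto simp: coords_mult_def coords_one_def algebra_simps fun_eq_iff)

lemma coords_prod_cong:
  "(\<And>l. l < length xs \<Longrightarrow> c l = c' l) \<Longrightarrow> coords_prod xs c = coords_prod xs c'"
  by (induction xs) auto

lemma fst_coords_prod:
  "fst (coords_prod xs c) i = (\<Sum>l<length xs. c l * fst (rev xs ! l) i)"
  by (induction xs) (auto simp: coords_mult_def coords_pow_def coords_one_def nth_append)

lemma snd_coords_prod:
  "(\<And>x. x \<in> set xs \<Longrightarrow> fst x = (\<lambda>_. 0)) \<Longrightarrow>
    snd (coords_prod xs c) i j = (\<Sum>l<length xs. c l * snd (rev xs ! l) i j)"
  by (induction xs) (auto simp: coords_mult_def coords_pow_def coords_one_def nth_append)

lemma coords_pow_Suc: "coords_pow x (k + 1) = coords_mult (coords_pow x k) x"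
proof -
  define e where "e = k * (k - 1) div 2"
  have "(k + 1) * (k + 1 - 1) div 2 = e + k" using choose_two_Suc[of k] by (simp add: e_def)
  then show ?thesis
    unfolding coords_pow_def coords_mult_def e_def[symmetric]
    by (simp add: fun_eq_iff distrib_right)
qed

section \<open>Evaluation of coordinates in \<open>G\<close>\<close>

context two_step_group
begin

context
  fixes gs :: "'a list"
  assumes gs: "set gs \<subseteq> carrier G"
begin

abbreviation "r \<equiv> length gs"

lemma gs_closed [simp]: "i < r \<Longrightarrow> gs ! i \<in> carrier G" using gs nth_mem by blast

primrec gen_prod :: "nat \<Rightarrow> (nat \<Rightarrow> int) \<Rightarrow> 'a" where
  "gen_prod 0 n = \<one>"
| "gen_prod (Suc k) n = gen_prod k n \<otimes> (gs ! k) [^] n k"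

primrec row_prod :: "nat \<Rightarrow> nat \<Rightarrow> (nat \<Rightarrow> int) \<Rightarrow> 'a" where
  "row_prod i 0 m = \<one>"
| "row_prod i (Suc j) m = row_prod i j m \<otimes> commutator G (gs ! i) (gs ! j) [^] m j"

primrec comm_prod :: "nat \<Rightarrow> (nat \<Rightarrow> nat \<Rightarrow> int) \<Rightarrow> 'a" where
  "comm_prod 0 m = \<one>"
| "comm_prod (Suc i) m = comm_prod i m \<otimes> row_prod i i (m i)"

definition coords_val :: "coords \<Rightarrow> 'a" where
  "coords_val x = gen_prod r (fst x) \<otimes> comm_prod r (snd x)"

lemma gen_prod_closed [simp]: "k \<le> r \<Longrightarrow> gen_prod k n \<in> carrier G"
  by (induction k) auto

lemma gen_prod_cong: "(\<And>i. i < k \<Longrightarrow> n i = n' i) \<Longrightarrow> gen_prod k n = gen_prod k n'"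
  by (induction k) auto

lemma row_prod_C [simp]: "i < r \<Longrightarrow> j \<le> r \<Longrightarrow> row_prod i j m \<in> C"
  by (induction j) auto

lemma row_prod_cong: "(\<And>l. l < j \<Longrightarrow> m l = m' l) \<Longrightarrow> row_prod i j m = row_prod i j m'"
  by (induction j) auto

lemma comm_prod_C [simp]: "k \<le> r \<Longrightarrow> comm_prod k m \<in> C"
  by (induction k) auto

lemma comm_prod_closed [simp]: "k \<le> r \<Longrightarrow> comm_prod k m \<in> carrier G"
  by (rule C_carrier) simp

lemma comm_prod_cong:
  "(\<And>i j. j < i \<Longrightarrow> i < k \<Longrightarrow> m i j = m' i j) \<Longrightarrow> comm_prod k m = comm_prod k m'"
  by (induction k) (auto intro: row_prod_cong arg_cong2[where f = "(\<otimes>)"])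

lemma row_prod_add:
  "i < r \<Longrightarrow> j \<le> r \<Longrightarrow> row_prod i j (\<lambda>l. m l + m' l) = row_prod i j m \<otimes> row_prod i j m'"
proof (induction j)
  case (Suc j)
  then have "gs ! i \<in> carrier G" "gs ! j \<in> carrier G" by auto
  then show ?case using Suc by (simp add: int_pow_mult m_assoc Z_ac C_Z C_carrier)
qed simp

lemma comm_prod_add:
  "k \<le> r \<Longrightarrow> comm_prod k (\<lambda>i j. m i j + m' i j) = comm_prod k m \<otimes> comm_prod k m'"
  by (induction k) (simp_all add: row_prod_add m_assoc Z_ac C_Z C_carrier)

lemma row_prod_zero [simp]: "i < r \<Longrightarrow> j \<le> r \<Longrightarrow> row_prod i j (\<lambda>_. 0) = \<one>"
  by (induction j) auto

lemma comm_prod_zero [simp]: "k \<le> r \<Longrightarrow> comm_prod k (\<lambda>_ _. 0) = \<one>"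
  by (induction k) auto

lemma gen_prod_zero [simp]: "k \<le> r \<Longrightarrow> gen_prod k (\<lambda>_. 0) = \<one>"
  by (induction k) auto

lemma row_prod_scale:
  assumes "i < r" "j \<le> r" shows "row_prod i j (\<lambda>l. a * m l) = row_prod i j m [^] a"
  by (rule int_pow_unique[of _ "\<lambda>a. row_prod i j (\<lambda>l. a * m l)"])
    (use assms in \<open>auto simp: row_prod_add distrib_right C_carrier\<close>)

lemma comm_prod_scale:
  assumes "k \<le> r" shows "comm_prod k (\<lambda>i j. a * m i j) = comm_prod k m [^] a"
  by (rule int_pow_unique[of _ "\<lambda>a. comm_prod k (\<lambda>i j. a * m i j)"])
    (use assms in \<open>auto simp: comm_prod_add distrib_right\<close>)

lemma commutator_gen_prod:
  "i < r \<Longrightarrow> j \<le> r \<Longrightarrow> commutator G (gs ! i) (gen_prod j n) = row_prod i j n"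
  by (induction j) (simp_all add: commutator_mult_right commutator_pow_right)

text \<open>In the inductive step the one costly exchange moves \<open>x_k^(n k)\<close> past the
  whole product \<open>P'\<close> of earlier generators, which produces row \<open>k\<close> of the
  commutator product.\<close>

lemma gen_prod_mult:
  "k \<le> r \<Longrightarrow> gen_prod k n \<otimes> gen_prod k n' =
    gen_prod k (\<lambda>i. n i + n' i) \<otimes> comm_prod k (\<lambda>i j. n i * n' j)"
proof (induction k)
  case (Suc k)
  define x where "x = gs ! k"
  define P where "P = gen_prod k n"
  define P' where "P' = gen_prod k n'"
  define Q where "Q = gen_prod k (\<lambda>i. n i + n' i)"
  define c where "c = comm_prod k (\<lambda>i j. n i * n' j)"
  define d where "d = row_prod k k (\<lambda>j. n k * n' j)"
  have cl: "x \<in> carrier G" "P \<in> carrier G" "P' \<in> carrier G" "Q \<in> carrier G"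
    "c \<in> C" "d \<in> C" unfolding x_def P_def P'_def Q_def c_def d_def using Suc.prems by auto
  have IH: "P \<otimes> P' = Q \<otimes> c" unfolding P_def P'_def Q_def c_def using Suc by simp
  have cd: "c \<in> Z" "d \<in> Z" "c \<in> carrier G" "d \<in> carrier G" using cl by (auto simp: C_Z C_carrier)
  have swap: "x [^] n k \<otimes> P' = d \<otimes> (P' \<otimes> x [^] n k)"
  proof -
    have "commutator G (x [^] n k) P' = row_prod k k n' [^] n k"
      using Suc.prems cl by (simp add: commutator_pow_left commutator_gen_prod x_def P'_def)
    also have "\<dots> = d" unfolding d_def using Suc.prems by (simp add: row_prod_scale)
    finally show ?thesis using mult_swap[of "x [^] n k" P'] cl by simp
  qed
  have "(P \<otimes> x [^] n k) \<otimes> (P' \<otimes> x [^] n' k) = P \<otimes> ((x [^] n k \<otimes> P') \<otimes> x [^] n' k)"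
    using cl by (simp add: m_assoc)
  also have "\<dots> = d \<otimes> ((P \<otimes> P') \<otimes> (x [^] n k \<otimes> x [^] n' k))"
    unfolding swap using cl cd by (simp add: m_assoc Z_lcomm[of d P])
  also have "\<dots> = d \<otimes> (c \<otimes> (Q \<otimes> x [^] (n k + n' k)))"
    unfolding IH using cl cd by (simp add: m_assoc int_pow_mult Z_lcomm[of c Q])
  also have "\<dots> = (d \<otimes> c) \<otimes> (Q \<otimes> x [^] (n k + n' k))"
    using cl cd by (simp add: m_assoc)
  also have "\<dots> = (Q \<otimes> x [^] (n k + n' k)) \<otimes> (d \<otimes> c)"
    using cl cd by (intro Z_comm[symmetric]) auto
  also have "d \<otimes> c = c \<otimes> d" using cd by (intro Z_ac(1))
  finally show ?case unfolding x_def P_def P'_def Q_def c_def d_def by simp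
qed simp

lemma coords_val_closed [simp]: "coords_val x \<in> carrier G"
  by (simp add: coords_val_def)

lemma coords_val_mult: "coords_val (coords_mult x y) = coords_val x \<otimes> coords_val y"
proof -
  define P where "P = gen_prod r (fst x)"
  define P' where "P' = gen_prod r (fst y)"
  define c where "c = comm_prod r (snd x)"
  define d where "d = comm_prod r (snd y)"
  define Q where "Q = gen_prod r (\<lambda>i. fst x i + fst y i)"
  define b where "b = comm_prod r (\<lambda>i j. fst x i * fst y j)"
  have cl: "P \<in> carrier G" "P' \<in> carrier G" "Q \<in> carrier G"
    unfolding P_def P'_def Q_def by auto
  have cd: "c \<in> Z" "d \<in> Z" "b \<in> Z" "c \<in> carrier G" "d \<in> carrier G" "b \<in> carrier G"
    unfolding c_def d_def b_def by (auto simp: C_Z)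
  have PP: "P \<otimes> P' = Q \<otimes> b" unfolding P_def P'_def Q_def b_def by (rule gen_prod_mult) simp
  have "coords_val x \<otimes> coords_val y = P \<otimes> (c \<otimes> (P' \<otimes> d))"
    unfolding coords_val_def P_def P'_def c_def d_def by (simp add: m_assoc)
  also have "\<dots> = (P \<otimes> P') \<otimes> (c \<otimes> d)"
    using cl cd Z_lcomm[of c P' d] by (simp add: m_assoc)
  also have "\<dots> = Q \<otimes> (c \<otimes> d \<otimes> b)"
    unfolding PP using cl cd by (simp add: m_assoc Z_ac)
  also have "c \<otimes> d \<otimes> b = comm_prod r (\<lambda>i j. snd x i j + snd y i j + fst x i * fst y j)"
    unfolding c_def d_def b_def by (simp add: comm_prod_add)
  finally show ?thesis by (simp add: coords_val_def coords_mult_def Q_def)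
qed

lemma coords_val_one [simp]: "coords_val coords_one = \<one>"
  by (simp add: coords_val_def coords_one_def)

lemma coords_val_inv: "coords_val (coords_inv x) = inv (coords_val x)"
proof -
  have "coords_mult (coords_inv x) x = coords_one"
    by (simp add: coords_mult_def coords_inv_def coords_one_def)
  then have "coords_val (coords_inv x) \<otimes> coords_val x = \<one>"
    by (simp add: coords_val_mult[symmetric])
  then show ?thesis by (simp add: inv_equality)
qed

lemma coords_val_pow: "coords_val (coords_pow x k) = coords_val x [^] k"
proof (rule int_pow_unique[of _ "\<lambda>k. coords_val (coords_pow x k)"])
  have "coords_pow x 0 = coords_one" by (simp add: coords_pow_def coords_one_def)
  then show "coords_val (coords_pow x 0) = \<one>" by simp
qed (auto simp: coords_pow_Suc coords_val_mult)

lemma coords_val_prod: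
  "(\<And>x. x \<in> set xs \<Longrightarrow> coords_val x = \<one>) \<Longrightarrow> coords_val (coords_prod xs c) = \<one>"
  by (induction xs) (simp_all add: coords_val_mult coords_val_pow)

lemma coords_val_cong: "coords_cong r 0 x y \<Longrightarrow> coords_val x = coords_val y"
  unfolding coords_val_def coords_cong_def
  by (intro arg_cong2[where f = "(\<otimes>)"] gen_prod_cong comm_prod_cong) auto

lemma coords_val_gen: "g < r \<Longrightarrow> coords_val (gen_coords g) = gs ! g"
proof -
  assume g: "g < r"
  have "gen_prod k (\<lambda>i. if i = g then 1 else 0) = (if g < k then gs ! g else \<one>)" if "k \<le> r" for k
    using that by (induction k) (use g in \<open>auto simp: less_Suc_eq\<close>)
  then show ?thesis using g by (simp add: coords_val_def gen_coords_def)
qed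

text \<open>The linear coordinates of a commutator cancel, so every commutator is a product of
  commutators of generators, and these products form a subgroup.\<close>

lemma C_eq_comm_prod:
  assumes gen: "\<And>g. g \<in> carrier G \<Longrightarrow> \<exists>x. g = coords_val x" and c: "c \<in> C"
  shows "\<exists>m. c = comm_prod r m"
proof -
  have "C \<subseteq> range (comm_prod r)"
  proof (rule derived_subset)
    show "subgroup (range (comm_prod r)) G"
    proof
      show "range (comm_prod r) \<subseteq> carrier G" by auto
      show "\<one> \<in> range (comm_prod r)" by (rule range_eqI[of _ _ "\<lambda>_ _. 0"]) simp
      fix x assume "x \<in> range (comm_prod r)"
      then obtain m where m: "x = comm_prod r m" by blast
      have "inv x = comm_prod r (\<lambda>i j. - 1 * m i j)"
        using int_pow_neg_int[of x 1] m by (simp only: comm_prod_scale) simp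
      then show "inv x \<in> range (comm_prod r)" by blast
      fix y assume "y \<in> range (comm_prod r)"
      then show "x \<otimes> y \<in> range (comm_prod r)" using m by (auto simp: comm_prod_add[symmetric])
    qed
    fix g h assume gh: "g \<in> carrier G" "h \<in> carrier G"
    then obtain x y where x: "g = coords_val x" and y: "h = coords_val y" using gen by blast
    define z where "z = coords_mult (coords_mult x y) (coords_inv (coords_mult y x))"
    have "commutator G g h = coords_val z"
      using gh unfolding z_def coords_val_mult coords_val_inv x[symmetric] y[symmetric]
      by (simp add: commutator_def inv_mult_group m_assoc)
    moreover have "fst z = (\<lambda>_. 0)" by (simp add: z_def coords_mult_def coords_inv_def)
    ultimately show "commutator G g h \<in> range (comm_prod r)" by (simp add: coords_val_def)
  qed
  then show ?thesis using c by blast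
qed

lemma coords_surj:
  assumes "generate G (set gs) = carrier G" "g \<in> carrier G"
  shows "\<exists>x. g = coords_val x"
proof -
  have "g \<in> generate G (set gs)" using assms by simp
  then show ?thesis
  proof (induction rule: generate.induct)
    case one show ?case using coords_val_one by metis
  next
    case (incl h) then show ?case using coords_val_gen by (metis in_set_conv_nth)
  next
    case (inv h) then show ?case using coords_val_gen coords_val_inv by (metis in_set_conv_nth)
  next
    case (eng a b) then show ?case using coords_val_mult by metis
  qed
qed

section \<open>Relations among the generators\<close>

text \<open>The exponent vectors that become trivial in the abelian group
  \<open>G/C\<close>.\<close>

definition relation_lattice :: "(nat \<Rightarrow> int) set" where
  "relation_lattice = {n. gen_prod r n \<in> C}"

lemma gen_prod_coset:
  "gen_prod r n \<otimes> gen_prod r n' \<otimes> inv (gen_prod r (\<lambda>i. n i + n' i)) \<in> C"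
proof -
  let ?c = "comm_prod r (\<lambda>i j. n i * n' j)" and ?Q = "gen_prod r (\<lambda>i. n i + n' i)"
  have "gen_prod r n \<otimes> gen_prod r n' \<otimes> inv ?Q = ?Q \<otimes> ?c \<otimes> inv ?Q"
    by (simp add: gen_prod_mult)
  also have "\<dots> = ?c \<otimes> ?Q \<otimes> inv ?Q" using Z_comm[of ?c ?Q] by (simp add: C_Z)
  also have "\<dots> = ?c" by (simp add: m_assoc)
  finally show ?thesis by simp
qed

lemma C_mult_iff:
  assumes "c \<in> C" "g \<in> carrier G"
  shows "c \<otimes> g \<in> C \<longleftrightarrow> g \<in> C" "g \<otimes> c \<in> C \<longleftrightarrow> g \<in> C"
proof -
  have "g = inv c \<otimes> (c \<otimes> g)" "g = (g \<otimes> c) \<otimes> inv c"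
    using assms by (simp_all add: C_carrier m_assoc[symmetric] r_inv) (simp add: C_carrier m_assoc)
  then show "c \<otimes> g \<in> C \<longleftrightarrow> g \<in> C" "g \<otimes> c \<in> C \<longleftrightarrow> g \<in> C"
    using assms C_closed by metis+
qed

lemma coords_val_in_C_iff: "coords_val x \<in> C \<longleftrightarrow> fst x \<in> relation_lattice"
  unfolding coords_val_def relation_lattice_def by (simp add: C_mult_iff)

lemma relation_lattice_cong:
  "n \<in> relation_lattice \<Longrightarrow> (\<And>i. i < r \<Longrightarrow> n i = n' i) \<Longrightarrow> n' \<in> relation_lattice"
  unfolding relation_lattice_def using gen_prod_cong[of r n n'] by simp

lemma lattice_like_relation_lattice: "lattice_like relation_lattice"
  unfolding lattice_like_def
proof (intro conjI ballI)
  show "relation_lattice \<noteq> {}"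
    unfolding relation_lattice_def using gen_prod_zero[of r] by (auto intro!: exI[of _ "\<lambda>_. 0"])
  fix n n' assume *: "n \<in> relation_lattice" "n' \<in> relation_lattice"
  define P where "P = gen_prod r (\<lambda>i. n i - n' i)"
  define P' where "P' = gen_prod r n'"
  have "P \<otimes> P' \<otimes> inv (gen_prod r n) \<in> C"
    using gen_prod_coset[of "\<lambda>i. n i - n' i" n'] by (simp add: P_def P'_def)
  moreover have "gen_prod r n \<in> C" "P' \<in> C" "P \<in> carrier G"
    using * by (auto simp: relation_lattice_def P_def P'_def)
  ultimately have "P \<in> C" by (simp add: C_mult_iff C_carrier)
  then show "(\<lambda>i. n i - n' i) \<in> relation_lattice" by (simp add: relation_lattice_def P_def)
qed

lemma relation_lattice_separation:
  assumes gen: "generate G (set gs) = carrier G"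
  shows "\<exists>R::int. R > 0 \<and>
    (\<forall>h\<in>carrier G. \<forall>k::int. k > 0 \<longrightarrow> h [^] k \<in> C \<longrightarrow> h [^] R \<in> C) \<and>
    (\<forall>g\<in>carrier G. (\<forall>M::int. M > 0 \<longrightarrow> (\<exists>h\<in>carrier G. \<exists>c\<in>C. g = h [^] M \<otimes> c)) \<longrightarrow> g \<in> C)"
proof -
  let ?L = relation_lattice
  obtain \<Lambda> R where ann: "annihilators r ?L \<Lambda> R"
    using lattice_like_annihilators[OF lattice_like_relation_lattice] by blast
  let ?f = "\<lambda>\<phi> n. (\<Sum>i<r. \<phi> i * n i) :: int"
  have fin: "finite \<Lambda>" and "R > 0" and van: "\<And>\<phi> x. \<phi> \<in> \<Lambda> \<Longrightarrow> x \<in> ?L \<Longrightarrow> ?f \<phi> x = 0"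
    and sep: "\<And>x. (\<forall>\<phi>\<in>\<Lambda>. ?f \<phi> x = 0) \<Longrightarrow> \<exists>y\<in>?L. \<forall>i<r. y i = int R * x i"
    using ann unfolding annihilators_def by blast+
  have sep': "(\<lambda>i. int R * x i) \<in> ?L" if "\<forall>\<phi>\<in>\<Lambda>. ?f \<phi> x = 0" for x
    using sep[OF that] by (auto elim: relation_lattice_cong)
  have scale: "?f \<phi> (\<lambda>i. k * n i) = k * ?f \<phi> n" for \<phi> n k
    by (simp add: sum_distrib_left algebra_simps)
  have pow: "h [^] k \<in> C \<longleftrightarrow> (\<lambda>i. k * fst x i) \<in> ?L" if "h = coords_val x" for h x k
    unfolding that coords_val_pow[symmetric] coords_val_in_C_iff by (simp add: coords_pow_def)
  have tors: "h [^] int R \<in> C" if h: "h \<in> carrier G" and k: "k > 0" "h [^] k \<in> C" for h and k :: int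
  proof -
    obtain x where x: "h = coords_val x" using coords_surj[OF gen h] by blast
    have "\<forall>\<phi>\<in>\<Lambda>. k * ?f \<phi> (fst x) = 0"
      using van k(2) unfolding pow[OF x] by (simp add: scale[symmetric])
    then have "(\<lambda>i. int R * fst x i) \<in> ?L" using k(1) by (intro sep') auto
    then show ?thesis unfolding pow[OF x] .
  qed
  have resid: "g \<in> C" if g: "g \<in> carrier G"
    and M: "\<And>M::int. M > 0 \<Longrightarrow> \<exists>h\<in>carrier G. \<exists>c\<in>C. g = h [^] M \<otimes> c" for g
  proof -
    obtain x where x: "g = coords_val x" using coords_surj[OF gen g] by blast
    \<comment> \<open>\<open>B\<close> exceeds all \<open>\<bar>\<phi> x\<bar>\<close>, so
      \<open>\<phi> x = R * B * \<phi> y\<close> is possible only if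
      \<open>\<phi> y = 0\<close>.\<close>
    define B where "B = 1 + (\<Sum>\<phi>\<in>\<Lambda>. \<bar>?f \<phi> (fst x)\<bar>)"
    have "B > 0" unfolding B_def by (intro add_pos_nonneg sum_nonneg) auto
    then have "int R * B > 0" using \<open>R > 0\<close> by simp
    then obtain h c where h: "h \<in> carrier G" and c: "c \<in> C" and gh: "g = h [^] (int R * B) \<otimes> c"
      using M by blast
    obtain y where y: "h = coords_val y" using coords_surj[OF gen h] by blast
    define z where "z = coords_mult x (coords_pow y (- (int R * B)))"
    have "coords_val z = h [^] (int R * B) \<otimes> c \<otimes> h [^] (- (int R * B))"
      unfolding z_def coords_val_mult coords_val_pow x[symmetric] y[symmetric] gh ..
    also have "\<dots> = c"
      using h c Z_comm[of c "h [^] (int R * B)"]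
      by (simp add: C_Z C_carrier m_assoc int_pow_neg)
    finally have "fst z \<in> ?L" using c by (simp add: coords_val_in_C_iff[symmetric])
    then have z: "(\<lambda>i. fst x i - int R * B * fst y i) \<in> ?L"
      by (simp add: z_def coords_mult_def coords_pow_def)
    have "?f \<phi> (fst y) = 0" if "\<phi> \<in> \<Lambda>" for \<phi>
    proof -
      have "?f \<phi> (fst x) - int R * B * ?f \<phi> (fst y) = 0"
        using van[OF that z] by (simp add: algebra_simps sum_subtractf sum_distrib_left)
      then have eq: "\<bar>?f \<phi> (fst x)\<bar> = int R * B * \<bar>?f \<phi> (fst y)\<bar>"
        using \<open>B > 0\<close> by (simp add: abs_mult)
      have "\<bar>?f \<phi> (fst x)\<bar> \<le> (\<Sum>\<phi>\<in>\<Lambda>. \<bar>?f \<phi> (fst x)\<bar>)"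
        by (rule member_le_sum[OF that _ fin]) auto
      then have lt: "\<bar>?f \<phi> (fst x)\<bar> < B" unfolding B_def by linarith
      show ?thesis
      proof (rule ccontr)
        assume "?f \<phi> (fst y) \<noteq> 0"
        then have "1 * 1 \<le> int R * \<bar>?f \<phi> (fst y)\<bar>" using \<open>R > 0\<close> by (intro mult_mono) auto
        then have "B * 1 \<le> B * (int R * \<bar>?f \<phi> (fst y)\<bar>)" using \<open>B > 0\<close> by (intro mult_left_mono) auto
        then show False using eq lt by (simp add: ac_simps)
      qed
    qed
    then have "(\<lambda>i. int R * fst y i) \<in> ?L" by (intro sep') auto
    \<comment> \<open>\<open>x = (x - R B y) + B (R y)\<close> is a combination of two relations;
      for the second summand the exponent was chosen to contain \<open>R\<close>.\<close>
    from lattice_like_combination[OF lattice_like_relation_lattice z this, of 1 B]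
    have "fst x \<in> ?L" by (simp add: algebra_simps)
    then show ?thesis unfolding x coords_val_in_C_iff .
  qed
  show ?thesis
    by (rule exI[of _ "int R"], intro conjI ballI allI impI)
      (use \<open>R > 0\<close> in simp, erule (2) tors, rule resid, assumption, simp)
qed

text \<open>Relators lifting generators of the relation lattice adjust the linear coordinates; what
  remains is a relation among commutators, an additive problem. So one ordered product of powers
  represents the whole kernel, and membership is expressed by integer exponents instead of words in
  relators.\<close>

lemma kernel_generators:
  assumes gen: "generate G (set gs) = carrier G"
  shows "\<exists>\<rho>s. (\<forall>\<rho>\<in>set \<rho>s. coords_val \<rho> = \<one>) \<and>
    (\<forall>x. coords_val x = \<one> \<longrightarrow> (\<exists>c. coords_cong r 0 x (coords_prod \<rho>s c)))"
proof -
  \<comment> \<open>Matrices are stored row by row in a sequence so that the lattice lemma also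
    applies to commutator coordinates.\<close>
  define flat :: "(nat \<Rightarrow> int) \<Rightarrow> nat \<Rightarrow> nat \<Rightarrow> int" where "flat = (\<lambda>x i j. x (i * r + j))"
  define K where "K = {x. comm_prod r (flat x) = \<one>}"
  have K: "lattice_like K" unfolding lattice_like_def
  proof (intro conjI ballI)
    have "(\<lambda>_. 0) \<in> K" by (simp add: K_def flat_def)
    then show "K \<noteq> {}" by blast
    fix x y assume "x \<in> K" "y \<in> K"
    moreover have "flat (\<lambda>i. x i - y i) = (\<lambda>i j. flat x i j + - 1 * flat y i j)"
      by (simp add: flat_def)
    moreover have "comm_prod r (\<lambda>i j. flat x i j + - 1 * flat y i j) =
        comm_prod r (flat x) \<otimes> comm_prod r (flat y) [^] (- 1 :: int)"
      by (simp only: comm_prod_add comm_prod_scale order_refl)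
    ultimately show "(\<lambda>i. x i - y i) \<in> K" by (simp only: K_def mem_Collect_eq) simp
  qed
  obtain us where us: "set us \<subseteq> relation_lattice"
    and us_gen: "\<And>x. x \<in> relation_lattice \<Longrightarrow> \<exists>c::nat \<Rightarrow> int. \<forall>i<r. x i = (\<Sum>l<length us. c l * (us ! l) i)"
    using lattice_like_finitely_generated[OF lattice_like_relation_lattice, of r] by blast
  obtain vs where vs: "set vs \<subseteq> K"
    and vs_gen: "\<And>x. x \<in> K \<Longrightarrow> \<exists>c::nat \<Rightarrow> int. \<forall>i<r * r. x i = (\<Sum>l<length vs. c l * (vs ! l) i)"
    using lattice_like_finitely_generated[OF K, of "r * r"] by blast
  have "\<exists>m. coords_val (n, m) = \<one>" if "n \<in> relation_lattice" for n
  proof -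
    have n: "gen_prod r n \<in> C" using that by (simp add: relation_lattice_def)
    then obtain m where "inv (gen_prod r n) = comm_prod r m"
      using C_eq_comm_prod[OF coords_surj[OF gen], of "inv (gen_prod r n)"] by auto
    then have "coords_val (n, m) = gen_prod r n \<otimes> inv (gen_prod r n)" by (simp add: coords_val_def)
    then show ?thesis by auto
  qed
  then obtain mm where mm: "\<And>n. n \<in> relation_lattice \<Longrightarrow> coords_val (n, mm n) = \<one>" by metis
  \<comment> \<open>Reversed, because \<open>coords_prod\<close> indexes its exponents from the
    end.\<close>
  define \<rho>1 where "\<rho>1 = rev (map (\<lambda>n. (n, mm n)) us)"
  define \<rho>2 where "\<rho>2 = rev (map (\<lambda>x. (\<lambda>_::nat. 0::int, flat x)) vs)"
  have one1: "coords_val \<rho> = \<one>" if "\<rho> \<in> set \<rho>1" for \<rho>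
    using that us mm unfolding \<rho>1_def by auto
  have one2: "coords_val \<rho> = \<one>" if "\<rho> \<in> set \<rho>2" for \<rho>
    using that vs unfolding \<rho>2_def K_def by (auto simp: coords_val_def)
  have "\<exists>c. coords_cong r 0 x (coords_prod (\<rho>1 @ \<rho>2) c)" if x: "coords_val x = \<one>" for x
  proof -
    have "fst x \<in> relation_lattice" using x by (simp add: coords_val_in_C_iff[symmetric])
    then obtain c1 where c1: "\<And>i. i < r \<Longrightarrow> fst x i = (\<Sum>l<length us. c1 l * (us ! l) i)"
      using us_gen by blast
    define y where "y = coords_prod \<rho>1 c1"
    have y1: "fst y i = fst x i" if "i < r" for i
      using c1[OF that] unfolding y_def \<rho>1_def by (simp add: fst_coords_prod)
    have yv: "coords_val y = \<one>" unfolding y_def by (rule coords_val_prod[OF one1])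
    define d where "d k = snd x (k div r) (k mod r) - snd y (k div r) (k mod r)" for k
    have flat_d: "flat d i j = snd x i j - snd y i j" if "j < i" "i < r" for i j
    proof -
      have "j < r" "r \<noteq> 0" using that by auto
      then have "(i * r + j) div r = i" by simp
      with \<open>j < r\<close> show ?thesis by (simp add: flat_def d_def)
    qed
    define P where "P = gen_prod r (fst y)"
    define D where "D = comm_prod r (flat d)"
    define E where "E = comm_prod r (snd y)"
    have cl: "P \<in> carrier G" "D \<in> Z" "D \<in> carrier G" "E \<in> carrier G"
      by (simp_all add: P_def D_def E_def C_Z)
    have "gen_prod r (fst x) = P" unfolding P_def by (rule gen_prod_cong) (simp add: y1)
    moreover have "comm_prod r (snd x) = D \<otimes> E"
      unfolding D_def E_def comm_prod_add[OF order_refl, symmetric]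
      by (rule comm_prod_cong) (simp add: flat_d)
    ultimately have "P \<otimes> (D \<otimes> E) = \<one>" using x by (simp add: coords_val_def)
    moreover have "P \<otimes> E = \<one>" using yv by (simp add: coords_val_def P_def E_def)
    ultimately have "comm_prod r (flat d) = \<one>"
      using cl Z_lcomm[of D P E] by (simp add: D_def[symmetric])
    then obtain c2 where c2: "\<And>k. k < r * r \<Longrightarrow> d k = (\<Sum>l<length vs. c2 l * (vs ! l) k)"
      using vs_gen[of d] unfolding K_def by blast
    define z where "z = coords_prod \<rho>2 c2"
    have z1: "fst z i = 0" for i
      unfolding z_def fst_coords_prod by (rule sum.neutral) (simp add: \<rho>2_def)
    have z2: "snd z i j = snd x i j - snd y i j" if "i < r" "j < i" for i j
    proof -
      have "i * r + j < r * r"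
      proof -
        have "i * r + j < Suc i * r" using that by simp
        also have "\<dots> \<le> r * r" using that by (intro mult_le_mono1) simp
        finally show ?thesis .
      qed
      then have "snd z i j = d (i * r + j)"
        unfolding z_def using c2 by (subst snd_coords_prod) (auto simp: \<rho>2_def flat_def)
      then show ?thesis using flat_d[OF that(2,1)] by (simp add: flat_def)
    qed
    \<comment> \<open>Counted from the end, the exponents of \<open>\<rho>2\<close> come before
      those of \<open>\<rho>1\<close>.\<close>
    define c where "c l = (if l < length \<rho>2 then c2 l else c1 (l - length \<rho>2))" for l
    have "coords_prod (\<rho>1 @ \<rho>2) c = coords_mult y z"
      unfolding coords_prod_append y_def z_def
      by (intro arg_cong2[where f = coords_mult] coords_prod_cong) (auto simp: c_def)
    then have "coords_cong r 0 x (coords_prod (\<rho>1 @ \<rho>2) c)"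
      by (simp add: coords_cong_def coords_mult_def y1 z1 z2)
    then show ?thesis by blast
  qed
  then show ?thesis using one1 one2 by (intro exI[of _ "\<rho>1 @ \<rho>2"]) auto
qed

text \<open>The power \<open>h^(2M)\<close> differs from the linear part by commutators with
  exponent \<open>2M choose 2 = M (2M - 1)\<close>, a multiple of \<open>M\<close> though in general
  not of \<open>2M\<close>. This fixes the shape of \<open>power_coset\<close>.\<close>

lemma coords_val_scaled:
  "\<exists>h\<in>carrier G. \<exists>c\<in>C. coords_val (\<lambda>i. 2 * M * a i, \<lambda>i j. 2 * M * b i j) = h [^] (2 * M) \<otimes> c [^] M"
proof -
  define h where "h = coords_val (a, \<lambda>_ _. 0)"
  define P where "P = gen_prod r (\<lambda>i. 2 * M * a i)"
  define q where "q = comm_prod r (\<lambda>i j. a i * a j)"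
  define e where "e = M * (2 * M - 1)"
  have e: "2 * M * (2 * M - 1) div 2 = e" by (simp add: e_def)
  have cl: "P \<in> carrier G" "q \<in> C" "q \<in> carrier G" by (auto simp: P_def q_def)
  have "h [^] (2 * M) = P \<otimes> q [^] e"
    unfolding h_def coords_val_pow[symmetric] P_def q_def
    by (simp add: coords_pow_def coords_val_def e comm_prod_scale)
  then have "P = h [^] (2 * M) \<otimes> q [^] (- e)"
    using cl by (simp add: m_assoc int_pow_mult[symmetric])
  moreover have "coords_val (\<lambda>i. 2 * M * a i, \<lambda>i j. 2 * M * b i j) = P \<otimes> comm_prod r b [^] (2 * M)"
    by (simp add: coords_val_def P_def comm_prod_scale)
  moreover have "q [^] (- e) \<otimes> comm_prod r b [^] (2 * M) =
      (q [^] (- (2 * M - 1)) \<otimes> comm_prod r b [^] (2::int)) [^] M"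
    using cl by (simp add: Z_mult_pow C_Z int_pow_pow e_def algebra_simps)
  moreover have "h \<in> carrier G" by (simp add: h_def)
  ultimately have "coords_val (\<lambda>i. 2 * M * a i, \<lambda>i j. 2 * M * b i j) =
      h [^] (2 * M) \<otimes> (q [^] (- (2 * M - 1)) \<otimes> comm_prod r b [^] (2::int)) [^] M"
    using cl by (simp add: m_assoc)
  moreover have "q [^] (- (2 * M - 1)) \<otimes> comm_prod r b [^] (2::int) \<in> C" using cl by simp
  ultimately show ?thesis using \<open>h \<in> carrier G\<close> by blast
qed

text \<open>\<open>x\<close> factors as the kernel element \<open>y\<close> times an element all of
  whose coordinates are divisible by \<open>2M\<close>.\<close>

lemma coords_val_cong_mod:
  assumes "coords_cong r (2 * M) x y" "coords_val y = \<one>"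
  shows "\<exists>h\<in>carrier G. \<exists>c\<in>C. coords_val x = h [^] (2 * M) \<otimes> c [^] M"
proof -
  define a where "a i = (fst x i - fst y i) div (2 * M)" for i
  \<comment> \<open>The subtracted product compensates for the bilinear term of
    \<open>coords_mult\<close>.\<close>
  define b where "b i j = (snd x i j - snd y i j) div (2 * M) - fst y i * a j" for i j
  have a: "fst x i = fst y i + 2 * M * a i" if "i < r" for i
  proof -
    have "2 * M * a i = fst x i - fst y i"
      unfolding a_def using assms(1) that by (intro dvd_mult_div_cancel) (simp add: coords_cong_def)
    then show ?thesis by simp
  qed
  have b: "snd x i j = snd y i j + 2 * M * b i j + fst y i * (2 * M * a j)" if "i < r" "j < i" for i j
  proof -
    have "2 * M * ((snd x i j - snd y i j) div (2 * M)) = snd x i j - snd y i j"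
      using assms(1) that by (intro dvd_mult_div_cancel) (simp add: coords_cong_def)
    then show ?thesis unfolding b_def by (simp add: right_diff_distrib)
  qed
  have "coords_cong r 0 x (coords_mult y (\<lambda>i. 2 * M * a i, \<lambda>i j. 2 * M * b i j))"
    unfolding coords_cong_def coords_mult_def using a b by simp
  then have "coords_val x = coords_val (\<lambda>i. 2 * M * a i, \<lambda>i j. 2 * M * b i j)"
    using assms(2) by (simp add: coords_val_cong coords_val_mult)
  then show ?thesis using coords_val_scaled by simp
qed

end
end

section \<open>The decision procedure\<close>

lemma coords_cong_refl: "coords_cong r M x x"
  by (simp add: coords_cong_def)

lemma coords_cong_sym: "coords_cong r M x y \<Longrightarrow> coords_cong r M y x"
  unfolding coords_cong_def by (metis dvd_diff_commute)

lemma coords_cong_trans: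
  assumes "coords_cong r M x y" "coords_cong r M y z" shows "coords_cong r M x z"
proof -
  have *: "M dvd a - c" if "M dvd a - b" "M dvd b - c" for a b c :: int
    using dvd_add[OF that] by simp
  show ?thesis using assms unfolding coords_cong_def by (blast intro: *)
qed

lemma dvd_diff_mult:
  fixes M a a' b b' :: int
  assumes "M dvd a - a'" "M dvd b - b'"
  shows "M dvd a * b - a' * b'"
proof -
  have "a * b - a' * b' = (a - a') * b + a' * (b - b')" by (simp add: algebra_simps)
  with assms show ?thesis by simp
qed

lemma dvd_diff_add:
  fixes M a a' b b' :: int
  assumes "M dvd a - a'" "M dvd b - b'"
  shows "M dvd (a + b) - (a' + b')"
  using dvd_add[OF assms] by (simp add: algebra_simps)

lemma dvd_diff_diff:
  fixes M a a' b b' :: int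
  assumes "M dvd a - a'" "M dvd b - b'"
  shows "M dvd (a - b) - (a' - b')"
  using dvd_diff[OF assms] by (simp add: algebra_simps)

lemma coords_cong_mult:
  assumes "coords_cong r M x x'" "coords_cong r M y y'"
  shows "coords_cong r M (coords_mult x y) (coords_mult x' y')"
  using assms unfolding coords_cong_def coords_mult_def fst_conv snd_conv
  by (intro conjI allI impI dvd_diff_add dvd_diff_mult) auto

lemma coords_cong_inv:
  assumes "coords_cong r M x x'" shows "coords_cong r M (coords_inv x) (coords_inv x')"
proof -
  have "M dvd - a - - b" if "M dvd a - b" for a b :: int
    using that dvd_diff_commute[of M a b] by simp
  then show ?thesis using assms unfolding coords_cong_def coords_inv_def fst_conv snd_conv
    by (intro conjI allI impI dvd_diff_diff dvd_diff_mult) auto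
qed

text \<open>The residue of \<open>k choose 2\<close> modulo \<open>M\<close> is determined only by
  \<open>k\<close> modulo \<open>2M\<close>; hence exponents are compared modulo twice the modulus
  of the coordinates.\<close>

lemma dvd_diff_choose_two:
  assumes "2 * M dvd k - k'" shows "M dvd k * (k - 1) div 2 - k' * (k' - 1) div (2 :: int)"
proof -
  obtain t where t: "k = k' + 2 * M * t" using assms by (auto simp: dvd_def algebra_simps)
  have "even (k' * (k' - 1))" by auto
  then obtain p where p: "k' * (k' - 1) = 2 * p" by blast
  have "k * (k - 1) = 2 * (p + M * (t * (2 * k' - 1 + 2 * M * t)))"
    using p unfolding t by (simp add: algebra_simps)
  then show ?thesis using p by simp
qed

lemma coords_cong_pow:
  assumes "2 * M dvd k - k'" shows "coords_cong r M (coords_pow x k) (coords_pow x k')"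
proof -
  have "M dvd k - k'" using assms dvd_mult_right by (metis dvd_mult_left mult.commute)
  then show ?thesis using assms unfolding coords_cong_def coords_pow_def fst_conv snd_conv
    by (intro conjI allI impI dvd_diff_add dvd_diff_mult dvd_diff_choose_two) auto
qed

lemma coords_cong_prod:
  "(\<And>l. l < length xs \<Longrightarrow> 2 * M dvd c l - c' l) \<Longrightarrow>
    coords_cong r M (coords_prod xs c) (coords_prod xs c')"
  by (induction xs) (auto intro: coords_cong_mult coords_cong_pow coords_cong_refl)

section \<open>Equations in coordinates\<close>

primrec symbol_coords :: "(nat \<Rightarrow> coords) \<Rightarrow> symbol \<Rightarrow> coords" where
  "symbol_coords X (Gen g) = gen_coords g"
| "symbol_coords X (Var v) = X v"

definition letter_coords :: "(nat \<Rightarrow> coords) \<Rightarrow> symbol \<times> bool \<Rightarrow> coords" where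
  "letter_coords X l =
     (if snd l then coords_inv (symbol_coords X (fst l)) else symbol_coords X (fst l))"

primrec word_coords :: "(nat \<Rightarrow> coords) \<Rightarrow> equation \<Rightarrow> coords" where
  "word_coords X [] = coords_one"
| "word_coords X (l # w) = coords_mult (letter_coords X l) (word_coords X w)"

lemma word_coords_cong:
  assumes "\<And>v e. (Var v, e) \<in> set w \<Longrightarrow> coords_cong r M (X v) (X' v)"
  shows "coords_cong r M (word_coords X w) (word_coords X' w)"
  using assms
proof (induction w)
  case (Cons l w)
  have "coords_cong r M (symbol_coords X (fst l)) (symbol_coords X' (fst l))"
    using Cons.prems[of _ "snd l"] by (cases l; cases "fst l") (auto intro: coords_cong_refl)
  then have "coords_cong r M (letter_coords X l) (letter_coords X' l)"
    by (simp add: letter_coords_def coords_cong_inv)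
  moreover have "coords_cong r M (word_coords X w) (word_coords X' w)"
    by (rule Cons.IH) (use Cons.prems in auto)
  ultimately show ?case by (simp add: coords_cong_mult)
qed (simp add: coords_cong_refl)

lemma fst_word_coords:
  "fst (word_coords X w) i = (\<Sum>p<length w. fst (letter_coords X (w ! p)) i)"
  by (induction w) (simp_all add: coords_one_def coords_mult_def sum.lessThan_Suc_shift
      del: sum.lessThan_Suc)

text \<open>Each pair of positions \<open>p < q\<close> contributes one collection term. Sums over
  fixed ranges replace recursion on the word, so \<open>rec_int_sum\<close> applies to coded
  words.\<close>

lemma snd_word_coords:
  "snd (word_coords X w) i j = (\<Sum>p<length w. snd (letter_coords X (w ! p)) i j +
    fst (letter_coords X (w ! p)) i *
      (\<Sum>q<length w. if p < q then fst (letter_coords X (w ! q)) j else 0))"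
  by (induction w) (simp_all add: coords_one_def coords_mult_def sum.lessThan_Suc_shift
      fst_word_coords algebra_simps del: sum.lessThan_Suc cong: if_cong)

text \<open>
  A single integer sequence stores the coordinates of all variables and the exponents
  of the relators; residues modulo 3 keep the three kinds of entries apart.
\<close>

definition var_coords :: "(nat \<Rightarrow> int) \<Rightarrow> nat \<Rightarrow> coords" where
  "var_coords E v =
     (\<lambda>i. E (3 * prod_encode (v, i)), \<lambda>i j. E (3 * prod_encode (v, prod_encode (i, j)) + 1))"

definition relator_exponents :: "(nat \<Rightarrow> int) \<Rightarrow> nat \<Rightarrow> int" where
  "relator_exponents E l = E (3 * l + 2)"

lemma ex_sequence: "\<exists>E. var_coords E = X \<and> relator_exponents E = c"
proof -
  define E where "E k = (let m = k div 3; v = fst (prod_decode m); p = snd (prod_decode m) in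
     if k mod 3 = 0 then fst (X v) p
     else if k mod 3 = 1 then snd (X v) (fst (prod_decode p)) (snd (prod_decode p)) else c m)" for k
  have "(3 * m + 1) mod 3 = 1" "(3 * m + 2) mod 3 = 2" "(3 * m + 1) div 3 = m" "(3 * m + 2) div 3 = m"
    for m :: nat by presburger+
  then have "var_coords E = X" "relator_exponents E = c"
    by (simp_all add: E_def var_coords_def relator_exponents_def Let_def fun_eq_iff)
  then show ?thesis by blast
qed

text \<open>If \<open>\<rho>s\<close> represents the kernel as in \<open>kernel_generators\<close>,
  \<open>M = 0\<close> expresses an exact solution; positive \<open>M\<close> gives approximate
  ones.\<close>

definition satisfies :: "nat \<Rightarrow> coords list \<Rightarrow> equation \<Rightarrow> int \<Rightarrow> (nat \<Rightarrow> int) \<Rightarrow> bool" where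
  "satisfies r \<rho>s w M E \<longleftrightarrow>
     coords_cong r M (word_coords (var_coords E) w) (coords_prod \<rho>s (relator_exponents E))"

text \<open>Exceeds all positions of the sequence that are read: coordinates of variables up to
  \<open>n\<close> with indices below \<open>r\<close>, and the exponents of the relators.\<close>

definition index_bound :: "nat \<Rightarrow> coords list \<Rightarrow> nat \<Rightarrow> nat" where
  "index_bound r \<rho>s n = 3 * prod_encode (n, prod_encode (r, r)) + (3 * length \<rho>s + 3)"

lemma satisfies_cong:
  assumes "satisfies r \<rho>s w M E" and E: "\<And>k. k < index_bound r \<rho>s n \<Longrightarrow> 2 * M dvd E k - E' k"
    and n: "\<And>v e. (Var v, e) \<in> set w \<Longrightarrow> v \<le> n"
  shows "satisfies r \<rho>s w M E'"
proof -
  have "coords_cong r M (var_coords E v) (var_coords E' v)" if "v \<le> n" for v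
  proof -
    have 1: "3 * prod_encode (v, i) < index_bound r \<rho>s n" if "i < r" for i
      using prod_encode_mono[OF \<open>v \<le> n\<close>, of i "prod_encode (r, r)"] that
        le_prod_encode_1[of r r] by (simp add: index_bound_def)
    have 2: "3 * prod_encode (v, prod_encode (i, j)) + 1 < index_bound r \<rho>s n" if "i < r" "j < i" for i j
      using prod_encode_mono[OF \<open>v \<le> n\<close>, of "prod_encode (i, j)" "prod_encode (r, r)"] that
        prod_encode_mono[of i r j r] by (simp add: index_bound_def)
    have "M dvd a" if "2 * M dvd a" for a using that by (metis dvd_mult_right)
    with 1 2 E show ?thesis unfolding coords_cong_def var_coords_def by auto
  qed
  then have "coords_cong r M (word_coords (var_coords E) w) (word_coords (var_coords E') w)"
    using n by (intro word_coords_cong) blast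
  moreover have "coords_cong r M (coords_prod \<rho>s (relator_exponents E)) (coords_prod \<rho>s (relator_exponents E'))"
    using E by (intro coords_cong_prod) (simp add: relator_exponents_def index_bound_def)
  ultimately show ?thesis using assms(1) unfolding satisfies_def
    by (meson coords_cong_sym coords_cong_trans)
qed

section \<open>Decoding equations and integer sequences\<close>

definition letter_decode :: "nat \<Rightarrow> symbol \<times> bool" where
  "letter_decode c =
     (if (c div 2) mod 2 = 0 then Gen (c div 2 div 2) else Var (c div 2 div 2), c mod 2 = 1)"

definition equation_decode :: "nat \<Rightarrow> equation" where
  "equation_decode n = map letter_decode (list_decode n)"

lemma letter_decode_encode: "letter_decode (2 * symbol_encode s + of_bool e) = (s, e)"
  by (cases s; cases e; simp add: letter_decode_def; presburger)

lemma letter_encode_decode: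
  "(case letter_decode c of (s, e) \<Rightarrow> 2 * symbol_encode s + of_bool e) = c"
proof -
  have "2 * (2 * (c div 2 div 2) + c div 2 mod 2) + c mod 2 = c" by simp
  then show ?thesis by (simp add: letter_decode_def of_bool_def) presburger
qed

lemma equation_decode_encode [simp]: "equation_decode (equation_encode w) = w"
  unfolding equation_decode_def equation_encode_def
  by (simp add: case_prod_unfold letter_decode_encode map_idI)

lemma equation_encode_decode [simp]: "equation_encode (equation_decode n) = n"
proof -
  have "map (\<lambda>(s, e). 2 * symbol_encode s + of_bool e) (map letter_decode xs) = xs" for xs
    by (induction xs) (simp_all only: list.map letter_encode_decode)
  then show ?thesis unfolding equation_decode_def equation_encode_def by simp
qed

text \<open>A list code exceeds its entries and a letter code is at least its variable index, so the
  code of an equation bounds the variables to be searched.\<close>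

lemma equation_decode_var_le:
  assumes "(Var v, e) \<in> set (equation_decode n)" shows "v \<le> n"
proof -
  obtain c where c: "c \<in> set (list_decode n)" "letter_decode c = (Var v, e)"
    using assms unfolding equation_decode_def by auto
  have "v \<le> c" using c(2) by (auto simp: letter_decode_def split: if_splits)
  moreover have "c < n" using mem_less_list_encode[OF c(1)] by simp
  ultimately show ?thesis by simp
qed

lemma length_equation_decode: "length (equation_decode n) = code_length n"
  using code_length_list_encode[of "list_decode n"] by (simp add: equation_decode_def)

lemma nth_equation_decode:
  "p < code_length n \<Longrightarrow> equation_decode n ! p = letter_decode (code_nth n p)"
  using code_nth_list_encode[of "list_decode n" p] code_length_list_encode[of "list_decode n"]
  by (simp add: equation_decode_def)

text \<open>Beyond the end of the coded list the value is 0, as \<open>int_decode 0 = 0\<close>;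
  thus every number denotes a total sequence.\<close>

definition sequence_decode :: "nat \<Rightarrow> nat \<Rightarrow> int" where
  "sequence_decode s k = int_decode (code_nth s k)"

lemma sequence_decode_list_encode:
  "sequence_decode (list_encode (map (\<lambda>k. int_encode (E k)) [0..<D])) k = (if k < D then E k else 0)"
proof -
  have "int_decode 0 = 0" by (simp add: int_decode_def sum_decode_def)
  then show ?thesis by (simp add: sequence_decode_def code_nth_list_encode)
qed

lemma rec_int_sequence_decode [rec_int_intros]:
  "rec_fn n F \<Longrightarrow> rec_fn n G \<Longrightarrow> rec_int n (\<lambda>xs. sequence_decode (F xs) (G xs))"
  unfolding sequence_decode_def by (intro rec_int_intros rec_fn_intros)

lemma rec_int_letter_coords:
  assumes "rec_fn n F" "rec_fn n G"
  shows "rec_int n (\<lambda>xs. fst (letter_coords (var_coords (sequence_decode (F xs))) (letter_decode (G xs))) i)"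
    and "rec_int n (\<lambda>xs. snd (letter_coords (var_coords (sequence_decode (F xs))) (letter_decode (G xs))) i j)"
proof -
  let ?X = "\<lambda>xs. var_coords (sequence_decode (F xs))"
  let ?s = "\<lambda>xs. fst (letter_decode (G xs))"
  have 1: "rec_int n (\<lambda>xs. fst (symbol_coords (?X xs) (?s xs)) i)" for i
    by (rule rec_int_cong[of n "\<lambda>xs. if (G xs div 2) mod 2 = 0 then (if i = G xs div 2 div 2 then 1 else 0)
        else sequence_decode (F xs) (3 * prod_encode (G xs div 2 div 2, i))"])
      (rule assms rec_int_intros rec_fn_intros | simp add: letter_decode_def gen_coords_def var_coords_def)+
  have 2: "rec_int n (\<lambda>xs. snd (symbol_coords (?X xs) (?s xs)) i j)"
    by (rule rec_int_cong[of n "\<lambda>xs. if (G xs div 2) mod 2 = 0 then 0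
        else sequence_decode (F xs) (3 * prod_encode (G xs div 2 div 2, prod_encode (i, j)) + 1)"])
      (rule assms rec_int_intros rec_fn_intros | simp add: letter_decode_def gen_coords_def var_coords_def)+
  show "rec_int n (\<lambda>xs. fst (letter_coords (?X xs) (letter_decode (G xs))) i)"
    by (rule rec_int_cong[of n "\<lambda>xs. if G xs mod 2 = 1 then - fst (symbol_coords (?X xs) (?s xs)) i
        else fst (symbol_coords (?X xs) (?s xs)) i"])
      (rule 1 assms rec_int_intros rec_fn_intros | simp add: letter_coords_def coords_inv_def letter_decode_def)+
  show "rec_int n (\<lambda>xs. snd (letter_coords (?X xs) (letter_decode (G xs))) i j)"
    by (rule rec_int_cong[of n "\<lambda>xs. if G xs mod 2 = 1
        then fst (symbol_coords (?X xs) (?s xs)) i * fst (symbol_coords (?X xs) (?s xs)) j -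
          snd (symbol_coords (?X xs) (?s xs)) i j
        else snd (symbol_coords (?X xs) (?s xs)) i j"])
      (rule 1 2 assms rec_int_intros rec_fn_intros | simp add: letter_coords_def coords_inv_def letter_decode_def)+
qed

lemma rec_int_word_coords:
  assumes F: "rec_fn n F" and G: "rec_fn n G"
  shows "rec_int n (\<lambda>xs. fst (word_coords (var_coords (sequence_decode (F xs))) (equation_decode (G xs))) i)"
    and "rec_int n (\<lambda>xs. snd (word_coords (var_coords (sequence_decode (F xs))) (equation_decode (G xs))) i j)"
proof -
  let ?X = "\<lambda>xs. var_coords (sequence_decode (F xs))"
  let ?l = "\<lambda>xs p. letter_coords (?X xs) (letter_decode (code_nth (G xs) p))"
  have F1: "rec_fn (Suc n) (\<lambda>ys. F (tl ys))" and G1: "rec_fn (Suc n) (\<lambda>ys. G (tl ys))"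
    by (rule rec_fn_tl, rule F) (rule rec_fn_tl, rule G)
  have F2: "rec_fn (Suc (Suc n)) (\<lambda>ys. F (tl (tl ys)))" and G2: "rec_fn (Suc (Suc n)) (\<lambda>ys. G (tl (tl ys)))"
    by (rule rec_fn_tl, rule F1) (rule rec_fn_tl, rule G1)
  have h1: "rec_fn (Suc n) hd" for n
    using rec_fn_hd[OF suffix_of_args_id, of "Suc n"] by simp
  have h2: "rec_fn (Suc (Suc n)) (\<lambda>ys. hd (tl ys))" for n
    by (rule rec_fn_tl, rule h1)
  have "rec_int n (\<lambda>xs. \<Sum>p<code_length (G xs). fst (?l xs p) i)"
    by (rule rec_int_sum) (rule rec_int_letter_coords F1 rec_fn_intros G1 h1 G)+
  then show "rec_int n (\<lambda>xs. fst (word_coords (?X xs) (equation_decode (G xs))) i)"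
    by (rule rec_int_cong) (simp add: fst_word_coords length_equation_decode nth_equation_decode)
  have "rec_int (Suc n) (\<lambda>ys. \<Sum>q<code_length (G (tl ys)). if hd ys < q then fst (?l (tl ys) q) j else 0)"
    by (rule rec_int_sum) (rule rec_int_if rec_int_const rec_pred_less rec_int_letter_coords F2 rec_fn_code_nth rec_fn_code_length G2 h1 h2 G1)+
  then have "rec_int n (\<lambda>xs. \<Sum>p<code_length (G xs). snd (?l xs p) i j +
      fst (?l xs p) i * (\<Sum>q<code_length (G xs). if p < q then fst (?l xs q) j else 0))"
    by (intro rec_int_sum) (assumption | rule rec_int_add rec_int_mult rec_int_letter_coords F1 rec_fn_code_nth rec_fn_code_length G1 h1 G)+
  then show "rec_int n (\<lambda>xs. snd (word_coords (?X xs) (equation_decode (G xs))) i j)"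
    by (rule rec_int_cong)
      (simp add: snd_word_coords length_equation_decode nth_equation_decode cong: if_cong)
qed

text \<open>The relators belong to the group and not to the input, so the product is unfolded
  outside the recursive functions.\<close>

lemma rec_int_coords_prod:
  assumes F: "rec_fn n F"
  shows "rec_int n (\<lambda>xs. fst (coords_prod \<rho>s (relator_exponents (sequence_decode (F xs)))) i)"
    and "rec_int n (\<lambda>xs. snd (coords_prod \<rho>s (relator_exponents (sequence_decode (F xs)))) i j)"
proof (induction \<rho>s arbitrary: i j)
  case Nil
  { case 1 show ?case by (simp add: rec_int_const coords_one_def) }
  { case 2 show ?case by (simp add: rec_int_const coords_one_def) }
next
  case (Cons \<rho> \<rho>s)
  let ?c = "\<lambda>xs. relator_exponents (sequence_decode (F xs)) (length \<rho>s)"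
  have c: "rec_int n ?c" unfolding relator_exponents_def by (intro rec_int_intros F rec_fn_intros)
  { case 1 show ?case
      by (simp add: coords_mult_def coords_pow_def) (intro rec_int_intros c Cons.IH) }
  { case 2 show ?case
      by (simp add: coords_mult_def coords_pow_def) (intro rec_int_intros c Cons.IH) }
qed

lemma rec_pred_satisfies:
  assumes "rec_fn n F" "rec_fn n G" "rec_fn n K"
  shows "rec_pred n (\<lambda>xs. satisfies r \<rho>s (equation_decode (G xs)) (int (K xs)) (sequence_decode (F xs)))"
proof -
  let ?w = "\<lambda>xs. word_coords (var_coords (sequence_decode (F xs))) (equation_decode (G xs))"
  let ?p = "\<lambda>xs. coords_prod \<rho>s (relator_exponents (sequence_decode (F xs)))"
  have "rec_pred n (\<lambda>xs. (\<forall>i\<in>{..<r}. int (K xs) dvd fst (?w xs) i - fst (?p xs) i) \<and>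
      (\<forall>i\<in>{..<r}. \<forall>j\<in>{..<i}. int (K xs) dvd snd (?w xs) i j - snd (?p xs) i j))"
    by (intro rec_pred_conj rec_pred_finite_all rec_pred_int_dvd rec_int_diff rec_int_word_coords rec_int_coords_prod assms
        finite_lessThan)
  then show ?thesis
    by (rule rec_pred_cong) (simp add: satisfies_def coords_cong_def lessThan_iff Ball_def)
qed

lemma rec_pred_is_equation: "rec_pred 1 (\<lambda>xs. is_equation gs (equation_decode (xs ! 0)))"
proof (rule rec_pred_cong)
  show "rec_pred 1 (\<lambda>xs. \<forall>p<code_length (xs ! 0). code_nth (xs ! 0) p div 2 mod 2 = 0 \<longrightarrow>
      code_nth (xs ! 0) p div 2 div 2 < length gs)"
    by (rule rec_pred_all) (rule rec_fn_intros | simp)+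
  fix xs :: "nat list"
  let ?n = "xs ! 0"
  have "is_equation gs w \<longleftrightarrow> (\<forall>p<length w. \<forall>i. fst (w ! p) = Gen i \<longrightarrow> i < length gs)" for w
    unfolding is_equation_def by (metis fst_conv in_set_conv_nth prod.collapse)
  then show "(\<forall>p<code_length ?n. code_nth ?n p div 2 mod 2 = 0 \<longrightarrow> code_nth ?n p div 2 div 2 < length gs) =
      is_equation gs (equation_decode ?n)"
    by (auto simp: length_equation_decode nth_equation_decode letter_decode_def)
qed

text \<open>For the modulus \<open>2 * Suc x\<close> entries are reduced modulo
  \<open>4 * Suc x\<close>, and \<open>int_encode\<close> doubles nonnegative numbers: hence the
  entry bound \<open>8 * Suc x\<close>. The outer \<open>Suc\<close> makes the bound on codes
  strict.\<close>

definition sequence_code_bound :: "nat \<Rightarrow> coords list \<Rightarrow> nat \<Rightarrow> nat \<Rightarrow> nat" where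
  "sequence_code_bound r \<rho>s n x = Suc (list_encode_bound (8 * Suc x) (index_bound r \<rho>s n))"

text \<open>Reducing an exact solution entrywise gives an approximate one with small code. So
  failure of the bounded search for a single modulus refutes solvability.\<close>

lemma satisfies_bounded:
  assumes "satisfies r \<rho>s (equation_decode n) 0 E"
  shows "\<exists>s<sequence_code_bound r \<rho>s n x.
    satisfies r \<rho>s (equation_decode n) (int (2 * Suc x)) (sequence_decode s)"
proof -
  define D where "D = index_bound r \<rho>s n"
  define b where "b = int (4 * Suc x)"
  have b: "b > 0" "2 * int (2 * Suc x) = b" by (simp_all add: b_def)
  define s where "s = list_encode (map (\<lambda>k. int_encode (E k mod b)) [0..<D])"
  have "satisfies r \<rho>s (equation_decode n) (int (2 * Suc x)) E"
    using assms unfolding satisfies_def coords_cong_def by simp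
  then have "satisfies r \<rho>s (equation_decode n) (int (2 * Suc x)) (sequence_decode s)"
  proof (rule satisfies_cong[where n = n])
    fix k assume "k < index_bound r \<rho>s n"
    then have "sequence_decode s k = E k mod b"
      by (simp add: s_def sequence_decode_list_encode D_def)
    then show "2 * int (2 * Suc x) dvd E k - sequence_decode s k"
      unfolding b(2) by (simp add: minus_mod_eq_mult_div)
  qed (rule equation_decode_var_le)
  moreover have "s < sequence_code_bound r \<rho>s n x"
  proof -
    have "int_encode (a mod b) \<le> 8 * Suc x" for a
    proof -
      have "0 \<le> a mod b" "a mod b < b" using b(1) by simp_all
      then have "int_encode (a mod b) = 2 * nat (a mod b)"
        by (simp add: int_encode_def sum_encode_def)
      moreover have "nat (a mod b) \<le> 4 * Suc x" using \<open>a mod b < b\<close> unfolding b_def by linarith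
      ultimately show ?thesis by linarith
    qed
    then have "s \<le> list_encode_bound (8 * Suc x) (length (map (\<lambda>k. int_encode (E k mod b)) [0..<D]))"
      unfolding s_def by (intro list_encode_le_bound) auto
    then show ?thesis by (simp add: sequence_code_bound_def D_def)
  qed
  ultimately show ?thesis by blast
qed

lemma satisfies_exact_code:
  assumes "satisfies r \<rho>s (equation_decode n) 0 E"
  shows "\<exists>s. satisfies r \<rho>s (equation_decode n) 0 (sequence_decode s)"
proof -
  define s where "s = list_encode (map (\<lambda>k. int_encode (E k)) [0..<index_bound r \<rho>s n])"
  have "satisfies r \<rho>s (equation_decode n) 0 (sequence_decode s)"
    using assms
  proof (rule satisfies_cong[where n = n])
    fix k assume "k < index_bound r \<rho>s n"
    then show "2 * 0 dvd E k - sequence_decode s k"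
      by (simp add: s_def sequence_decode_list_encode)
  qed (rule equation_decode_var_le)
  then show ?thesis by blast
qed

text \<open>
  An exact solution and a modulus without approximate solutions are searched for
  simultaneously; the hypotheses say that exactly one of the two searches succeeds.
\<close>

lemma decidable_by_double_search:
  assumes solv: "\<And>w. is_equation gs w \<Longrightarrow> has_solution G gs w \<longleftrightarrow> (\<exists>E. satisfies r \<rho>s w 0 E)"
    and approx: "\<And>w. is_equation gs w \<Longrightarrow>
      (\<And>M::nat. M > 0 \<Longrightarrow> \<exists>E. satisfies r \<rho>s w (int (2 * M)) E) \<Longrightarrow> has_solution G gs w"
  shows "decidable_set (equation_encode ` {w. is_equation gs w \<and> has_solution G gs w})"
proof -
  let ?eq = "\<lambda>n. is_equation gs (equation_decode n)"
  \<comment> \<open>One number \<open>x\<close> serves both searches, as the code of a candidate and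
    as the index of the modulus \<open>2 * Suc x\<close>, which is never 0.\<close>
  define exact where "exact n x \<longleftrightarrow> satisfies r \<rho>s (equation_decode n) 0 (sequence_decode x)" for n x
  define modular where "modular n x \<longleftrightarrow> (\<exists>s<sequence_code_bound r \<rho>s n x.
    satisfies r \<rho>s (equation_decode n) (int (2 * Suc x)) (sequence_decode s))" for n x
  define stop where "stop n x \<longleftrightarrow> \<not> ?eq n \<or> exact n x \<or> \<not> modular n x" for n x
  have exact_iff: "(\<exists>x. exact n x) \<longleftrightarrow> has_solution G gs (equation_decode n)" if "?eq n" for n
    using solv[OF that] satisfies_exact_code[of r \<rho>s n] unfolding exact_def by blast
  have modular: "modular n x" if "exact n y" for n x y
    using satisfies_bounded that unfolding modular_def exact_def by blast
  have ex_stop: "\<exists>x. stop n x" for n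
  proof (rule ccontr)
    assume "\<nexists>x. stop n x"
    then have n: "?eq n" and "\<And>x. \<not> exact n x" and m: "\<And>x. modular n x" by (auto simp: stop_def)
    then have "\<not> has_solution G gs (equation_decode n)" using exact_iff by blast
    moreover have "has_solution G gs (equation_decode n)"
    proof (rule approx[OF n])
      fix M :: nat assume "M > 0"
      then show "\<exists>E. satisfies r \<rho>s (equation_decode n) (int (2 * M)) E"
        using m[of "M - 1"] unfolding modular_def by auto
    qed
    ultimately show False by blast
  qed
  \<comment> \<open>If the equation is solvable, no modulus fails, so the search can only have
    stopped at an exact solution; inspecting the stopping point decides.\<close>
  have found: "exact n (LEAST x. stop n x) \<longleftrightarrow> has_solution G gs (equation_decode n)" if "?eq n" for n
  proof
    assume "exact n (LEAST x. stop n x)"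
    then show "has_solution G gs (equation_decode n)" using exact_iff[OF that] by blast
  next
    assume "has_solution G gs (equation_decode n)"
    then have "\<And>x. modular n x" using exact_iff[OF that] modular by blast
    then show "exact n (LEAST x. stop n x)"
      using LeastI_ex[OF ex_stop[of n]] that by (simp add: stop_def)
  qed
  have eq: "rec_pred 1 (\<lambda>xs. ?eq (xs ! 0))" by (rule rec_pred_is_equation)
  have eq_tl: "rec_pred 2 (\<lambda>xs. ?eq (xs ! 1))"
    using rec_fn_comp1[of "\<lambda>n. of_bool (?eq n)" 2 "\<lambda>xs. xs ! 1"] eq unfolding rec_pred_def
    by (simp add: rec_fn_nth)
  have exact2: "rec_pred 2 (\<lambda>xs. exact (xs ! 1) (xs ! 0))"
    using rec_pred_satisfies[OF rec_fn_nth[of 0 2] rec_fn_nth[of 1 2] rec_fn_const[of 2 0]]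
    unfolding exact_def by simp
  have mod_body: "rec_pred (Suc 2) (\<lambda>ys. satisfies r \<rho>s (equation_decode (tl ys ! 1))
      (int (2 * Suc (tl ys ! 0))) (sequence_decode (hd ys)))"
    by (rule rec_pred_satisfies) (rule rec_fn_intros | simp)+
  have mod_bound: "rec_fn 2 (\<lambda>xs. sequence_code_bound r \<rho>s (xs ! 1) (xs ! 0))"
    unfolding sequence_code_bound_def index_bound_def by (rule rec_fn_nth rec_fn_intros | simp)+
  have modular2: "rec_pred 2 (\<lambda>xs. modular (xs ! 1) (xs ! 0))"
    unfolding modular_def by (rule rec_pred_ex[OF mod_body mod_bound])
  have "rec_pred 2 (\<lambda>xs. stop (xs ! 1) (xs ! 0))"
    unfolding stop_def by (intro rec_pred_disj rec_pred_not eq_tl exact2 modular2)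
  then have "rec_pred (Suc 1) (\<lambda>ys. stop (tl ys ! 0) (hd ys))"
    unfolding numeral_2_eq_2 One_nat_def by (rule rec_pred_cong) (auto simp: length_Suc_conv)
  then have least: "rec_fn 1 (\<lambda>xs. LEAST x. stop (xs ! 0) x)"
    by (rule rec_fn_Least) (rule ex_stop)
  have "rec_pred 1 (\<lambda>xs. exact (xs ! 0) (LEAST x. stop (xs ! 0) x))"
    using rec_pred_satisfies[OF least rec_fn_nth[of 0 1] rec_fn_const[of 1 0]] unfolding exact_def by simp
  with eq have "rec_pred 1 (\<lambda>xs. ?eq (xs ! 0) \<and> exact (xs ! 0) (LEAST x. stop (xs ! 0) x))"
    by (rule rec_pred_conj)
  then have "rec_pred 1 (\<lambda>xs. ?eq (xs ! 0) \<and> has_solution G gs (equation_decode (xs ! 0)))"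
    by (rule rec_pred_cong) (use found in blast)
  then obtain f where f: "\<And>xs. length xs = 1 \<Longrightarrow>
      rec_eval f xs (of_bool (?eq (xs ! 0) \<and> has_solution G gs (equation_decode (xs ! 0))))"
    unfolding rec_pred_def rec_fn_def by blast
  have mem: "n \<in> equation_encode ` {w. is_equation gs w \<and> has_solution G gs w} \<longleftrightarrow>
      ?eq n \<and> has_solution G gs (equation_decode n)" for n
    by (force intro: image_eqI[of _ _ "equation_decode n"])
  show ?thesis unfolding decidable_set_def
    by (rule exI[of _ f]) (use f[of "[_]"] in \<open>simp add: mem of_bool_def\<close>)
qed

section \<open>Decidability for two-step nilpotent groups with rank-one commutator\<close>

lemma (in two_step_group) coords_val_word:
  assumes gs: "set gs \<subseteq> carrier G" and "is_equation gs w"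
  shows "coords_val gs (word_coords X w) = word_value G gs (\<lambda>v. coords_val gs (X v)) w"
  using assms(2)
proof (induction w)
  case Nil
  then show ?case by (simp add: coords_val_one[OF gs])
next
  case (Cons l w)
  have "coords_val gs (symbol_coords X (fst l)) = symbol_value gs (\<lambda>v. coords_val gs (X v)) (fst l)"
    using Cons.prems by (cases "fst l") (auto simp: coords_val_gen[OF gs])
  then show ?case
    using Cons by (simp add: letter_coords_def coords_val_mult[OF gs] coords_val_inv[OF gs] Let_def)
qed

lemma (in group) two_step_groupI:
  assumes "step_nilpotent G 2"
  shows "two_step_group G"
proof unfold_locales
  fix x y z assume xyz: "x \<in> carrier G" "y \<in> carrier G" "z \<in> carrier G"
  define c where "c = commutator G x y"
  have c: "c \<in> carrier G" using xyz by (simp add: c_def commutator_def)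
  have "nested_commutator G [x, y, z] = \<one>"
    using assms xyz unfolding step_nilpotent_def by (auto simp: numeral_2_eq_2 dest: spec[of _ "[x, y, z]"])
  then have "c \<otimes> z \<otimes> inv c \<otimes> inv z = \<one>"
    by (simp add: nested_commutator_def c_def commutator_def)
  then have "c \<otimes> z \<otimes> inv c \<otimes> inv z \<otimes> (z \<otimes> c) = z \<otimes> c" using c xyz by simp
  then have "c \<otimes> z = z \<otimes> c" using c xyz by (simp add: m_assoc) (simp add: m_assoc[symmetric])
  then show "z \<otimes> commutator G x y = commutator G x y \<otimes> z" by (simp add: c_def)
qed

text \<open>\<open>\<tau>\<close> is the integer component of the given isomorphism and
  \<open>N\<close> the order of \<open>T\<close>. Vanishing on all commutators would make
  \<open>\<tau>\<close> vanish on \<open>C\<close>, whereas it attains the value 1.\<close>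

lemma (in two_step_group) rank_one_functional:
  assumes "rank_one_commutator G"
  shows "\<exists>(\<tau> :: 'a \<Rightarrow> int) N :: int. N > 0 \<and> (\<forall>c\<in>C. \<forall>d\<in>C. \<tau> (c \<otimes> d) = \<tau> c + \<tau> d) \<and>
    (\<forall>c\<in>C. \<tau> c = 0 \<longrightarrow> c [^] N = \<one>) \<and>
    (\<exists>x\<in>carrier G. \<exists>y\<in>carrier G. \<tau> (commutator G x y) \<noteq> 0)"
proof -
  obtain T :: "'a monoid" and \<phi> where T: "comm_group T" "finite (carrier T)"
    and \<phi>: "\<phi> \<in> iso (G\<lparr>carrier := C\<rparr>) (integer_group \<times>\<times> T)"
    using assms unfolding rank_one_commutator_def is_iso_def by blast
  interpret T: comm_group T by (rule T)
  define \<tau> where "\<tau> c = fst (\<phi> c)" for c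
  define \<theta> where "\<theta> c = snd (\<phi> c)" for c
  have hom: "\<phi> (c \<otimes> d) = (\<tau> c + \<tau> d, \<theta> c \<otimes>\<^bsub>T\<^esub> \<theta> d)" and \<theta>: "\<theta> c \<in> carrier T"
    if "c \<in> C" "d \<in> C" for c d
    using \<phi> that unfolding iso_def hom_def \<tau>_def \<theta>_def
    by (auto simp: DirProd_def integer_group_def split: prod.splits) (metis mem_Times_iff PiE)+
  have inj: "inj_on \<phi> C" and surj: "\<phi> ` C = UNIV \<times> carrier T"
    using \<phi> unfolding iso_def bij_betw_def by (auto simp: DirProd_def integer_group_def)
  have \<tau>_mult: "\<tau> (c \<otimes> d) = \<tau> c + \<tau> d" if "c \<in> C" "d \<in> C" for c d
    using hom[OF that] by (simp add: \<tau>_def)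
  have \<theta>_mult: "\<theta> (c \<otimes> d) = \<theta> c \<otimes>\<^bsub>T\<^esub> \<theta> d" if "c \<in> C" "d \<in> C" for c d
    using hom[OF that] by (simp add: \<theta>_def)
  have \<tau>_one: "\<tau> \<one> = 0" using \<tau>_mult[of \<one> \<one>] by simp
  have \<theta>_one: "\<theta> \<one> = \<one>\<^bsub>T\<^esub>"
    using \<theta>_mult[of \<one> \<one>] \<theta>[of \<one> \<one>] by simp
  define N where "N = order T"
  have "N > 0" unfolding N_def using T(2) T.order_gt_0_iff_finite by simp
  have pow: "c [^] n \<in> C \<and> \<tau> (c [^] n) = int n * \<tau> c \<and> \<theta> (c [^] n) = \<theta> c [^]\<^bsub>T\<^esub> n"
    if "c \<in> C" for c and n :: nat
    by (induction n) (use that in \<open>simp_all add: \<tau>_one \<theta>_one \<tau>_mult \<theta>_mult algebra_simps\<close>)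
  have ker: "c [^] int N = \<one>" if "c \<in> C" "\<tau> c = 0" for c
  proof -
    have "\<theta> (c [^] N) = \<one>\<^bsub>T\<^esub>"
      using pow[OF that(1), of N] T.pow_order_eq_1[OF \<theta>[OF that(1) that(1)]] by (simp add: N_def)
    moreover have "\<tau> (c [^] N) = 0" using pow[OF that(1), of N] that(2) by simp
    ultimately have "\<phi> (c [^] N) = \<phi> \<one>"
      using \<tau>_one \<theta>_one unfolding \<tau>_def \<theta>_def by (intro prod_eqI) simp_all
    then have "c [^] N = \<one>" using inj pow[OF that(1), of N] by (auto dest: inj_onD)
    then show ?thesis by (simp add: int_pow_int)
  qed
  have "\<exists>x\<in>carrier G. \<exists>y\<in>carrier G. \<tau> (commutator G x y) \<noteq> 0"
  proof (rule ccontr)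
    assume contra: "\<not> ?thesis"
    have "C \<subseteq> {c \<in> C. \<tau> c = 0}"
    proof (rule derived_subset)
      show "subgroup {c \<in> C. \<tau> c = 0} G"
      proof
        show "inv c \<in> {c \<in> C. \<tau> c = 0}" if "c \<in> {c \<in> C. \<tau> c = 0}" for c
          using \<tau>_mult[of c "inv c"] that \<tau>_one by (simp add: C_carrier)
      qed (auto simp: \<tau>_one \<tau>_mult C_carrier)
    qed (use contra in auto)
    then have zero: "\<tau> c = 0" if "c \<in> C" for c using that by blast
    have "(1, \<one>\<^bsub>T\<^esub>) \<in> \<phi> ` C" unfolding surj by simp
    then obtain c where "c \<in> C" "\<phi> c = (1, \<one>\<^bsub>T\<^esub>)" by (metis imageE)
    then show False using zero[of c] by (simp add: \<tau>_def)
  qed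
  with \<open>N > 0\<close> \<tau>_mult ker show ?thesis
    by (intro exI[of _ \<tau>] exI[of _ "int N"]) simp
qed

theorem (in group) EP1_decidable_rank_one:
  assumes "step_nilpotent G 2" and "rank_one_commutator G"
  shows "EP1_decidable G"
proof -
  interpret two_step_group G by (rule two_step_groupI[OF assms(1)])
  obtain \<tau> :: "'a \<Rightarrow> int" and N :: int where \<tau>: "N > 0" "\<forall>c\<in>C. \<forall>d\<in>C. \<tau> (c \<otimes> d) = \<tau> c + \<tau> d"
    "\<forall>c\<in>C. \<tau> c = 0 \<longrightarrow> c [^] N = \<one>"
    "\<exists>x\<in>carrier G. \<exists>y\<in>carrier G. \<tau> (commutator G x y) \<noteq> 0"
    using rank_one_functional[OF assms(2)] by blast
  have "decidable_set (equation_encode ` {w. is_equation gs w \<and> has_solution G gs w})"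
    if gs: "set gs \<subseteq> carrier G" and gen: "generate G (set gs) = carrier G" for gs
  proof -
    obtain R :: int where R: "R > 0"
      "\<forall>h\<in>carrier G. \<forall>k::int. k > 0 \<longrightarrow> h [^] k \<in> C \<longrightarrow> h [^] R \<in> C"
      "\<forall>g\<in>carrier G. (\<forall>M::int. M > 0 \<longrightarrow> (\<exists>h\<in>carrier G. \<exists>c\<in>C. g = h [^] M \<otimes> c)) \<longrightarrow> g \<in> C"
      using relation_lattice_separation[OF gs gen] by blast
    interpret rank_one_group G \<tau> N R
      by unfold_locales (use \<tau> R in blast)+
    obtain \<rho>s where \<rho>s: "\<And>\<rho>. \<rho> \<in> set \<rho>s \<Longrightarrow> coords_val gs \<rho> = \<one>"
      and ker: "\<And>x. coords_val gs x = \<one> \<Longrightarrow> \<exists>c. coords_cong (length gs) 0 x (coords_prod \<rho>s c)"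
      using kernel_generators[OF gs gen] by blast
    have prod_one: "coords_val gs (coords_prod \<rho>s c) = \<one>" for c
      by (rule coords_val_prod[OF gs \<rho>s])
    show ?thesis
    proof (rule decidable_by_double_search[where r = "length gs" and \<rho>s = \<rho>s])
      fix w assume w: "is_equation gs w"
      show "has_solution G gs w \<longleftrightarrow> (\<exists>E. satisfies (length gs) \<rho>s w 0 E)"
      proof
        assume "has_solution G gs w"
        then obtain \<sigma> where \<sigma>: "\<And>j. \<sigma> j \<in> carrier G" "word_value G gs \<sigma> w = \<one>"
          unfolding has_solution_def by blast
        have "\<forall>j. \<exists>x. \<sigma> j = coords_val gs x" using coords_surj[OF gs gen \<sigma>(1)] by blast
        then obtain X where X: "\<And>j. \<sigma> j = coords_val gs (X j)" by metis
        then have "\<sigma> = (\<lambda>j. coords_val gs (X j))" by blast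
        then have "coords_val gs (word_coords X w) = \<one>"
          using \<sigma>(2) coords_val_word[OF gs w, of X] by simp
        then obtain c where c: "coords_cong (length gs) 0 (word_coords X w) (coords_prod \<rho>s c)"
          using ker by blast
        obtain E where "var_coords E = X" "relator_exponents E = c" using ex_sequence by blast
        with c have "satisfies (length gs) \<rho>s w 0 E" by (simp add: satisfies_def)
        then show "\<exists>E. satisfies (length gs) \<rho>s w 0 E" by blast
      next
        assume "\<exists>E. satisfies (length gs) \<rho>s w 0 E"
        then obtain E where "satisfies (length gs) \<rho>s w 0 E" by blast
        then have "coords_val gs (word_coords (var_coords E) w) = \<one>"
          unfolding satisfies_def using coords_val_cong[OF gs] prod_one by metis
        then show "has_solution G gs w"
          unfolding coords_val_word[OF gs w] has_solution_def
          by (intro exI[of _ "\<lambda>v. coords_val gs (var_coords E v)"])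
            (simp add: coords_val_closed[OF gs])
      qed
    next
      fix w assume w: "is_equation gs w"
        and approx: "\<And>M::nat. M > 0 \<Longrightarrow> \<exists>E. satisfies (length gs) \<rho>s w (int (2 * M)) E"
      show "has_solution G gs w"
      proof (rule solvable_if_approximately_solvable[OF gs w])
        fix M :: int assume "M > 0"
        then obtain E where "satisfies (length gs) \<rho>s w (2 * M) E"
          using approx[of "nat M"] by auto
        then have "\<exists>h\<in>carrier G. \<exists>c\<in>C. coords_val gs (word_coords (var_coords E) w) =
            h [^] (2 * M) \<otimes> c [^] M"
          unfolding satisfies_def by (rule coords_val_cong_mod[OF gs _ prod_one])
        then have "word_value G gs (\<lambda>v. coords_val gs (var_coords E v)) w \<in> power_coset M"
          unfolding coords_val_word[OF gs w] power_coset_def by blast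
        then show "\<exists>\<sigma>. (\<forall>i. \<sigma> i \<in> carrier G) \<and> word_value G gs \<sigma> w \<in> power_coset M"
          by (intro exI[of _ "\<lambda>v. coords_val gs (var_coords E v)"])
            (simp add: coords_val_closed[OF gs])
      qed
    qed
  qed
  moreover have "finitely_generated G" using assms(1) unfolding step_nilpotent_def by blast
  ultimately show ?thesis unfolding EP1_decidable_def by blast
qed

section \<open>The Heisenberg group\<close>

definition invert_letter :: "nat \<times> bool \<Rightarrow> nat \<times> bool" where
  "invert_letter x = (fst x, \<not> snd x)"

lemma cancels_iff: "cancels x y \<longleftrightarrow> y = invert_letter x"
  by (auto simp: cancels_def invert_letter_def prod_eq_iff)

lemma invert_invert [simp]: "invert_letter (invert_letter x) = x"
  by (simp add: invert_letter_def)

abbreviation reduced :: "fword \<Rightarrow> bool" where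
  "reduced w \<equiv> successively (\<lambda>x y. \<not> cancels x y) w"

abbreviation reduced_append :: "fword \<Rightarrow> fword \<Rightarrow> fword" where
  "reduced_append v w \<equiv> foldr reduced_Cons v w"

lemma reduced_tl: "reduced (x # w) \<Longrightarrow> reduced w"
  by (cases w) auto

lemma reduced_reduced_Cons: "reduced w \<Longrightarrow> reduced (reduced_Cons x w)"
  by (cases w) (auto intro: reduced_tl)

lemma reduced_reduced_append: "reduced w \<Longrightarrow> reduced (reduced_append v w)"
  by (induction v) (auto intro: reduced_reduced_Cons)

lemma reduced_Cons_reduced: "reduced (x # w) \<Longrightarrow> reduced_Cons x w = x # w"
  by (cases w) auto

text \<open>Letters act on reduced words by permutations; associativity and inverses in the free
  group rest on this.\<close>

lemma reduced_Cons_invert: "reduced w \<Longrightarrow> reduced_Cons (invert_letter x) (reduced_Cons x w) = w"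
  by (cases w; cases "tl w") (auto simp: cancels_iff split: if_splits)

text \<open>The case with content is cancellation of \<open>x\<close> against the first letter
  \<open>y\<close> of \<open>v\<close>: there prepending \<open>x\<close> undoes prepending
  \<open>y\<close>.\<close>

lemma reduced_append_reduced_Cons:
  assumes "reduced v" "reduced w"
  shows "reduced_append (reduced_Cons x v) w = reduced_Cons x (reduced_append v w)"
proof (cases v)
  case (Cons y ys)
  show ?thesis
  proof (cases "cancels x y")
    case True
    then have "x = invert_letter y" by (simp add: cancels_iff)
    then show ?thesis
      using Cons True reduced_Cons_invert[of "reduced_append ys w" y] assms
      by (simp add: reduced_reduced_append)
  qed (use Cons in simp)
qed simp

lemma reduced_append_assoc:
  "reduced v \<Longrightarrow> reduced w \<Longrightarrow>
    reduced_append (reduced_append u v) w = reduced_append u (reduced_append v w)"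
  by (induction u) (simp_all add: reduced_append_reduced_Cons reduced_reduced_append)

lemma reduced_append_inverse:
  "reduced w \<Longrightarrow> reduced_append (map invert_letter (rev w)) w = []"
proof (induction w)
  case (Cons x w)
  have "reduced w" by (rule reduced_tl[OF Cons.prems])
  have "reduced_Cons (invert_letter x) (x # w) = w"
    using reduced_Cons_invert[OF \<open>reduced w\<close>, of x] reduced_Cons_reduced[OF Cons.prems] by simp
  then show ?case using Cons.IH[OF \<open>reduced w\<close>] by simp
qed simp

lemma letters_reduced_append:
  "fst ` set (reduced_append v w) \<subseteq> fst ` set v \<union> fst ` set w"
proof (induction v)
  case (Cons x v)
  have "fst ` set (reduced_Cons x u) \<subseteq> insert (fst x) (fst ` set u)" for u
    by (cases u) auto
  from this[of "reduced_append v w"] Cons show ?case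
    unfolding foldr_Cons o_apply list.set image_insert by blast
qed simp

lemma free_group_carrier:
  "carrier (free_group q) = {w. fst ` set w \<subseteq> {..<q} \<and> reduced w}"
  by (simp add: free_group_def)

lemma free_group_mult [simp]: "v \<otimes>\<^bsub>free_group q\<^esub> w = reduced_append v w"
  by (simp add: free_group_def)

lemma free_group_one [simp]: "\<one>\<^bsub>free_group q\<^esub> = []"
  by (simp add: free_group_def)

lemma group_free_group: "group (free_group q)"
proof (rule groupI)
  fix x y z assume x: "x \<in> carrier (free_group q)"
  { assume y: "y \<in> carrier (free_group q)"
    show "x \<otimes>\<^bsub>free_group q\<^esub> y \<in> carrier (free_group q)"
      using x y order_trans[OF letters_reduced_append[of x y] Un_least]
      by (simp add: free_group_carrier reduced_reduced_append)
    assume "z \<in> carrier (free_group q)"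
    with y show "x \<otimes>\<^bsub>free_group q\<^esub> y \<otimes>\<^bsub>free_group q\<^esub> z =
        x \<otimes>\<^bsub>free_group q\<^esub> (y \<otimes>\<^bsub>free_group q\<^esub> z)"
      by (simp add: free_group_carrier reduced_append_assoc) }
  define y where "y = reduced_append (map invert_letter (rev x)) []"
  have "y \<in> carrier (free_group q)"
    using x letters_reduced_append[of "map invert_letter (rev x)" "[]"]
    unfolding y_def free_group_carrier
    by (auto simp: reduced_reduced_append invert_letter_def image_image)
  moreover have "y \<otimes>\<^bsub>free_group q\<^esub> x = \<one>\<^bsub>free_group q\<^esub>"
    using x by (simp add: y_def free_group_carrier reduced_append_assoc reduced_append_inverse)
  ultimately show "\<exists>y\<in>carrier (free_group q). y \<otimes>\<^bsub>free_group q\<^esub> x = \<one>\<^bsub>free_group q\<^esub>"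
    by blast
  show "\<one>\<^bsub>free_group q\<^esub> \<otimes>\<^bsub>free_group q\<^esub> x = x" by simp
qed (simp add: free_group_carrier)

lemma free_gen_carrier: "i < q \<Longrightarrow> free_gen i \<in> carrier (free_group q)"
  by (simp add: free_group_carrier)

lemma free_group_generated:
  "generate (free_group q) (free_gen ` {..<q}) = carrier (free_group q)"
proof
  interpret F: group "free_group q" by (rule group_free_group)
  let ?S = "free_gen ` {..<q}"
  have S: "?S \<subseteq> carrier (free_group q)" using free_gen_carrier by blast
  show "generate (free_group q) ?S \<subseteq> carrier (free_group q)"
    by (rule F.generate_incl[OF S])
  have sub: "subgroup (generate (free_group q) ?S) (free_group q)"
    by (rule F.generate_is_subgroup[OF S])
  have letter: "[x] \<in> generate (free_group q) ?S" if "fst x < q" for x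
  proof -
    have g: "free_gen (fst x) \<in> generate (free_group q) ?S"
      using that by (intro generate.incl) simp
    show ?thesis
    proof (cases "snd x")
      case False
      then have "[x] = free_gen (fst x)" by (cases x) simp
      then show ?thesis using g by simp
    next
      case True
      have "inv\<^bsub>free_group q\<^esub> free_gen (fst x) = [x]"
        by (rule F.inv_equality)
          (use that True in \<open>auto simp: free_group_carrier cancels_def\<close>)
      then show ?thesis using subgroup.m_inv_closed[OF sub g] by simp
    qed
  qed
  have "w \<in> generate (free_group q) ?S" if "w \<in> carrier (free_group q)" for w
    using that
  proof (induction w)
    case Nil
    then show ?case using subgroup.one_closed[OF sub] by simp
  next
    case (Cons x w)
    have red: "reduced (x # w)" "fst x < q" using Cons.prems by (auto simp: free_group_carrier)
    then have "w \<in> carrier (free_group q)" using Cons.prems reduced_tl[of x w] by (auto simp: free_group_carrier)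
    then have "[x] \<otimes>\<^bsub>free_group q\<^esub> w \<in> generate (free_group q) ?S"
      using Cons.IH letter[OF red(2)] by (intro subgroup.m_closed[OF sub])
    then show ?case using reduced_Cons_reduced[OF red(1)] by simp
  qed
  then show "carrier (free_group q) \<subseteq> generate (free_group q) ?S" by blast
qed

text \<open>\<open>(a, b, c)\<close> is the upper unitriangular matrix with entries \<open>a, b\<close> above the diagonal and corner \<open>c\<close>.\<close>

definition triple_group :: "(int \<times> int \<times> int) monoid" where
  "triple_group = \<lparr>carrier = UNIV,
     monoid.mult = (\<lambda>(a, b, c) (a', b', c'). (a + a', b + b', c + c' + a * b')), one = (0, 0, 0)\<rparr>"

lemma group_triple_group: "group triple_group"
proof (rule groupI)
  fix x :: "int \<times> int \<times> int" assume "x \<in> carrier triple_group"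
  obtain a b c where "x = (a, b, c)" by (cases x)
  then show "\<exists>y\<in>carrier triple_group. y \<otimes>\<^bsub>triple_group\<^esub> x = \<one>\<^bsub>triple_group\<^esub>"
    by (intro bexI[of _ "(- a, - b, a * b - c)"]) (simp_all add: triple_group_def)
qed (auto simp: triple_group_def algebra_simps)

definition letter_triple :: "nat \<times> bool \<Rightarrow> int \<times> int \<times> int" where
  "letter_triple x = (let s = (if snd x then - 1 else 1) in if fst x = 0 then (s, 0, 0) else (0, s, 0))"

primrec word_triple :: "fword \<Rightarrow> int \<times> int \<times> int" where
  "word_triple [] = (0, 0, 0)"
| "word_triple (x # w) = letter_triple x \<otimes>\<^bsub>triple_group\<^esub> word_triple w"

lemma word_triple_reduced_Cons:
  "word_triple (reduced_Cons x w) = letter_triple x \<otimes>\<^bsub>triple_group\<^esub> word_triple w"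
proof (cases w)
  case (Cons y ys)
  obtain a b c where "word_triple ys = (a, b, c)" by (cases "word_triple ys")
  then show ?thesis using Cons
    by (auto simp: cancels_iff invert_letter_def letter_triple_def triple_group_def Let_def)
qed simp

lemma word_triple_hom: "word_triple \<in> hom (free_group q) triple_group"
proof (rule homI)
  fix v w :: fword
  interpret T: group triple_group by (rule group_triple_group)
  have UNIV: "x \<in> carrier triple_group" for x by (simp add: triple_group_def)
  have "word_triple (reduced_append v w) = word_triple v \<otimes>\<^bsub>triple_group\<^esub> word_triple w"
  proof (induction v)
    case Nil
    have "(0, 0, 0) = \<one>\<^bsub>triple_group\<^esub>" by (simp add: triple_group_def)
    then show ?case using T.l_one[OF UNIV] by simp
  next
    case (Cons x v)
    then show ?case by (simp add: word_triple_reduced_Cons T.m_assoc[OF UNIV UNIV UNIV])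
  qed
  then show "word_triple (v \<otimes>\<^bsub>free_group q\<^esub> w) = word_triple v \<otimes>\<^bsub>triple_group\<^esub> word_triple w" by simp
qed (simp add: triple_group_def)

section \<open>Normal closures, two-generator groups and the lower central series\<close>

lemma (in group) normal_closure_normal:
  assumes "S \<subseteq> carrier G" shows "normal_closure G S \<lhd> G"
proof (rule normal_invI)
  have "carrier G \<lhd> G" by (rule normal_invI) (auto intro: subgroup_self)
  then have ne: "{N. N \<lhd> G \<and> S \<subseteq> N} \<noteq> {}" using assms by blast
  show "subgroup (normal_closure G S) G"
    unfolding normal_closure_def by (rule subgroups_Inter[OF _ ne]) (auto intro: normal_imp_subgroup)
  show "x \<otimes> h \<otimes> inv x \<in> normal_closure G S" if "x \<in> carrier G" "h \<in> normal_closure G S" for x h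
    using that unfolding normal_closure_def by (auto intro: normal_invE(2))
qed

lemma subset_normal_closure: "S \<subseteq> normal_closure G S"
  unfolding normal_closure_def by blast

lemma normal_closure_subset: "N \<lhd> G \<Longrightarrow> S \<subseteq> N \<Longrightarrow> normal_closure G S \<subseteq> N"
  unfolding normal_closure_def by blast

lemma (in group_hom) hom_commutator:
  "x \<in> carrier G \<Longrightarrow> y \<in> carrier G \<Longrightarrow> h (commutator G x y) = commutator H (h x) (h y)"
  by (simp add: commutator_def)

lemma (in group) commute_if_commutator_one:
  assumes "x \<in> carrier G" "y \<in> carrier G" "commutator G x y = \<one>"
  shows "x \<otimes> y = y \<otimes> x"
proof -
  have "x \<otimes> y \<otimes> inv x \<otimes> inv y \<otimes> (y \<otimes> x) = y \<otimes> x"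
    using assms unfolding commutator_def by simp
  then show ?thesis using assms(1,2) by (simp add: m_assoc) (simp add: m_assoc[symmetric])
qed

lemma (in group) commutes_generate:
  assumes S: "S \<subseteq> carrier G" and z: "z \<in> carrier G" and comm: "\<And>s. s \<in> S \<Longrightarrow> z \<otimes> s = s \<otimes> z"
    and "g \<in> generate G S"
  shows "z \<otimes> g = g \<otimes> z"
  using assms(4)
proof (induction rule: generate.induct)
  case (inv h)
  then show ?case using commute_inv[OF z _ comm] S by blast
next
  case (eng x y)
  then have xy: "x \<in> carrier G" "y \<in> carrier G" using generate_in_carrier[OF S] by blast+
  then have "z \<otimes> (x \<otimes> y) = (x \<otimes> z) \<otimes> y" using z eng m_assoc[of z x y] by simp
  also have "\<dots> = x \<otimes> y \<otimes> z" using z xy eng by (simp add: m_assoc)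
  finally show ?case .
qed (use z comm in auto)

text \<open>\<open>z\<close> commutes with both generators, so its powers form a central subgroup
  \<open>H\<close>. Modulo \<open>H\<close> the generators commute, hence the quotient is abelian
  and \<open>H\<close> contains the derived subgroup.\<close>

lemma (in group) two_generated_two_step:
  assumes ab: "a \<in> carrier G" "b \<in> carrier G" and gen: "generate G {a, b} = carrier G"
    and z: "z = commutator G a b" and za: "z \<otimes> a = a \<otimes> z" and zb: "z \<otimes> b = b \<otimes> z"
  shows "two_step_group G" and "derived G (carrier G) = range (\<lambda>k::int. z [^] k)"
proof -
  define H where "H = range (\<lambda>k::int. z [^] k)"
  have zc: "z \<in> carrier G" unfolding z using ab by simp
  have "z \<otimes> g = g \<otimes> z" if "g \<in> carrier G" for g
    by (rule commutes_generate[of "{a, b}"]) (use ab zc za zb that gen in auto)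
  then have "z \<in> Z" using zc unfolding Z_def by simp
  then have HZ: "H \<subseteq> Z" unfolding H_def using subgroup_int_pow_closed[OF subgroup_Z] by blast
  have "subgroup H G"
  proof
    show "\<one> \<in> H" unfolding H_def by (rule range_eqI[of _ _ 0]) simp
    show "x \<otimes> y \<in> H" if "x \<in> H" "y \<in> H" for x y
      using that zc unfolding H_def by (auto simp: int_pow_mult[symmetric])
    show "inv x \<in> H" if "x \<in> H" for x
      using that zc unfolding H_def by (auto simp: int_pow_neg[symmetric])
  qed (use HZ Z_carrier in blast)
  then have "H \<lhd> G"
  proof (rule normal_invI)
    fix x h assume "x \<in> carrier G" "h \<in> H"
    then have "x \<otimes> h \<otimes> inv x = h" using HZ Z_comm[of h x] Z_carrier[of h] by (auto simp: m_assoc)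
    then show "x \<otimes> h \<otimes> inv x \<in> H" using \<open>h \<in> H\<close> by simp
  qed
  interpret N: normal H G by fact
  interpret Q: group "G Mod H" by (rule N.factorgroup_is_group)
  interpret p: group_hom G "G Mod H" "\<lambda>x. H #> x" by unfold_locales (rule N.r_coset_hom_Mod)
  let ?a = "H #> a" and ?b = "H #> b"
  have Qab: "{?a, ?b} \<subseteq> carrier (G Mod H)" using p.hom_closed ab by blast
  have genQ: "generate (G Mod H) {?a, ?b} = carrier (G Mod H)"
    using p.generate_img[of "{a, b}"] ab gen by (auto simp: FactGroup_def RCOSETS_def)
  have ba: "?a \<otimes>\<^bsub>G Mod H\<^esub> ?b = ?b \<otimes>\<^bsub>G Mod H\<^esub> ?a"
  proof (rule Q.commute_if_commutator_one)
    have "z \<in> H" unfolding H_def using zc by (intro range_eqI[of _ _ 1]) simp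
    then have "H #> z = H" by (rule coset_join2[OF zc N.subgroup_axioms])
    then show "commutator (G Mod H) ?a ?b = \<one>\<^bsub>G Mod H\<^esub>"
      unfolding p.hom_commutator[OF ab, symmetric] z[symmetric] by (simp add: FactGroup_def)
  qed (use Qab in auto)
  have ab_comm: "s \<otimes>\<^bsub>G Mod H\<^esub> y = y \<otimes>\<^bsub>G Mod H\<^esub> s"
    if "s \<in> {?a, ?b}" "y \<in> carrier (G Mod H)" for s y
    by (rule Q.commutes_generate[OF Qab]) (use that Qab ba genQ in auto)
  have "x \<otimes>\<^bsub>G Mod H\<^esub> y = y \<otimes>\<^bsub>G Mod H\<^esub> x"
    if x: "x \<in> carrier (G Mod H)" and y: "y \<in> carrier (G Mod H)" for x y
  proof (rule Q.commutes_generate[OF Qab x])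
    show "x \<otimes>\<^bsub>G Mod H\<^esub> s = s \<otimes>\<^bsub>G Mod H\<^esub> x" if "s \<in> {?a, ?b}" for s
      by (rule ab_comm[OF that x, symmetric])
    show "y \<in> generate (G Mod H) {?a, ?b}" unfolding genQ by (rule y)
  qed
  then have "comm_group (G Mod H)" by (rule Q.group_comm_groupI)
  then have sub: "derived G (carrier G) \<subseteq> H" by (rule derived_minimal[OF \<open>H \<lhd> G\<close>])
  show "two_step_group G"
  proof unfold_locales
    fix x y g assume "x \<in> carrier G" "y \<in> carrier G" "g \<in> carrier G"
    moreover have "commutator G x y \<in> Z" using calculation(1,2) sub HZ commutator_in_derived by blast
    ultimately show "g \<otimes> commutator G x y = commutator G x y \<otimes> g" by (intro Z_comm)
  qed
  have "z [^] k \<in> derived G (carrier G)" for k :: int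
    unfolding z using ab
    by (intro subgroup_int_pow_closed[OF normal_imp_subgroup[OF derived_self_is_normal]]) simp
  with sub show "derived G (carrier G) = range (\<lambda>k::int. z [^] k)" unfolding H_def by blast
qed

text \<open>As indices start at 0, this is the third term \<open>[[G, G], G]\<close>, the one
  divided out in a free nilpotent group of step two.\<close>

lemma (in group) lower_central_series_two:
  "lower_central_series G 2 =
     generate G {commutator G h g | h g. h \<in> derived G (carrier G) \<and> g \<in> carrier G}"
proof -
  have "{commutator G h g | h g. h \<in> carrier G \<and> g \<in> carrier G} =
      (\<Union>h\<in>carrier G. \<Union>g\<in>carrier G. {h \<otimes> g \<otimes> inv h \<otimes> inv g})"
    by (auto simp: commutator_def)
  then show ?thesis by (simp add: numeral_2_eq_2 derived_def)
qed

lemma (in group) conj_hom: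
  assumes x: "x \<in> carrier G" shows "group_hom G G (\<lambda>y. x \<otimes> y \<otimes> inv x)"
proof unfold_locales
  have "x \<otimes> (c \<otimes> d) \<otimes> inv x = (x \<otimes> c \<otimes> inv x) \<otimes> (x \<otimes> d \<otimes> inv x)"
    if cd: "c \<in> carrier G" "d \<in> carrier G" for c d
  proof -
    have "(x \<otimes> c \<otimes> inv x) \<otimes> (x \<otimes> d \<otimes> inv x) = x \<otimes> c \<otimes> (inv x \<otimes> (x \<otimes> (d \<otimes> inv x)))"
      using x cd by (simp add: m_assoc)
    also have "\<dots> = x \<otimes> c \<otimes> (d \<otimes> inv x)" using x cd by (simp add: m_assoc[symmetric])
    finally show ?thesis using x cd by (simp add: m_assoc)
  qed
  then show "(\<lambda>y. x \<otimes> y \<otimes> inv x) \<in> hom G G" using x by (intro homI) auto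
qed

text \<open>Conjugation takes \<open>[h, g]\<close> to the commutator of the conjugates, whose first
  entry is again in the derived subgroup; so the generating set is invariant.\<close>

lemma (in group) lower_central_series_two_normal: "lower_central_series G 2 \<lhd> G"
  unfolding lower_central_series_two
proof (rule normal_generateI)
  let ?D = "derived G (carrier G)"
  have D: "?D \<lhd> G" by (rule derived_self_is_normal)
  have D_carrier: "h \<in> carrier G" if "h \<in> ?D" for h
    using that subgroup.mem_carrier[OF normal_imp_subgroup[OF D]] by blast
  then show "{commutator G h g | h g. h \<in> ?D \<and> g \<in> carrier G} \<subseteq> carrier G" by auto
  fix c x assume x: "x \<in> carrier G" and "c \<in> {commutator G h g | h g. h \<in> ?D \<and> g \<in> carrier G}"
  then obtain h g where hg: "c = commutator G h g" "h \<in> ?D" "g \<in> carrier G" by blast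
  interpret conj: group_hom G G "\<lambda>y. x \<otimes> y \<otimes> inv x" by (rule conj_hom[OF x])
  have "x \<otimes> c \<otimes> inv x = commutator G (x \<otimes> h \<otimes> inv x) (x \<otimes> g \<otimes> inv x)"
    unfolding hg(1) by (rule conj.hom_commutator[OF D_carrier[OF hg(2)] hg(3)])
  moreover have "x \<otimes> h \<otimes> inv x \<in> ?D" by (rule normal_invE(2)[OF D x hg(2)])
  ultimately show "x \<otimes> c \<otimes> inv x \<in> {commutator G h g | h g. h \<in> ?D \<and> g \<in> carrier G}"
    using conj.hom_closed[OF hg(3)] by blast
qed

lemma (in group) trivial_comm_group:
  "comm_group \<lparr>carrier = {\<one>}, monoid.mult = (\<otimes>), one = \<one>\<rparr>"
  by (rule comm_groupI) auto

text \<open>Here the derived subgroup is infinite cyclic, and \<open>T\<close> is taken to be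
  trivial.\<close>

lemma (in group) rank_one_commutatorI:
  assumes z: "z \<in> carrier G" and inf: "\<And>k::int. z [^] k = \<one> \<Longrightarrow> k = 0"
    and der: "derived G (carrier G) = range (\<lambda>k::int. z [^] k)"
  shows "rank_one_commutator G"
proof -
  define T :: "'a monoid" where "T = \<lparr>carrier = {\<one>}, monoid.mult = (\<otimes>), one = \<one>\<rparr>"
  have T: "comm_group T" unfolding T_def by (rule trivial_comm_group)
  let ?D = "G\<lparr>carrier := derived G (carrier G)\<rparr>"
  let ?h = "\<lambda>(k::int, t::'a). z [^] k"
  have "inj_on ?h (carrier (integer_group \<times>\<times> T))"
  proof (rule inj_onI)
    fix x y assume xy: "x \<in> carrier (integer_group \<times>\<times> T)" "y \<in> carrier (integer_group \<times>\<times> T)"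
      and eq: "?h x = ?h y"
    obtain k l where k: "x = (k, \<one>)" and l: "y = (l, \<one>)"
      using xy by (cases x; cases y) (auto simp: DirProd_def T_def)
    have "z [^] (k - l) = \<one>" using eq z by (simp add: k l int_pow_diff)
    then show "x = y" using inf[of "k - l"] by (simp add: k l)
  qed
  moreover have "?h ` carrier (integer_group \<times>\<times> T) = carrier ?D"
    by (auto simp: der DirProd_def T_def integer_group_def image_iff)
  moreover have "?h \<in> hom (integer_group \<times>\<times> T) ?D"
    using z by (intro homI) (auto simp: der DirProd_def integer_group_def int_pow_mult)
  ultimately have "integer_group \<times>\<times> T \<cong> ?D"
    unfolding is_iso_def iso_def bij_betw_def by blast
  moreover have "group (integer_group \<times>\<times> T)"
    by (rule DirProd_group[OF group_integer_group]) (rule comm_group.axioms(2)[OF T])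
  ultimately have "?D \<cong> integer_group \<times>\<times> T" by (rule group.iso_sym[rotated])
  then show ?thesis unfolding rank_one_commutator_def using T by (intro exI[of _ T]) (simp add: T_def)
qed

section \<open>The Heisenberg group as a quotient of the free group of rank two\<close>

abbreviation "F2 \<equiv> free_group 2"

definition heisenberg_relators :: "fword set" where
  "heisenberg_relators =
     {nested_commutator F2 [free_gen 0, free_gen 1, free_gen 0],
      nested_commutator F2 [free_gen 0, free_gen 1, free_gen 1]}"

definition heisenberg_kernel :: "fword set" where
  "heisenberg_kernel = normal_closure F2 heisenberg_relators"

lemma heisenberg_group_eq: "heisenberg_group = F2 Mod heisenberg_kernel"
  by (simp add: heisenberg_group_def heisenberg_kernel_def heisenberg_relators_def
      presented_group_def Let_def)

interpretation F2: group F2 by (rule group_free_group)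

lemma gens_carrier: "free_gen 0 \<in> carrier F2" "free_gen 1 \<in> carrier F2"
  by (rule free_gen_carrier; simp)+

lemma heisenberg_relators_carrier: "heisenberg_relators \<subseteq> carrier F2"
  using gens_carrier
  by (auto simp: heisenberg_relators_def nested_commutator_def intro!: F2.commutator_closed)

lemma heisenberg_kernel_normal: "heisenberg_kernel \<lhd> F2"
  unfolding heisenberg_kernel_def by (rule F2.normal_closure_normal[OF heisenberg_relators_carrier])

lemma heisenberg_relators_kernel: "heisenberg_relators \<subseteq> heisenberg_kernel"
  unfolding heisenberg_kernel_def by (rule subset_normal_closure)

interpretation K: normal heisenberg_kernel F2 by (rule heisenberg_kernel_normal)

abbreviation "HQ \<equiv> F2 Mod heisenberg_kernel"
abbreviation heis_class :: "fword \<Rightarrow> fword set" where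
  "heis_class w \<equiv> heisenberg_kernel #>\<^bsub>F2\<^esub> w"

interpretation HQ: group HQ by (rule K.factorgroup_is_group)

interpretation class_hom: group_hom F2 HQ heis_class
  by unfold_locales (rule K.r_coset_hom_Mod)

lemma heis_class_surj: "carrier HQ = heis_class ` carrier F2"
  by (auto simp: FactGroup_def RCOSETS_def)

lemma heis_class_one_iff:
  assumes "w \<in> carrier F2" shows "heis_class w = \<one>\<^bsub>HQ\<^esub> \<longleftrightarrow> w \<in> heisenberg_kernel"
  using F2.coset_join1[OF _ assms K.subgroup_axioms] F2.coset_join2[OF assms K.subgroup_axioms]
  by (auto simp: FactGroup_def)

definition "heis_a = heis_class (free_gen 0)"
definition "heis_b = heis_class (free_gen 1)"
definition "heis_z = commutator HQ heis_a heis_b"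

lemma heis_closed: "heis_a \<in> carrier HQ" "heis_b \<in> carrier HQ" "heis_z \<in> carrier HQ"
  using gens_carrier by (auto simp: heis_a_def heis_b_def heis_z_def intro!: HQ.commutator_closed)

lemma heis_generated: "generate HQ {heis_a, heis_b} = carrier HQ"
proof -
  have lt2: "{..<2} = {0, 1 :: nat}" by auto
  have "free_gen ` {..<2} \<subseteq> carrier F2" using free_gen_carrier by blast
  then have "generate HQ (heis_class ` free_gen ` {..<2}) = carrier HQ"
    by (simp only: class_hom.generate_img free_group_generated heis_class_surj)
  moreover have "heis_class ` free_gen ` {..<2} = {heis_a, heis_b}"
    by (simp add: lt2 heis_a_def heis_b_def)
  ultimately show ?thesis by simp
qed

lemma heis_z_commutes:
  "heis_z \<otimes>\<^bsub>HQ\<^esub> heis_a = heis_a \<otimes>\<^bsub>HQ\<^esub> heis_z" "heis_z \<otimes>\<^bsub>HQ\<^esub> heis_b = heis_b \<otimes>\<^bsub>HQ\<^esub> heis_z"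
proof -
  let ?c = "commutator F2 (free_gen 0) (free_gen 1)"
  have c: "?c \<in> carrier F2" by (rule F2.commutator_closed[OF gens_carrier])
  have cz: "heis_class ?c = heis_z"
    unfolding heis_z_def heis_a_def heis_b_def by (rule class_hom.hom_commutator[OF gens_carrier])
  have "commutator HQ heis_z (heis_class x) = \<one>\<^bsub>HQ\<^esub>"
    if "x \<in> carrier F2" "commutator F2 ?c x \<in> heisenberg_relators" for x
  proof -
    have "commutator HQ heis_z (heis_class x) = heis_class (commutator F2 ?c x)"
      unfolding cz[symmetric] by (rule class_hom.hom_commutator[OF c that(1), symmetric])
    also have "\<dots> = \<one>\<^bsub>HQ\<^esub>"
      by (rule iffD2[OF heis_class_one_iff[OF F2.commutator_closed[OF c that(1)]]])
        (rule subsetD[OF heisenberg_relators_kernel that(2)])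
    finally show ?thesis .
  qed
  note one = this
  have "commutator HQ heis_z heis_a = \<one>\<^bsub>HQ\<^esub>"
    unfolding heis_a_def
    by (rule one[OF gens_carrier(1)]) (simp add: heisenberg_relators_def nested_commutator_def)
  then show "heis_z \<otimes>\<^bsub>HQ\<^esub> heis_a = heis_a \<otimes>\<^bsub>HQ\<^esub> heis_z"
    by (rule HQ.commute_if_commutator_one[OF heis_closed(3,1)])
  have "commutator HQ heis_z heis_b = \<one>\<^bsub>HQ\<^esub>"
    unfolding heis_b_def
    by (rule one[OF gens_carrier(2)]) (simp add: heisenberg_relators_def nested_commutator_def)
  then show "heis_z \<otimes>\<^bsub>HQ\<^esub> heis_b = heis_b \<otimes>\<^bsub>HQ\<^esub> heis_z"
    by (rule HQ.commute_if_commutator_one[OF heis_closed(3,2)])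
qed

lemma heis_two_step: "two_step_group HQ"
  and heis_derived: "derived HQ (carrier HQ) = range (\<lambda>k::int. heis_z [^]\<^bsub>HQ\<^esub> k)"
  by (rule HQ.two_generated_two_step[OF heis_closed(1,2) heis_generated heis_z_def heis_z_commutes])+

text \<open>The relators hold among unitriangular matrices, so the matrix map is trivial on the
  normal closure; it sends the commutator of the generators to \<open>(0, 0, 1)\<close>, whose
  \<open>k\<close>-th power has corner \<open>k\<close>.\<close>

lemma heis_z_infinite_order:
  assumes "heis_z [^]\<^bsub>HQ\<^esub> (k::int) = \<one>\<^bsub>HQ\<^esub>" shows "k = 0"
proof -
  interpret T: group triple_group by (rule group_triple_group)
  interpret ev: group_hom F2 triple_group word_triple
    by unfold_locales (rule word_triple_hom)
  have inv: "inv\<^bsub>triple_group\<^esub> (a, b, c) = (- a, - b, a * b - c)" for a b c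
    by (rule T.inv_equality) (simp_all add: triple_group_def)
  let ?c = "commutator F2 (free_gen 0) (free_gen 1)"
  have c: "?c \<in> carrier F2" by (rule F2.commutator_closed[OF gens_carrier])
  have mult: "(a, b, c) \<otimes>\<^bsub>triple_group\<^esub> (a', b', c') = (a + a', b + b', c + c' + a * b')"
    for a b c a' b' c' by (simp add: triple_group_def)
  have evg: "word_triple (free_gen 0) = (1, 0, 0)" "word_triple (free_gen 1) = (0, 1, 0)"
    by (simp_all add: letter_triple_def mult)
  have evc: "word_triple ?c = (0, 0, 1)"
    unfolding ev.hom_commutator[OF gens_carrier] evg by (simp add: commutator_def inv mult)
  have "heisenberg_relators \<subseteq> kernel F2 triple_group word_triple"
  proof -
    have "word_triple (commutator F2 ?c x) = \<one>\<^bsub>triple_group\<^esub>" if "x \<in> carrier F2" for x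
    proof -
      obtain p q r where x: "word_triple x = (p, q, r)" by (cases "word_triple x")
      show ?thesis
        unfolding ev.hom_commutator[OF c that] evc x
        by (simp add: commutator_def inv mult) (simp add: triple_group_def)
    qed
    then show ?thesis using heisenberg_relators_carrier gens_carrier
      by (auto simp: heisenberg_relators_def nested_commutator_def kernel_def)
  qed
  then have ker: "heisenberg_kernel \<subseteq> kernel F2 triple_group word_triple"
    unfolding heisenberg_kernel_def by (rule normal_closure_subset[OF ev.normal_kernel])
  have cz: "heis_class ?c = heis_z"
    unfolding heis_z_def heis_a_def heis_b_def by (rule class_hom.hom_commutator[OF gens_carrier])
  have "heis_class (?c [^]\<^bsub>F2\<^esub> k) = \<one>\<^bsub>HQ\<^esub>"
    unfolding class_hom.hom_int_pow[OF c] cz by (rule assms)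
  then have "?c [^]\<^bsub>F2\<^esub> k \<in> heisenberg_kernel"
    using heis_class_one_iff[OF F2.int_pow_closed[OF c]] by simp
  then have "word_triple (?c [^]\<^bsub>F2\<^esub> k) = \<one>\<^bsub>triple_group\<^esub>" using ker by (auto simp: kernel_def)
  moreover have "word_triple (?c [^]\<^bsub>F2\<^esub> k) = (0, 0, 1) [^]\<^bsub>triple_group\<^esub> k"
    unfolding ev.hom_int_pow[OF c] evc ..
  moreover have "(0, 0, k) = (0, 0, 1) [^]\<^bsub>triple_group\<^esub> k"
    by (rule T.int_pow_unique[of _ "\<lambda>k. (0, 0, k)"]) (simp_all add: triple_group_def)
  ultimately show ?thesis by (simp add: triple_group_def)
qed

lemma heis_step_nilpotent: "step_nilpotent HQ 2"
proof -
  interpret Q: two_step_group HQ by (rule heis_two_step)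
  have "nested_commutator HQ xs = \<one>\<^bsub>HQ\<^esub>" if xs: "set xs \<subseteq> carrier HQ" "length xs = 2 + 1" for xs
  proof -
    obtain x y w where "xs = [x, y, w]"
      using xs(2) by (auto simp: numeral_2_eq_2 length_Suc_conv)
    then show ?thesis using xs(1)
      by (simp add: nested_commutator_def Q.commutator_Z_one(2) Q.commutator_Z)
  qed
  moreover have "nested_commutator HQ [heis_a, heis_b] \<noteq> \<one>\<^bsub>HQ\<^esub>"
  proof
    assume "nested_commutator HQ [heis_a, heis_b] = \<one>\<^bsub>HQ\<^esub>"
    then have "heis_z [^]\<^bsub>HQ\<^esub> (1::int) = \<one>\<^bsub>HQ\<^esub>"
      using heis_closed(3) by (simp add: nested_commutator_def heis_z_def)
    then have "(1::int) = 0" by (rule heis_z_infinite_order)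
    then show False by simp
  qed
  moreover have "finitely_generated HQ"
    unfolding finitely_generated_def using heis_closed heis_generated
    by (intro exI[of _ "{heis_a, heis_b}"]) simp
  ultimately show ?thesis
    unfolding step_nilpotent_def using HQ.group_axioms heis_closed
    by (auto intro!: exI[of _ "[heis_a, heis_b]"])
qed

lemma heis_rank_one: "rank_one_commutator HQ"
  by (rule HQ.rank_one_commutatorI[OF heis_closed(3) heis_z_infinite_order heis_derived])

text \<open>The relators lie in the normal subgroup \<open>[[F, F], F]\<close>; conversely the
  presented group has central commutators, which puts every \<open>[h, g]\<close> with
  \<open>h\<close> in the derived subgroup into the kernel. The two quotients of \<open>F2\<close>
  are therefore equal, not merely isomorphic.\<close>

lemma heisenberg_kernel_eq: "heisenberg_kernel = lower_central_series F2 2"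
proof
  let ?c = "commutator F2 (free_gen 0) (free_gen 1)"
  have c: "?c \<in> derived F2 (carrier F2)"
    unfolding derived_def commutator_def by (intro generate.incl) (use gens_carrier in blast)
  have "commutator F2 ?c x \<in> lower_central_series F2 2" if "x \<in> carrier F2" for x
    unfolding F2.lower_central_series_two by (rule generate.incl) (use c that in blast)
  from this[OF gens_carrier(1)] this[OF gens_carrier(2)]
  have "heisenberg_relators \<subseteq> lower_central_series F2 2"
    by (simp add: heisenberg_relators_def nested_commutator_def)
  then show "heisenberg_kernel \<subseteq> lower_central_series F2 2"
    unfolding heisenberg_kernel_def by (rule normal_closure_subset[OF F2.lower_central_series_two_normal])
next
  interpret Q: two_step_group HQ by (rule heis_two_step)
  have derived: "h \<in> carrier F2" "heis_class h \<in> HQ.Z" if "h \<in> derived F2 (carrier F2)" for h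
  proof -
    show "h \<in> carrier F2" by (rule subsetD[OF F2.derived_in_carrier[OF order_refl] that])
    have "heis_class h \<in> derived HQ (heis_class ` carrier F2)"
      unfolding class_hom.derived_img[OF order_refl] by (rule imageI[OF that])
    then show "heis_class h \<in> HQ.Z"
      unfolding heis_class_surj[symmetric] by (rule subsetD[OF Q.C_subset_Z])
  qed
  have "commutator F2 h g \<in> heisenberg_kernel" if "h \<in> derived F2 (carrier F2)" "g \<in> carrier F2" for h g
  proof -
    note h = derived[OF that(1)]
    have "heis_class (commutator F2 h g) = \<one>\<^bsub>HQ\<^esub>"
      unfolding class_hom.hom_commutator[OF h(1) that(2)]
      by (rule Q.commutator_Z_one(2)[OF class_hom.hom_closed[OF that(2)] h(2)])
    then show ?thesis using heis_class_one_iff[OF F2.commutator_closed[OF h(1) that(2)]] by blast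
  qed
  then show "lower_central_series F2 2 \<subseteq> heisenberg_kernel"
    unfolding F2.lower_central_series_two
    by (intro F2.generate_subgroup_incl[OF _ K.subgroup_axioms]) blast
qed

theorem theorem3:
  shows "(\<forall>G :: ('a, 'b) monoid_scheme.
            group G \<and> step_nilpotent G 2 \<and> rank_one_commutator G \<longrightarrow> EP1_decidable G) \<and>
         heisenberg_group \<cong> free_nilpotent_group 2 2 \<and>
         EP1_decidable heisenberg_group"
proof (intro conjI allI impI)
  fix G :: "('a, 'b) monoid_scheme"
  assume "group G \<and> step_nilpotent G 2 \<and> rank_one_commutator G"
  then show "EP1_decidable G" using group.EP1_decidable_rank_one by blast
next
  show "heisenberg_group \<cong> free_nilpotent_group 2 2"
    by (simp only: heisenberg_group_eq free_nilpotent_group_def heisenberg_kernel_eq iso_refl)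
  show "EP1_decidable heisenberg_group"
    unfolding heisenberg_group_eq
    by (rule HQ.EP1_decidable_rank_one[OF heis_step_nilpotent heis_rank_one])
qed

end
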